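(* Assume (C1), (C2) and (C3), and suppose that for every $z\in\mathcal Z$ the indicator $I(Z=z)$ is an affine function of $X$. Let $\hat b_1,\dots,\hat b_k$ be $p$-vectors with $\hat b_t\to b_t$ in probability, and put $B=(b_1,\dots,b_k)$. (i) As $n\to\infty$, $\sqrt n\{\hat\theta(\hat b_1,\dots,\hat b_k)-\theta\}\to N(0,V(B))$ in distribution, where $$V(B)=V_{\rm SR}(B)-E\big[R(B)\{\Omega_{\rm SR}-\Omega(Z_i)\}R(B)\big],$$ with $V_{\rm SR}(B)=\mathrm{diag}\{\pi_t^{-1}\mathrm{var}(Y^{(t)}-b_t^\top X)\}+\mathscr B^\top\Sigma_XB+B^\top\Sigma_X\mathscr B-B^\top\Sigma_XB$, $\Omega_{\rm SR}=\mathrm{diag}(\pi_t)-\pi\pi^\top$, $\pi=(\pi_1,\dots,\pi_k)^\top$, and $R(B)=\mathrm{diag}\big(\pi_t^{-1}E\{Y_i^{(t)}-\theta_t-b_t^\top(X_i-\mu_X)\mid Z_i\}\big)$. Moreover $R(\mathscr B)=0$, hence $V(\mathscr B)=V_{\rm SR}(\mathscr B)$. (ii) $V(B)-V(\mathscr B)$ is positive semidefinite for every $p\times k$ matrix $B$.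
   Context: Setup: $k$ arms; potential responses $Y^{(1)},\dots,Y^{(k)}$; discrete covariate $Z$; $p$-dimensional covariate $X$. (C1): $(Y_i^{(1)},\dots,Y_i^{(k)},Z_i,X_i)$, $i=1,\dots,n$, i.i.d. with finite second moments, covariate distribution unaffected by treatment, $\Sigma_X=\mathrm{var}(X)$ positive definite. $\pi_t\in(0,1)$, $\sum_t\pi_t=1$. $A_i\in\{a_1,\dots,a_k\}$ ($a_t$ the standard basis vectors of $\mathbb R^k$), $Y_i=Y_i^{(t)}$ iff $A_i=a_t$. (C2): $Z$ takes values in a finite set $\mathcal Z$; (i) given $\{Z_i\}$, $\{A_i\}$ is conditionally independent of $\{(Y_i^{(1)},\dots,Y_i^{(k)},X_i)\}$; (ii) $n_t(z)/n(z)\to\pi_t$ a.s. for all $z,t$, where $n(z)=\#\{i:Z_i=z\}$, $n_t(z)=\#\{i:Z_i=z,A_i=a_t\}$. (C3): there exist $k\times k$ matrices $\Omega(z)$, $z\in\mathcal Z$, such that conditionally on $Z_1,\dots,Z_n$, $\sqrt n\big(n_1(z)/n(z)-\pi_1,\dots,n_k(z)/n(z)-\pi_k,\ z\in\mathcal Z\big)^\top\to N(0,D)$ in distribution, where $D$ is block diagonal with blocks $\Omega(z)/P(Z_i=z)$, $z\in\mathcal Z$. Notation: $\theta_t=EY^{(t)}$, $\mu_X=EX$, $\beta_t=\Sigma_X^{-1}\mathrm{cov}(X,Y^{(t)})$, $\mathscr B=(\beta_1,\dots,\beta_k)$, $\mathrm{diag}(d_t)$ the diagonal $k\times k$ matrix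 with entries $d_t$. $\hat\theta(\hat b_1,\dots,\hat b_k)=(\bar Y_1-\hat b_1^\top(\bar X_1-\bar X),\dots,\bar Y_k-\hat b_k^\top(\bar X_k-\bar X))^\top$ with $\bar Y_t,\bar X_t$ arm-$t$ sample means and $\bar X$ the overall mean of $X_i$. (Components of $b_t$ corresponding to dummy variables for $Z$ may be zero, so this covers estimators not adjusting for $Z$.) *)

theory Defs
  imports "HOL-Probability.Probability"
begin

definition psd :: "real^'n^'n \<Rightarrow> bool" where
  "psd S \<longleftrightarrow> transpose S = S \<and> (\<forall>x. 0 \<le> x \<bullet> (S *v x))"

definition posdef :: "real^'n^'n \<Rightarrow> bool" where
  "posdef S \<longleftrightarrow> transpose S = S \<and> (\<forall>x. x \<noteq> 0 \<longrightarrow> 0 < x \<bullet> (S *v x))"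

definition diagm :: "('n \<Rightarrow> real) \<Rightarrow> real^'n^'n" where
  "diagm d = (\<chi> i j. if i = j then d i else 0)"

definition col :: "real^'k^'p \<Rightarrow> 'k \<Rightarrow> real^'p" where
  "col B t = (\<chi> j. B $ j $ t)"

abbreviation std_gauss :: "(real^'n) measure" where
  "std_gauss \<equiv> density lborel (\<lambda>x. ennreal (\<Prod>i\<in>UNIV. std_normal_density (x $ i)))"

definition mvnormal :: "real^'n^'n \<Rightarrow> (real^'n) measure" where
  "mvnormal V = distr std_gauss borel (\<lambda>x. (SOME L::real^'n^'n. L ** transpose L = V) *v x)"

definition conv_distr :: "'a measure \<Rightarrow> (nat \<Rightarrow> 'a \<Rightarrow> 'b::real_normed_vector) \<Rightarrow> 'b measure \<Rightarrow> bool" where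
  "conv_distr M W \<mu> \<longleftrightarrow>
     (\<forall>f::'b \<Rightarrow> real. continuous_on UNIV f \<and> bounded (range f) \<longrightarrow>
        (\<lambda>n. \<integral>\<omega>. f (W n \<omega>) \<partial>M) \<longlonglongrightarrow> (\<integral>x. f x \<partial>\<mu>))"

definition conv_normal :: "'a measure \<Rightarrow> (nat \<Rightarrow> 'a \<Rightarrow> real^'n) \<Rightarrow> real^'n^'n \<Rightarrow> bool" where
  "conv_normal M W V \<longleftrightarrow> psd V \<and> conv_distr M W (mvnormal V)"

definition cond_expect_at :: "'a measure \<Rightarrow> ('a \<Rightarrow> 'g) \<Rightarrow> ('a \<Rightarrow> real) \<Rightarrow> 'a \<Rightarrow> real" where
  "cond_expect_at M G g \<omega> =
     (\<integral>\<omega>'. g \<omega>' * indicator {\<omega>'\<in>space M. G \<omega>' = G \<omega>} \<omega>' \<partial>M)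
       / measure M {\<omega>'\<in>space M. G \<omega>' = G \<omega>}"

definition cond_prob_at :: "'a measure \<Rightarrow> ('a \<Rightarrow> 'g) \<Rightarrow> 'a set \<Rightarrow> 'a \<Rightarrow> real" where
  "cond_prob_at M G S \<omega> =
     measure M (S \<inter> {\<omega>'\<in>space M. G \<omega>' = G \<omega>}) / measure M {\<omega>'\<in>space M. G \<omega>' = G \<omega>}"

definition cond_indep :: "'a measure \<Rightarrow> ('a \<Rightarrow> 'g) \<Rightarrow> 'a set set \<Rightarrow> 'a set set \<Rightarrow> bool" where
  "cond_indep M G SA SB \<longleftrightarrow>
     (\<forall>S\<in>SA. \<forall>T\<in>SB. AE \<omega> in M.
        cond_prob_at M G (S \<inter> T) \<omega> = cond_prob_at M G S \<omega> * cond_prob_at M G T \<omega>)"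

definition cond_conv_normal :: "'a measure \<Rightarrow> (nat \<Rightarrow> 'a \<Rightarrow> 'g) \<Rightarrow> (nat \<Rightarrow> 'a \<Rightarrow> real^'n)
    \<Rightarrow> real^'n^'n \<Rightarrow> bool" where
  "cond_conv_normal M G U V \<longleftrightarrow> psd V \<and>
     (AE \<omega> in M. \<forall>f::real^'n \<Rightarrow> real. continuous_on UNIV f \<and> bounded (range f) \<longrightarrow>
        (\<lambda>n. cond_expect_at M (G n) (\<lambda>\<omega>'. f (U n \<omega>')) \<omega>) \<longlonglongrightarrow> (\<integral>x. f x \<partial>mvnormal V))"

section \<open>Population quantities (computed from the generic unit i = 0)\<close>

definition theta :: "'a measure \<Rightarrow> ('a \<Rightarrow> real^'k) \<Rightarrow> real^'k" where
  "theta M Y = (\<chi> t. \<integral>\<omega>. Y \<omega> $ t \<partial>M)"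

definition muX :: "'a measure \<Rightarrow> ('a \<Rightarrow> real^'p) \<Rightarrow> real^'p" where
  "muX M X = (\<chi> j. \<integral>\<omega>. X \<omega> $ j \<partial>M)"

definition SigmaX :: "'a measure \<Rightarrow> ('a \<Rightarrow> real^'p) \<Rightarrow> real^'p^'p" where
  "SigmaX M X = (\<chi> j l. \<integral>\<omega>. (X \<omega> $ j - muX M X $ j) * (X \<omega> $ l - muX M X $ l) \<partial>M)"

definition covXY :: "'a measure \<Rightarrow> ('a \<Rightarrow> real^'k) \<Rightarrow> ('a \<Rightarrow> real^'p) \<Rightarrow> 'k \<Rightarrow> real^'p" where
  "covXY M Y X t = (\<chi> j. \<integral>\<omega>. (X \<omega> $ j - muX M X $ j) * (Y \<omega> $ t - theta M Y $ t) \<partial>M)"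

definition betaM :: "'a measure \<Rightarrow> ('a \<Rightarrow> real^'k) \<Rightarrow> ('a \<Rightarrow> real^'p) \<Rightarrow> real^'k^'p" where
  "betaM M Y X = (\<chi> j t. (matrix_inv (SigmaX M X) *v covXY M Y X t) $ j)"

definition V_SR :: "'a measure \<Rightarrow> ('a \<Rightarrow> real^'k) \<Rightarrow> ('a \<Rightarrow> real^'p) \<Rightarrow> real^'k
    \<Rightarrow> real^'k^'p \<Rightarrow> real^'k^'k" where
  "V_SR M Y X pv B =
     diagm (\<lambda>t. (\<integral>\<omega>. (Y \<omega> $ t - col B t \<bullet> X \<omega>
                      - (\<integral>\<omega>'. Y \<omega>' $ t - col B t \<bullet> X \<omega>' \<partial>M))\<^sup>2 \<partial>M) / pv $ t)
     + transpose (betaM M Y X) ** SigmaX M X ** B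
     + transpose B ** SigmaX M X ** betaM M Y X
     - transpose B ** SigmaX M X ** B"

definition Omega_SR :: "real^'k \<Rightarrow> real^'k^'k" where
  "Omega_SR pv = diagm (\<lambda>t. pv $ t) - (\<chi> i j. pv $ i * pv $ j)"

definition Rm :: "'a measure \<Rightarrow> ('a \<Rightarrow> real^'k) \<Rightarrow> ('a \<Rightarrow> real^'p) \<Rightarrow> ('a \<Rightarrow> 'z) \<Rightarrow> real^'k
    \<Rightarrow> real^'k^'p \<Rightarrow> 'z \<Rightarrow> real^'k^'k" where
  "Rm M Y X Z pv B z =
     diagm (\<lambda>t. ((\<integral>\<omega>. (Y \<omega> $ t - theta M Y $ t - col B t \<bullet> (X \<omega> - muX M X))
                        * indicator {\<omega>\<in>space M. Z \<omega> = z} \<omega> \<partial>M)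
                  / measure M {\<omega>\<in>space M. Z \<omega> = z}) / pv $ t)"

definition Vm :: "'a measure \<Rightarrow> ('a \<Rightarrow> real^'k) \<Rightarrow> ('a \<Rightarrow> real^'p) \<Rightarrow> ('a \<Rightarrow> 'z::finite) \<Rightarrow> real^'k
    \<Rightarrow> ('z \<Rightarrow> real^'k^'k) \<Rightarrow> real^'k^'p \<Rightarrow> real^'k^'k" where
  "Vm M Y X Z pv Om B =
     V_SR M Y X pv B
     - (\<Sum>z\<in>UNIV. measure M {\<omega>\<in>space M. Z \<omega> = z}
          *\<^sub>R (Rm M Y X Z pv B z ** (Omega_SR pv - Om z) ** Rm M Y X Z pv B z))"

definition ncount :: "(nat \<Rightarrow> nat \<Rightarrow> 'a \<Rightarrow> 'k) \<Rightarrow> nat \<Rightarrow> 'k \<Rightarrow> 'a \<Rightarrow> nat" where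
  "ncount A n t \<omega> = card {i. i < n \<and> A n i \<omega> = t}"

text \<open>Sample of size n consists of units 0..n-1; A n i = arm of unit i in the n-th experiment.\<close>
definition thetahat :: "(nat \<Rightarrow> 'a \<Rightarrow> real^'k) \<Rightarrow> (nat \<Rightarrow> 'a \<Rightarrow> real^'p) \<Rightarrow> (nat \<Rightarrow> nat \<Rightarrow> 'a \<Rightarrow> 'k)
    \<Rightarrow> (nat \<Rightarrow> 'k \<Rightarrow> 'a \<Rightarrow> real^'p) \<Rightarrow> nat \<Rightarrow> 'a \<Rightarrow> real^'k" where
  "thetahat Y X A bhat n \<omega> = (\<chi> t.
      (\<Sum>i | i < n \<and> A n i \<omega> = t. Y i \<omega> $ t) / real (ncount A n t \<omega>)
      - bhat n t \<omega> \<bullet> ((1 / real (ncount A n t \<omega>)) *\<^sub>R (\<Sum>i | i < n \<and> A n i \<omega> = t. X i \<omega>)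
                       - (1 / real n) *\<^sub>R (\<Sum>i<n. X i \<omega>)))"

end

theory Submission
  imports Defs
begin

text \<open>
  Write \<open>r\<^sub>t\<close> for the residual \<open>Y\<^sub>t - \<theta>\<^sub>t - b\<^sub>t \<bullet> (X - \<mu>)\<close> and \<open>m\<^sub>t(z)\<close> for its mean in stratum \<open>z\<close>.
  Up to an error that is negligible in probability, the scaled estimation error in arm \<open>t\<close> is
  the sum of \<open>(r\<^sub>t - m\<^sub>t(Z)) / \<pi>\<^sub>t\<close> over the arm and of \<open>b\<^sub>t \<bullet> (X - E[X | Z])\<close> over all units, a fixed linear function of the
  imbalances \<open>n\<^sub>t(z) / n(z) - \<pi>\<^sub>t\<close>, and a sum that depends on the strata only.
  Given strata and assignments the first part is a sum of independent centred terms, so its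
  characteristic function is a product of powers with exponents \<open>n\<^sub>t(z)\<close>, which converges to a
  constant because \<open>n\<^sub>t(z) / n\<close> converges; given the strata the second part is asymptotically
  normal by (C3); the third part obeys the classical central limit theorem. The characteristic
  functions multiply, and Levy's continuity theorem yields the limit law. The total variance
  equals \<open>V(B)\<close> by the law of total covariance.

  Since stratum indicators are affine in \<open>X\<close>, the least squares residuals have mean zero in each stratum, hence
  \<open>R(\<B>) = 0\<close>; with \<open>d\<^sub>t = (\<beta>\<^sub>t - b\<^sub>t) \<bullet> (X - E[X | Z])\<close> the difference \<open>V(B) - V(\<B>)\<close> is
  \<open>E[diag(d\<^sub>t\<^sup>2 / \<pi>\<^sub>t) - d d\<^sup>T] + E[R \<Omega>(Z) R]\<close>, which is positive semidefinite by the
  Cauchy-Schwarz inequality.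
\<close>

subsection \<open>Positive semidefinite matrices and the normal law\<close>

lemma psd_cauchy_schwarz:
  fixes V :: "real^'n^'n"
  assumes "psd V"
  shows "(x \<bullet> (V *v y))\<^sup>2 \<le> (x \<bullet> (V *v x)) * (y \<bullet> (V *v y))"
proof -
  define a b d where "a = x \<bullet> (V *v x)" and "b = x \<bullet> (V *v y)" and "d = y \<bullet> (V *v y)"
  have sym: "y \<bullet> (V *v x) = b"
    using assms unfolding psd_def b_def by (metis dot_lmul_matrix inner_commute vector_transpose_matrix)
  have nonneg: "0 \<le> z \<bullet> (V *v z)" for z
    using assms by (auto simp: psd_def)
  have q: "0 \<le> a - 2 * c * b + c\<^sup>2 * d" for c
  proof -
    have "(x - c *\<^sub>R y) \<bullet> (V *v (x - c *\<^sub>R y)) = a - 2 * c * b + c\<^sup>2 * d"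
      using sym by (simp add: a_def b_def d_def matrix_vector_mult_diff_distrib inner_diff_left inner_diff_right
          matrix_vector_mult_scaleR power2_eq_square algebra_simps)
    then show ?thesis using nonneg[of "x - c *\<^sub>R y"] by simp
  qed
  have "b\<^sup>2 \<le> a * d"
  proof (cases "d = 0")
    case True
    have "b = 0"
    proof (rule ccontr)
      assume "b \<noteq> 0"
      then show False using q[of "(a + 1) / (2 * b)"] True by (simp add: field_simps)
    qed
    then show ?thesis using True by simp
  next
    case False
    then have "d > 0" using nonneg[of y] by (simp add: d_def)
    then show ?thesis using q[of "b / d"] by (simp add: power2_eq_square field_simps)
  qed
  then show ?thesis by (simp add: a_def b_def d_def)
qed

lemma axis_matrix_axis: "axis i 1 \<bullet> (V *v axis j 1) = (V::real^'n^'m) $ i $ j"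
  by (simp add: inner_axis' matrix_vector_mult_basis column_def)

lemma inner_matrix_axis: "x \<bullet> (V *v axis k 1) = (\<Sum>i\<in>UNIV. x $ i * (V::real^'n^'m) $ i $ k)"
  by (simp add: matrix_vector_mult_basis column_def inner_vec_def)

lemma inner_matrix_vector: "x \<bullet> (V *v y) = (\<Sum>i\<in>UNIV. \<Sum>j\<in>UNIV. x $ i * y $ j * (V::real^'n^'m) $ i $ j)"
  by (simp add: inner_vec_def matrix_vector_mult_def sum_distrib_left mult_ac)

text \<open>Symmetric Gaussian elimination: subtracting the rank-one matrix built from column \<open>k\<close> clears row and
  column \<open>k\<close> and preserves positive semidefiniteness.\<close>

lemma psd_sum_of_squares:
  fixes V :: "real^'n^'n"
  assumes "finite S" "psd V" "\<And>i j. i \<notin> S \<Longrightarrow> V $ i $ j = 0"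
  shows "\<exists>l::'n \<Rightarrow> real^'n. \<forall>i j. V $ i $ j = (\<Sum>k\<in>S. l k $ i * l k $ j)"
  using assms
proof (induction S arbitrary: V rule: finite_induct)
  case empty
  then show ?case by auto
next
  case (insert k S)
  have sym: "V $ i $ j = V $ j $ i" for i j
    using \<open>psd V\<close> by (simp add: psd_def transpose_def vec_eq_iff)
  have Vkk: "0 \<le> V $ k $ k"
    using \<open>psd V\<close> axis_matrix_axis[of k V k] by (metis psd_def)
  have zero: "V $ k $ j = 0" if "V $ k $ k = 0" for j
    using psd_cauchy_schwarz[OF \<open>psd V\<close>, of "axis k 1" "axis j 1"] that by (simp add: axis_matrix_axis)
  define W :: "real^'n^'n" where "W = (\<chi> i j. V $ i $ j - V $ i $ k * V $ j $ k / V $ k $ k)"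
  have "psd W"
    unfolding psd_def
  proof (intro conjI allI)
    show "transpose W = W" by (simp add: W_def transpose_def vec_eq_iff sym mult.commute)
    fix x
    have "x \<bullet> (W *v x) = x \<bullet> (V *v x) - (x \<bullet> (V *v axis k 1))\<^sup>2 / V $ k $ k"
      unfolding inner_matrix_vector[of x W x] inner_matrix_vector[of x V x] inner_matrix_axis
      by (simp add: W_def power2_eq_square sum_product algebra_simps sum_subtractf sum_divide_distrib)
    also have "\<dots> \<ge> 0"
      using psd_cauchy_schwarz[OF \<open>psd V\<close>, of x "axis k 1"] Vkk \<open>psd V\<close>
      by (cases "V $ k $ k = 0") (auto simp: axis_matrix_axis field_simps psd_def)
    finally show "0 \<le> x \<bullet> (W *v x)" .
  qed
  moreover have "W $ i $ j = 0" if "i \<notin> S" for i j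
  proof (cases "i = k")
    case True
    then show ?thesis using zero[of j] sym[of j k] by (cases "V $ k $ k = 0") (auto simp: W_def)
  next
    case False
    then show ?thesis using insert.prems(2) that by (auto simp: W_def)
  qed
  ultimately obtain l :: "'n \<Rightarrow> real^'n" where l: "\<And>i j. W $ i $ j = (\<Sum>m\<in>S. l m $ i * l m $ j)"
    using insert.IH by blast
  define l' where "l' = l(k := (\<chi> i. V $ i $ k / sqrt (V $ k $ k)))"
  have "V $ i $ j = (\<Sum>m\<in>insert k S. l' m $ i * l' m $ j)" for i j
  proof -
    have "(\<Sum>m\<in>S. l' m $ i * l' m $ j) = W $ i $ j"
      unfolding l using insert.hyps by (intro sum.cong) (auto simp: l'_def)
    then show ?thesis
      using insert.hyps Vkk by (simp add: W_def l'_def)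
  qed
  then show ?case by blast
qed

lemma psd_factorization:
  fixes V :: "real^'n^'n"
  assumes "psd V"
  shows "\<exists>L::real^'n^'n. L ** transpose L = V"
proof -
  obtain l :: "'n \<Rightarrow> real^'n" where l: "\<And>i j. V $ i $ j = (\<Sum>k\<in>UNIV. l k $ i * l k $ j)"
    using psd_sum_of_squares[of UNIV V] assms by auto
  then have "(\<chi> i k. l k $ i) ** transpose (\<chi> i k. l k $ i) = V"
    by (simp add: vec_eq_iff matrix_matrix_mult_def transpose_def)
  then show ?thesis by blast
qed

lemma lborel_integral_prod_Basis:
  fixes f :: "'a::euclidean_space \<Rightarrow> real \<Rightarrow> 'b::{real_normed_field,banach,second_countable_topology}"
  assumes f: "\<And>b. b \<in> Basis \<Longrightarrow> integrable lborel (f b)"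
  shows "(\<integral>x. (\<Prod>b\<in>Basis. f b (x \<bullet> b)) \<partial>lborel) = (\<Prod>b\<in>Basis. \<integral>y. f b y \<partial>lborel)"
proof -
  interpret product_sigma_finite "\<lambda>_::'a. lborel :: real measure" ..
  have [measurable]: "\<And>b. b \<in> Basis \<Longrightarrow> f b \<in> borel_measurable borel"
    using borel_measurable_integrable[OF f] by simp
  have "(\<integral>x. (\<Prod>b\<in>Basis. f b (x \<bullet> b)) \<partial>(lborel::'a measure))
     = (\<integral>g. (\<Prod>b\<in>Basis. f b ((\<Sum>c\<in>Basis. g c *\<^sub>R c) \<bullet> b)) \<partial>(\<Pi>\<^sub>M b\<in>(Basis::'a set). lborel))"
    by (subst lborel_eq, subst integral_distr) auto
  also have "\<dots> = (\<integral>g. (\<Prod>b\<in>Basis. f b (g b)) \<partial>(\<Pi>\<^sub>M b\<in>(Basis::'a set). lborel))"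
    by (intro Bochner_Integration.integral_cong refl prod.cong)
       (simp_all add: inner_sum_left inner_Basis if_distrib sum.delta cong: if_cong)
  also have "\<dots> = (\<Prod>b\<in>Basis. \<integral>y. f b y \<partial>lborel)"
    by (rule product_integral_prod) (auto intro: f)
  finally show ?thesis .
qed

lemma prod_Basis_vec: "(\<Prod>b\<in>Basis. f b (x \<bullet> b)) = (\<Prod>i\<in>UNIV. f (axis i 1) ((x::real^'n) $ i))"
proof -
  have inj: "inj (\<lambda>i::'n. axis i (1::real))" by (auto simp: inj_on_def axis_eq_axis)
  have B: "(Basis :: (real^'n) set) = range (\<lambda>i. axis i 1)" by (auto simp: Basis_vec_def)
  show ?thesis unfolding B by (subst prod.reindex[OF inj]) (simp add: o_def inner_axis)
qed

lemma lborel_integral_prod_vec: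
  fixes f :: "'n::finite \<Rightarrow> real \<Rightarrow> 'b::{real_normed_field,banach,second_countable_topology}"
  assumes f: "\<And>i. integrable lborel (f i)"
  shows "(\<integral>x. (\<Prod>i\<in>UNIV. f i (x $ i)) \<partial>(lborel::(real^'n) measure)) = (\<Prod>i\<in>UNIV. \<integral>y. f i y \<partial>lborel)"
proof -
  define h where "h b = f (THE i. b = axis i (1::real))" for b :: "real^'n"
  have h: "h (axis i 1) = f i" for i
    by (simp add: h_def axis_eq_axis)
  have inj: "inj (\<lambda>i::'n. axis i (1::real))" by (auto simp: inj_on_def axis_eq_axis)
  have B: "(Basis :: (real^'n) set) = range (\<lambda>i. axis i 1)" by (auto simp: Basis_vec_def)
  have "(\<integral>x. (\<Prod>b\<in>Basis. h b (x \<bullet> b)) \<partial>lborel) = (\<Prod>b\<in>Basis. \<integral>y. h b y \<partial>lborel)"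
    by (rule lborel_integral_prod_Basis) (auto simp: B h f)
  also have "\<dots> = (\<Prod>i\<in>UNIV. \<integral>y. f i y \<partial>lborel)"
    unfolding B by (subst prod.reindex[OF inj]) (simp add: h)
  finally show ?thesis by (simp add: prod_Basis_vec h)
qed

lemma std_gauss_sets [simp, measurable_cong]: "sets (std_gauss :: (real^'n) measure) = sets borel"
  by simp

lemma integral_std_gauss:
  fixes f :: "real^'n \<Rightarrow> 'b::{banach,second_countable_topology}"
  assumes "f \<in> borel_measurable borel"
  shows "integral\<^sup>L std_gauss f = (\<integral>x. (\<Prod>i\<in>UNIV. std_normal_density (x $ i)) *\<^sub>R f x \<partial>lborel)"
  using assms by (subst integral_density) (auto intro!: AE_I2 prod_nonneg)

lemma prob_space_std_gauss: "prob_space (std_gauss :: (real^'n) measure)"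
proof
  have "emeasure (std_gauss :: (real^'n) measure) (space std_gauss) = (\<integral>\<^sup>+x. (\<Prod>b\<in>Basis. ennreal (std_normal_density ((x::real^'n) \<bullet> b))) \<partial>lborel)"
    by (simp add: emeasure_density prod_Basis_vec[where f="\<lambda>b y. ennreal (std_normal_density y)"] prod_ennreal)
  also have "\<dots> = (\<Prod>b\<in>(Basis::(real^'n) set). \<integral>\<^sup>+y. ennreal (std_normal_density y) \<partial>lborel)"
    by (subst nn_integral_lborel_prod) auto
  also have "(\<integral>\<^sup>+y. ennreal (std_normal_density y) \<partial>lborel) = 1"
    using prob_space.emeasure_space_1[OF prob_space_normal_density[of 1 0]] by (simp add: emeasure_density)
  finally show "emeasure (std_gauss :: (real^'n) measure) (space std_gauss) = 1" by simp
qed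

lemma char_std_gauss:
  "(\<integral>x. iexp (s \<bullet> x) \<partial>(std_gauss :: (real^'n) measure)) = complex_of_real (exp (- (s \<bullet> s) / 2))"
proof -
  have int: "integrable lborel (\<lambda>y. std_normal_density y *\<^sub>R iexp (a * y))" for a
    by (rule Bochner_Integration.integrable_bound[OF integrable_normal_density[of 1 0]])
       (auto simp: norm_mult)
  have "(\<integral>y. std_normal_density y *\<^sub>R iexp (a * y) \<partial>lborel) = char std_normal_distribution a" for a
    unfolding char_def by (subst integral_density) auto
  then have one: "(\<integral>y. std_normal_density y *\<^sub>R iexp (a * y) \<partial>lborel) = complex_of_real (exp (- a\<^sup>2 / 2))" for a
    by (simp add: char_std_normal_distribution)
  have "(\<integral>x. iexp (s \<bullet> x) \<partial>(std_gauss :: (real^'n) measure))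
     = (\<integral>x. (\<Prod>i\<in>UNIV. std_normal_density (x $ i)) *\<^sub>R iexp (s \<bullet> x) \<partial>lborel)"
    by (rule integral_std_gauss) auto
  also have "\<dots> = (\<integral>x. (\<Prod>i\<in>UNIV. std_normal_density (x $ i) *\<^sub>R iexp (s $ i * x $ i)) \<partial>(lborel :: (real^'n) measure))"
    by (intro Bochner_Integration.integral_cong refl)
       (simp add: inner_vec_def scaleR_conv_of_real prod.distrib sum_distrib_left exp_sum)
  also have "\<dots> = (\<Prod>i\<in>UNIV. complex_of_real (exp (- (s $ i)\<^sup>2 / 2)))"
    by (subst lborel_integral_prod_vec[where f="\<lambda>i y. std_normal_density y *\<^sub>R iexp (s $ i * y)"]) (simp_all only: int one)
  also have "\<dots> = complex_of_real (exp (\<Sum>i\<in>UNIV. - (s $ i)\<^sup>2 / 2))"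
    by (simp add: exp_sum)
  also have "(\<Sum>i\<in>UNIV. - (s $ i)\<^sup>2 / 2) = - (s \<bullet> s) / 2"
    by (simp add: inner_vec_def power2_eq_square sum_negf sum_divide_distrib)
  finally show ?thesis .
qed

lemma borel_measurable_matrix_vector [measurable]:
  "(\<lambda>x. (L::real^'n^'m) *v x) \<in> borel_measurable borel"
  by (intro borel_measurable_continuous_onI continuous_intros)

lemma sets_mvnormal [simp, measurable_cong]: "sets (mvnormal V) = sets borel"
  by (simp add: mvnormal_def)

lemma prob_space_mvnormal: "prob_space (mvnormal (V :: real^'n^'n))"
  unfolding mvnormal_def by (rule prob_space.prob_space_distr[OF prob_space_std_gauss]) measurable

lemma char_mvnormal:
  assumes "psd V"
  shows "(\<integral>x. iexp (s \<bullet> x) \<partial>(mvnormal (V :: real^'n^'n))) = complex_of_real (exp (- (s \<bullet> (V *v s)) / 2))"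
proof -
  define L :: "real^'n^'n" where "L = (SOME L. L ** transpose L = V)"
  have L: "L ** transpose L = V"
    unfolding L_def by (rule someI_ex[OF psd_factorization[OF assms]])
  have "(\<integral>x. iexp (s \<bullet> x) \<partial>(mvnormal V)) = (\<integral>x. iexp (s \<bullet> (L *v x)) \<partial>(std_gauss :: (real^'n) measure))"
    unfolding mvnormal_def L_def[symmetric] by (subst integral_distr) auto
  also have "\<dots> = (\<integral>x. iexp ((transpose L *v s) \<bullet> x) \<partial>(std_gauss :: (real^'n) measure))"
    by (simp add: dot_lmul_matrix[symmetric])
  also have "\<dots> = complex_of_real (exp (- ((transpose L *v s) \<bullet> (transpose L *v s)) / 2))"
    by (rule char_std_gauss)
  also have "(transpose L *v s) \<bullet> (transpose L *v s) = s \<bullet> (V *v s)"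
    unfolding L[symmetric] by (simp add: dot_lmul_matrix[symmetric] matrix_vector_mul_assoc[symmetric])
  finally show ?thesis .
qed

lemma matrix_vector_mult_matrix_inv:
  fixes S :: "real^'n^'n"
  assumes "posdef S"
  shows "S *v (matrix_inv S *v x) = x"
proof -
  have "S *v y = 0 \<Longrightarrow> y = 0" for y
    using assms unfolding posdef_def by (metis inner_zero_right less_irrefl)
  then have "invertible S"
    using matrix_left_invertible_ker[of S] invertible_left_inverse[of S] by blast
  then have "\<exists>A'. S ** A' = mat 1 \<and> A' ** S = mat 1" by (simp add: invertible_def)
  then have "S ** matrix_inv S = mat 1 \<and> matrix_inv S ** S = mat 1" unfolding matrix_inv_def by (rule someI_ex)
  then show ?thesis by (simp add: matrix_vector_mul_assoc)
qed

lemma diagm_mult_diagm: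
  "(diagm d ** W ** diagm e) $ i $ j = d i * (W::real^'n^'n) $ i $ j * e j"
proof -
  have "(diagm d ** W) $ i $ l = d i * W $ i $ l" for l
    by (simp add: matrix_matrix_mult_def diagm_def if_distrib[where f="\<lambda>x. x * _"] cong: if_cong)
  then show ?thesis
    by (simp add: matrix_matrix_mult_def[of "diagm d ** W"] diagm_def[of e] if_distrib[where f="\<lambda>x. _ * x"] cong: if_cong)
qed

lemma transpose_mult_mult_entry:
  "(transpose B1 ** S ** B2) $ i $ j = col B1 i \<bullet> ((S::real^'p^'p) *v col (B2::real^'k^'p) j)"
proof -
  have "(transpose B1 ** S ** B2) $ i $ j = (\<Sum>k\<in>UNIV. \<Sum>l\<in>UNIV. B1 $ l $ i * B2 $ k $ j * S $ l $ k)"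
    unfolding matrix_matrix_mult_def transpose_def by (simp add: sum_distrib_right) (simp add: mult_ac)
  also have "\<dots> = (\<Sum>l\<in>UNIV. \<Sum>k\<in>UNIV. B1 $ l $ i * B2 $ k $ j * S $ l $ k)"
    by (rule sum.swap)
  finally show ?thesis by (simp add: inner_matrix_vector col_def)
qed

lemma psdI:
  fixes V :: "real^'n^'n"
  assumes "\<And>i j. V $ i $ j = V $ j $ i" "\<And>s. 0 \<le> s \<bullet> (V *v s)"
  shows "psd V"
  using assms by (simp add: psd_def transpose_def vec_eq_iff)

subsection \<open>Levy's continuity theorem in several dimensions\<close>

lemma prob_space_norm_tail:
  fixes \<mu> :: "'b::real_normed_vector measure"
  assumes "prob_space \<mu>" "sets \<mu> = sets borel" "0 < \<epsilon>"
  shows "\<exists>K>0. measure \<mu> {x. K < norm x} < \<epsilon>"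
proof -
  interpret prob_space \<mu> by fact
  note [measurable_cong] = assms(2)
  have sp: "space \<mu> = UNIV" using sets_eq_imp_space_eq[OF assms(2)] by simp
  have "(\<lambda>n. measure \<mu> {x. real n < norm x}) \<longlonglongrightarrow> measure \<mu> (\<Inter>n. {x. real n < norm x})"
  proof (rule finite_Lim_measure_decseq)
    have "{x \<in> space \<mu>. real n < norm x} \<in> sets \<mu>" for n by measurable
    then show "range (\<lambda>n. {x. real n < norm x}) \<subseteq> sets \<mu>" by (auto simp: sp)
    show "decseq (\<lambda>n. {x::'b. real n < norm x})" by (auto simp: decseq_def)
  qed
  moreover have "(\<Inter>n. {x::'b. real n < norm x}) = {}"
    by auto (metis order_less_not_sym reals_Archimedean2)
  ultimately have "(\<lambda>n. measure \<mu> {x. real n < norm x}) \<longlonglongrightarrow> 0" by simp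
  then have "eventually (\<lambda>n. measure \<mu> {x. real n < norm x} < \<epsilon> \<and> 0 < n) sequentially"
    using order_tendstoD(2)[OF _ assms(3)] eventually_gt_at_top[of 0] eventually_conj by blast
  then obtain n :: nat where "measure \<mu> {x. real n < norm x} < \<epsilon>" "0 < n"
    by (auto simp: eventually_sequentially)
  then show ?thesis by (intro exI[of _ "real n"]) auto
qed

lemma gauss_kernel_char:
  fixes N :: "(real^'n) measure"
  assumes "prob_space N" "sets N = sets borel"
  shows "complex_of_real (\<integral>x. exp (- ((c *\<^sub>R (y - x)) \<bullet> (c *\<^sub>R (y - x))) / 2) \<partial>N)
     = (\<integral>u. iexp (c * (y \<bullet> u)) * (\<integral>x. iexp ((- (c *\<^sub>R u)) \<bullet> x) \<partial>N) \<partial>std_gauss)"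
proof -
  note [measurable_cong] = assms(2)
  interpret N: prob_space N by fact
  interpret G: prob_space "std_gauss :: (real^'n) measure" by (rule prob_space_std_gauss)
  interpret P: pair_prob_space N "std_gauss :: (real^'n) measure" ..
  have "complex_of_real (\<integral>x. exp (- ((c *\<^sub>R (y - x)) \<bullet> (c *\<^sub>R (y - x))) / 2) \<partial>N)
     = (\<integral>x. (\<integral>u. iexp ((c *\<^sub>R (y - x)) \<bullet> u) \<partial>std_gauss) \<partial>N)"
    unfolding char_std_gauss by (rule integral_complex_of_real[symmetric])
  also have "\<dots> = (\<integral>u. (\<integral>x. iexp ((c *\<^sub>R (y - x)) \<bullet> u) \<partial>N) \<partial>std_gauss)"
  proof (rule P.Fubini_integral[symmetric])
    show "integrable (N \<Otimes>\<^sub>M std_gauss) (\<lambda>(x, u). iexp ((c *\<^sub>R (y - x)) \<bullet> u))"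
      by (rule P.integrable_const_bound[where B=1]) (auto simp: case_prod_beta)
  qed
  also have "\<dots> = (\<integral>u. iexp (c * (y \<bullet> u)) * (\<integral>x. iexp ((- (c *\<^sub>R u)) \<bullet> x) \<partial>N) \<partial>std_gauss)"
  proof (intro Bochner_Integration.integral_cong refl)
    fix u :: "real^'n"
    have "iexp ((c *\<^sub>R (y - x)) \<bullet> u) = iexp (c * (y \<bullet> u)) * iexp ((- (c *\<^sub>R u)) \<bullet> x)" for x
      by (simp add: exp_add[symmetric] inner_diff_left inner_commute algebra_simps)
    then show "(\<integral>x. iexp ((c *\<^sub>R (y - x)) \<bullet> u) \<partial>N) = iexp (c * (y \<bullet> u)) * (\<integral>x. iexp ((- (c *\<^sub>R u)) \<bullet> x) \<partial>N)"
      by simp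
  qed
  finally show ?thesis .
qed

lemma gauss_kernel_tendsto:
  fixes N :: "nat \<Rightarrow> (real^'n) measure"
  assumes N: "\<And>n. prob_space (N n)" "\<And>n. sets (N n) = sets borel"
    and \<mu>: "prob_space \<mu>" "sets \<mu> = sets borel"
    and ch: "\<And>s. (\<lambda>n. \<integral>x. iexp (s \<bullet> x) \<partial>N n) \<longlonglongrightarrow> (\<integral>x. iexp (s \<bullet> x) \<partial>\<mu>)"
  shows "(\<lambda>n. \<integral>x. exp (- ((c *\<^sub>R (y - x)) \<bullet> (c *\<^sub>R (y - x))) / 2) \<partial>N n)
     \<longlonglongrightarrow> (\<integral>x. exp (- ((c *\<^sub>R (y - x)) \<bullet> (c *\<^sub>R (y - x))) / 2) \<partial>\<mu>)"
proof -
  interpret G: prob_space "std_gauss :: (real^'n) measure" by (rule prob_space_std_gauss)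
  have m: "(\<lambda>u. \<integral>x. iexp ((- (c *\<^sub>R u)) \<bullet> x) \<partial>K) \<in> borel_measurable borel"
    if K: "prob_space K" "sets K = sets borel" for K :: "(real^'n) measure"
  proof -
    note [measurable_cong] = K(2)
    interpret K: prob_space K by fact
    show ?thesis by measurable
  qed
  have b: "norm (\<integral>x. iexp ((- (c *\<^sub>R u)) \<bullet> x) \<partial>N n) \<le> 1" for u n
  proof -
    interpret K: prob_space "N n" by (rule N)
    have "norm (\<integral>x. iexp ((- (c *\<^sub>R u)) \<bullet> x) \<partial>N n) \<le> (\<integral>x. norm (iexp ((- (c *\<^sub>R u)) \<bullet> x)) \<partial>N n)"
      by (rule integral_norm_bound)
    then show ?thesis by (simp add: K.prob_space)
  qed
  note [measurable] = m[OF N] m[OF \<mu>]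
  have "(\<lambda>n. \<integral>u. iexp (c * (y \<bullet> u)) * (\<integral>x. iexp ((- (c *\<^sub>R u)) \<bullet> x) \<partial>N n) \<partial>(std_gauss :: (real^'n) measure))
     \<longlonglongrightarrow> (\<integral>u. iexp (c * (y \<bullet> u)) * (\<integral>x. iexp ((- (c *\<^sub>R u)) \<bullet> x) \<partial>\<mu>) \<partial>std_gauss)"
  proof (rule integral_dominated_convergence[where w="\<lambda>_. 1"])
    show "AE u in std_gauss. (\<lambda>n. iexp (c * (y \<bullet> u)) * (\<integral>x. iexp ((- (c *\<^sub>R u)) \<bullet> x) \<partial>N n))
        \<longlonglongrightarrow> iexp (c * (y \<bullet> u)) * (\<integral>x. iexp ((- (c *\<^sub>R u)) \<bullet> x) \<partial>\<mu>)"
      by (intro AE_I2 tendsto_mult tendsto_const ch)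
    show "AE u in std_gauss. norm (iexp (c * (y \<bullet> u)) * (\<integral>x. iexp ((- (c *\<^sub>R u)) \<bullet> x) \<partial>N n)) \<le> 1" for n
      by (intro AE_I2) (simp only: norm_mult norm_exp_i_times mult_1 b)
  qed (measurable; simp)+
  then show ?thesis
    unfolding gauss_kernel_char[OF N, symmetric] gauss_kernel_char[OF \<mu>, symmetric]
    by (simp add: tendsto_of_real_iff)
qed

text \<open>The Gaussian kernel is itself a Gaussian characteristic function, so the integral of a smoothed
  function depends on the measure only through its characteristic function.\<close>

definition gauss_smooth :: "real \<Rightarrow> (real^'n \<Rightarrow> real) \<Rightarrow> real^'n \<Rightarrow> real" where
  "gauss_smooth \<sigma> f x = (\<integral>g. f (x + \<sigma> *\<^sub>R g) \<partial>std_gauss)"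

lemma prod_std_normal_density:
  "(\<Prod>i\<in>UNIV. std_normal_density ((x::real^'n) $ i)) = (1 / sqrt (2 * pi)) ^ CARD('n) * exp (- (x \<bullet> x) / 2)"
proof -
  have "(\<Prod>i\<in>UNIV. std_normal_density (x $ i)) = (\<Prod>i\<in>(UNIV::'n set). 1 / sqrt (2 * pi)) * (\<Prod>i\<in>UNIV. exp (- (x $ i)\<^sup>2 / 2))"
    unfolding prod.distrib[symmetric] by (simp add: std_normal_density_def)
  also have "(\<Prod>i\<in>UNIV. exp (- (x $ i)\<^sup>2 / 2)) = exp (\<Sum>i\<in>UNIV. - (x $ i)\<^sup>2 / 2)"
    by (simp add: exp_sum)
  also have "(\<Sum>i\<in>UNIV. - (x $ i)\<^sup>2 / 2) = - (x \<bullet> x) / 2"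
    by (simp add: inner_vec_def power2_eq_square sum_negf sum_divide_distrib)
  finally show ?thesis by simp
qed

lemma gauss_smooth_kernel:
  assumes "0 < \<sigma>" and [measurable]: "f \<in> borel_measurable borel"
  shows "gauss_smooth \<sigma> f (x::real^'n) = (1 / sqrt (2 * pi)) ^ CARD('n) / \<sigma> ^ CARD('n) *
     (\<integral>y. f y * exp (- (((1/\<sigma>) *\<^sub>R (y - x)) \<bullet> ((1/\<sigma>) *\<^sub>R (y - x))) / 2) \<partial>lborel)"
proof -
  define h where "h y = f y * exp (- (((1/\<sigma>) *\<^sub>R (y - x)) \<bullet> ((1/\<sigma>) *\<^sub>R (y - x))) / 2)" for y
  have [measurable]: "h \<in> borel_measurable borel" unfolding h_def[abs_def] by measurable
  have "(\<integral>y. h y \<partial>lborel) = (\<integral>g. \<sigma> ^ CARD('n) * h (x + \<sigma> *\<^sub>R g) \<partial>lborel)"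
    using assms(1) by (subst lborel_affine[of \<sigma> x]) (simp_all add: integral_density integral_distr)
  also have "\<dots> = \<sigma> ^ CARD('n) * (\<integral>g. f (x + \<sigma> *\<^sub>R g) * exp (- (g \<bullet> g) / 2) \<partial>lborel)"
    using assms(1) by (simp add: h_def)
  finally have 1: "(\<integral>g. f (x + \<sigma> *\<^sub>R g) * exp (- (g \<bullet> g) / 2) \<partial>lborel) = (\<integral>y. h y \<partial>lborel) / \<sigma> ^ CARD('n)"
    using assms(1) by simp
  have "gauss_smooth \<sigma> f x = (\<integral>g. (1 / sqrt (2 * pi)) ^ CARD('n) * (f (x + \<sigma> *\<^sub>R g) * exp (- (g \<bullet> g) / 2)) \<partial>lborel)"
    unfolding gauss_smooth_def
    by (subst integral_std_gauss) (auto simp: prod_std_normal_density mult_ac)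
  also have "\<dots> = (1 / sqrt (2 * pi)) ^ CARD('n) * ((\<integral>y. h y \<partial>lborel) / \<sigma> ^ CARD('n))"
    unfolding 1[symmetric] by simp
  finally show ?thesis by (simp add: h_def)
qed

lemma integral_gauss_smooth:
  fixes N :: "(real^'n) measure"
  assumes N: "prob_space N" "sets N = sets borel" and \<sigma>: "0 < \<sigma>" and f: "integrable lborel f"
  shows "(\<integral>x. gauss_smooth \<sigma> f x \<partial>N) = (1 / sqrt (2 * pi)) ^ CARD('n) / \<sigma> ^ CARD('n) *
     (\<integral>y. f y * (\<integral>x. exp (- (((1/\<sigma>) *\<^sub>R (y - x)) \<bullet> ((1/\<sigma>) *\<^sub>R (y - x))) / 2) \<partial>N) \<partial>lborel)"
proof -
  note [measurable_cong] = N(2)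
  interpret N: prob_space N by fact
  interpret P: pair_sigma_finite N "lborel :: (real^'n) measure" ..
  have [measurable]: "f \<in> borel_measurable borel" using borel_measurable_integrable[OF f] by simp
  define k where "k x y = exp (- (((1/\<sigma>) *\<^sub>R (y - x)) \<bullet> ((1/\<sigma>) *\<^sub>R (y - x))) / 2)" for x y :: "real^'n"
  have [measurable]: "(\<lambda>(x, y). k x y) \<in> borel_measurable (borel \<Otimes>\<^sub>M borel)" unfolding k_def by measurable
  have k1: "\<bar>f y * k x y\<bar> \<le> \<bar>f y\<bar>" for x y
    by (auto simp: k_def abs_mult intro!: mult_left_le)
  have int: "integrable lborel (\<lambda>y. f y * k x y)" for x
    using k1 by (intro Bochner_Integration.integrable_bound[OF f]) auto
  have "(\<integral>x. (\<integral>y. f y * k x y \<partial>lborel) \<partial>N) = (\<integral>y. (\<integral>x. f y * k x y \<partial>N) \<partial>lborel)"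
  proof (rule P.Fubini_integral[symmetric], rule P.Fubini_integrable)
    have "\<bar>\<integral>y. norm (f y * k x y) \<partial>lborel\<bar> \<le> (\<integral>y. \<bar>f y\<bar> \<partial>lborel)" for x
      using k1 int f by (subst abs_of_nonneg) (auto intro!: integral_mono integrable_norm)
    then show "integrable N (\<lambda>x. \<integral>y. norm (case (x, y) of (x, y) \<Rightarrow> f y * k x y) \<partial>lborel)"
      by (intro N.integrable_const_bound[where B="\<integral>y. \<bar>f y\<bar> \<partial>lborel"]) auto
  qed (auto simp: int)
  then show ?thesis
    using \<sigma> by (simp add: gauss_smooth_kernel k_def)
qed

lemma integral_gauss_smooth_tendsto:
  fixes N :: "nat \<Rightarrow> (real^'n) measure"
  assumes N: "\<And>n. prob_space (N n)" "\<And>n. sets (N n) = sets borel"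
    and \<mu>: "prob_space \<mu>" "sets \<mu> = sets borel"
    and ch: "\<And>s. (\<lambda>n. \<integral>x. iexp (s \<bullet> x) \<partial>N n) \<longlonglongrightarrow> (\<integral>x. iexp (s \<bullet> x) \<partial>\<mu>)"
    and \<sigma>: "0 < \<sigma>" and f: "integrable lborel f"
  shows "(\<lambda>n. \<integral>x. gauss_smooth \<sigma> f x \<partial>N n) \<longlonglongrightarrow> (\<integral>x. gauss_smooth \<sigma> f x \<partial>\<mu>)"
  unfolding integral_gauss_smooth[OF N \<sigma> f] integral_gauss_smooth[OF \<mu> \<sigma> f]
proof (intro tendsto_mult tendsto_const integral_dominated_convergence[where w="\<lambda>y. \<bar>f y\<bar>"])
  have [measurable]: "f \<in> borel_measurable borel" using borel_measurable_integrable[OF f] by simp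
  let ?k = "\<lambda>K y. \<integral>x. exp (- (((1/\<sigma>) *\<^sub>R (y - x)) \<bullet> ((1/\<sigma>) *\<^sub>R (y - x))) / 2) \<partial>K"
  have m: "?k K \<in> borel_measurable borel"
    if K: "prob_space K" "sets K = sets borel" for K :: "(real^'n) measure"
  proof -
    note [measurable_cong] = K(2)
    interpret K: prob_space K by fact
    show ?thesis by measurable
  qed
  show "(\<lambda>y. f y * ?k \<mu> y) \<in> borel_measurable lborel" "(\<lambda>y. f y * ?k (N n) y) \<in> borel_measurable lborel" for n
    using m[OF \<mu>] m[OF N, of n] by (auto intro: borel_measurable_times)
  show "integrable lborel (\<lambda>y. \<bar>f y\<bar>)" using f by (rule integrable_abs)
  show "AE y in lborel. (\<lambda>n. f y * ?k (N n) y) \<longlonglongrightarrow> f y * ?k \<mu> y"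
    by (intro AE_I2 tendsto_mult tendsto_const gauss_kernel_tendsto N \<mu> ch)
  fix n
  interpret K: prob_space "N n" by (rule N)
  have "?k (N n) y \<le> 1" for y
  proof (cases "integrable (N n) (\<lambda>x. exp (- (((1/\<sigma>) *\<^sub>R (y - x)) \<bullet> ((1/\<sigma>) *\<^sub>R (y - x))) / 2))")
    case True
    then show ?thesis
      by (rule order.trans[OF integral_mono[where g="\<lambda>_. 1"]]) (auto simp: K.prob_space)
  qed (simp add: not_integrable_integral_eq)
  moreover have "0 \<le> ?k (N n) y" for y by (rule Bochner_Integration.integral_nonneg) auto
  ultimately show "AE y in lborel. norm (f y * ?k (N n) y) \<le> \<bar>f y\<bar>"
    by (auto simp: abs_mult intro!: mult_left_le)
qed

lemma compact_support_uniformly_continuous: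
  fixes f :: "'b::euclidean_space \<Rightarrow> real"
  assumes f: "continuous_on UNIV f" and supp: "\<And>x. R < norm x \<Longrightarrow> f x = 0" and "0 < \<epsilon>"
  shows "\<exists>\<delta>>0. \<forall>x y. norm (y - x) < \<delta> \<longrightarrow> \<bar>f y - f x\<bar> < \<epsilon>"
proof -
  have "uniformly_continuous_on (cball 0 (R + 1)) f"
    by (rule compact_uniformly_continuous[OF continuous_on_subset[OF f]]) auto
  then obtain d where d: "d > 0" "\<And>x y. x \<in> cball 0 (R+1) \<Longrightarrow> y \<in> cball 0 (R+1) \<Longrightarrow> dist y x < d \<Longrightarrow> dist (f y) (f x) < \<epsilon>"
    using \<open>0 < \<epsilon>\<close> unfolding uniformly_continuous_on_def by blast
  have "\<bar>f y - f x\<bar> < \<epsilon>" if *: "norm (y - x) < min d 1" for x y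
  proof (cases "norm x \<le> R \<or> norm y \<le> R")
    case True
    then have "norm x \<le> R + 1 \<and> norm y \<le> R + 1"
      using * norm_triangle_sub[of x y] norm_triangle_sub[of y x] norm_minus_commute[of x y] by linarith
    then show ?thesis using d(2)[of x y] * by (auto simp: dist_norm)
  next
    case False
    then show ?thesis using supp[of x] supp[of y] \<open>0 < \<epsilon>\<close> by auto
  qed
  then show ?thesis using d(1) by (intro exI[of _ "min d 1"]) auto
qed

lemma gauss_smooth_uniform_approx:
  fixes f :: "real^'n \<Rightarrow> real"
  assumes f: "continuous_on UNIV f" and supp: "\<And>x. R < norm x \<Longrightarrow> f x = 0"
    and B: "\<And>x. \<bar>f x\<bar> \<le> B" and "0 < \<epsilon>"
  shows "\<exists>\<sigma>>0. \<forall>x. \<bar>gauss_smooth \<sigma> f x - f x\<bar> \<le> \<epsilon>"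
proof -
  interpret G: prob_space "std_gauss :: (real^'n) measure" by (rule prob_space_std_gauss)
  have [measurable]: "f \<in> borel_measurable borel" by (rule borel_measurable_continuous_onI[OF f])
  have B0: "0 \<le> B" using B[of 0] by linarith
  obtain \<delta> where \<delta>: "\<delta> > 0" "\<And>x y. norm (y - x) < \<delta> \<Longrightarrow> \<bar>f y - f x\<bar> < \<epsilon> / 2"
    using compact_support_uniformly_continuous[where \<epsilon>="\<epsilon>/2" and R=R, OF f supp half_gt_zero[OF \<open>0 < \<epsilon>\<close>]] by blast
  obtain K where K: "K > 0" "measure (std_gauss :: (real^'n) measure) {x. K < norm x} < \<epsilon> / (4 * (B + 1))"
    using prob_space_norm_tail[OF prob_space_std_gauss std_gauss_sets, of "\<epsilon> / (4 * (B + 1))"] \<open>0 < \<epsilon>\<close> B0 by auto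
  define \<sigma> where "\<sigma> = \<delta> / (2 * K)"
  have \<sigma>: "\<sigma> > 0" using \<delta> K by (simp add: \<sigma>_def)
  have int: "integrable std_gauss (\<lambda>g. f (x + \<sigma> *\<^sub>R g))" for x
    by (rule G.integrable_const_bound[where B=B]) (auto simp: B)
  have "\<bar>gauss_smooth \<sigma> f x - f x\<bar> \<le> \<epsilon>" for x
  proof -
    let ?T = "{g::real^'n. K < norm g}"
    have T: "?T \<in> sets borel" by measurable
    have pw: "\<bar>f (x + \<sigma> *\<^sub>R g) - f x\<bar> \<le> \<epsilon> / 2 + 2 * B * indicator ?T g" for g
    proof (cases "K < norm g")
      case True
      have "\<bar>f (x + \<sigma> *\<^sub>R g) - f x\<bar> \<le> 2 * B" using B[of "x + \<sigma> *\<^sub>R g"] B[of x] by linarith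
      then show ?thesis using True \<open>0 < \<epsilon>\<close> by simp
    next
      case False
      then have "\<sigma> * norm g \<le> \<sigma> * K" using \<sigma> by (intro mult_left_mono) auto
      also have "\<sigma> * K = \<delta> / 2" using K(1) by (simp add: \<sigma>_def)
      finally have "norm ((x + \<sigma> *\<^sub>R g) - x) < \<delta>" using \<sigma> \<delta>(1) by simp
      from \<delta>(2)[OF this] show ?thesis using False by simp
    qed
    have "gauss_smooth \<sigma> f x - f x = (\<integral>g. f (x + \<sigma> *\<^sub>R g) - f x \<partial>std_gauss)"
      using int G.prob_space by (simp add: gauss_smooth_def)
    also have "\<bar>\<dots>\<bar> \<le> (\<integral>g. \<bar>f (x + \<sigma> *\<^sub>R g) - f x\<bar> \<partial>std_gauss)"
      by (rule integral_abs_bound)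
    also have "\<dots> \<le> (\<integral>g. \<epsilon> / 2 + 2 * B * indicator ?T g \<partial>std_gauss)"
      using int T by (intro integral_mono pw integrable_abs Bochner_Integration.integrable_diff
          Bochner_Integration.integrable_add integrable_mult_right integrable_real_indicator) (auto simp: G.emeasure_finite less_top[symmetric])
    also have "\<dots> = \<epsilon> / 2 + 2 * B * measure (std_gauss :: (real^'n) measure) ?T"
      using T G.prob_space by (simp add: G.emeasure_finite less_top[symmetric])
    also have "\<dots> \<le> \<epsilon> / 2 + 2 * B * (\<epsilon> / (4 * (B + 1)))"
      using K(2) B0 by (intro add_left_mono mult_left_mono) auto
    also have "\<dots> \<le> \<epsilon>" using B0 \<open>0 < \<epsilon>\<close> by (simp add: field_simps)
    finally show ?thesis .
  qed
  with \<sigma> show ?thesis by blast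
qed

lemma tendsto_by_approximation:
  fixes a :: "nat \<Rightarrow> real"
  assumes "\<And>\<epsilon>. 0 < \<epsilon> \<Longrightarrow> \<exists>g h. (\<forall>\<^sub>F n in sequentially. \<bar>a n - g n\<bar> \<le> \<epsilon>) \<and> \<bar>l - h\<bar> \<le> \<epsilon> \<and> g \<longlonglongrightarrow> h"
  shows "a \<longlonglongrightarrow> l"
proof (rule tendstoI)
  fix e :: real assume "0 < e"
  then obtain g h where *: "\<forall>\<^sub>F n in sequentially. \<bar>a n - g n\<bar> \<le> e / 4" "\<bar>l - h\<bar> \<le> e / 4" "g \<longlonglongrightarrow> h"
    using assms[of "e/4"] by auto
  have "\<forall>\<^sub>F n in sequentially. dist (g n) h < e / 4"
    using *(3) \<open>0 < e\<close> by (intro tendstoD) auto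
  with *(1) show "\<forall>\<^sub>F n in sequentially. dist (a n) l < e"
    by eventually_elim (use *(2) \<open>0 < e\<close> in \<open>unfold dist_real_def, linarith\<close>)
qed

lemma integral_diff_le_uniform:
  fixes f g :: "'b \<Rightarrow> real"
  assumes "prob_space N" "integrable N f" "integrable N g" "\<And>x. \<bar>f x - g x\<bar> \<le> \<epsilon>"
  shows "\<bar>(\<integral>x. f x \<partial>N) - (\<integral>x. g x \<partial>N)\<bar> \<le> \<epsilon>"
proof -
  interpret prob_space N by fact
  have "\<bar>(\<integral>x. f x \<partial>N) - (\<integral>x. g x \<partial>N)\<bar> = \<bar>\<integral>x. f x - g x \<partial>N\<bar>" using assms by simp
  also have "\<dots> \<le> (\<integral>x. \<bar>f x - g x\<bar> \<partial>N)" by (rule integral_abs_bound)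
  also have "\<dots> \<le> (\<integral>x. \<epsilon> \<partial>N)" using assms by (intro integral_mono) auto
  finally show ?thesis by (simp add: prob_space)
qed

lemma borel_measurable_gauss_smooth [measurable]:
  assumes [measurable]: "f \<in> borel_measurable borel"
  shows "gauss_smooth \<sigma> f \<in> borel_measurable borel"
proof -
  interpret G: prob_space "std_gauss :: (real^'n) measure" by (rule prob_space_std_gauss)
  show ?thesis unfolding gauss_smooth_def[abs_def] by measurable
qed

lemma char_tendsto_compact_support:
  fixes N :: "nat \<Rightarrow> (real^'n) measure" and f :: "real^'n \<Rightarrow> real"
  assumes N: "\<And>n. prob_space (N n)" "\<And>n. sets (N n) = sets borel"
    and \<mu>: "prob_space \<mu>" "sets \<mu> = sets borel"
    and ch: "\<And>s. (\<lambda>n. \<integral>x. iexp (s \<bullet> x) \<partial>N n) \<longlonglongrightarrow> (\<integral>x. iexp (s \<bullet> x) \<partial>\<mu>)"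
    and f: "continuous_on UNIV f" and supp: "\<And>x. R < norm x \<Longrightarrow> f x = 0"
    and B: "\<And>x. \<bar>f x\<bar> \<le> B"
  shows "(\<lambda>n. \<integral>x. f x \<partial>N n) \<longlonglongrightarrow> (\<integral>x. f x \<partial>\<mu>)"
proof (rule tendsto_by_approximation)
  fix \<epsilon> :: real assume "0 < \<epsilon>"
  have [measurable]: "f \<in> borel_measurable borel" by (rule borel_measurable_continuous_onI[OF f])
  obtain \<sigma> where \<sigma>: "\<sigma> > 0" "\<And>x. \<bar>gauss_smooth \<sigma> f x - f x\<bar> \<le> \<epsilon>"
    using gauss_smooth_uniform_approx[OF f supp B \<open>0 < \<epsilon>\<close>] by blast
  have "integrable lborel (\<lambda>x. indicator (cball 0 R) x *\<^sub>R f x)"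
    by (rule borel_integrable_compact) (auto intro: continuous_on_subset[OF f])
  also have "(\<lambda>x. indicator (cball 0 R) x *\<^sub>R f x) = f"
    using supp by (auto simp: fun_eq_iff indicator_def not_le)
  finally have lf: "integrable lborel f" .
  have b: "\<bar>(\<integral>x. f x \<partial>K) - (\<integral>x. gauss_smooth \<sigma> f x \<partial>K)\<bar> \<le> \<epsilon>"
    if K: "prob_space K" "sets K = sets borel" for K
  proof (rule integral_diff_le_uniform[OF K(1)])
    note [measurable_cong] = K(2)
    interpret K: prob_space K by fact
    show "integrable K f" by (rule K.integrable_const_bound[where B=B]) (auto simp: B)
    have "\<bar>gauss_smooth \<sigma> f x\<bar> \<le> B + \<epsilon>" for x using \<sigma>(2)[of x] B[of x] by linarith
    then show "integrable K (gauss_smooth \<sigma> f)"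
      by (intro K.integrable_const_bound[where B="B + \<epsilon>"]) auto
    show "\<bar>f x - gauss_smooth \<sigma> f x\<bar> \<le> \<epsilon>" for x using \<sigma>(2)[of x] by linarith
  qed
  show "\<exists>g h. (\<forall>\<^sub>F n in sequentially. \<bar>(\<integral>x. f x \<partial>N n) - g n\<bar> \<le> \<epsilon>) \<and> \<bar>(\<integral>x. f x \<partial>\<mu>) - h\<bar> \<le> \<epsilon> \<and> g \<longlonglongrightarrow> h"
    using b[OF N] b[OF \<mu>] integral_gauss_smooth_tendsto[OF N \<mu> ch \<sigma>(1) lf]
    by (intro exI[of _ "\<lambda>n. \<integral>x. gauss_smooth \<sigma> f x \<partial>N n"] exI[of _ "\<integral>x. gauss_smooth \<sigma> f x \<partial>\<mu>"]) auto
qed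

theorem char_tendsto_imp_integral_tendsto:
  fixes N :: "nat \<Rightarrow> (real^'n) measure" and f :: "real^'n \<Rightarrow> real"
  assumes N: "\<And>n. prob_space (N n)" "\<And>n. sets (N n) = sets borel"
    and \<mu>: "prob_space \<mu>" "sets \<mu> = sets borel"
    and ch: "\<And>s. (\<lambda>n. \<integral>x. iexp (s \<bullet> x) \<partial>N n) \<longlonglongrightarrow> (\<integral>x. iexp (s \<bullet> x) \<partial>\<mu>)"
    and f: "continuous_on UNIV f" and B: "\<And>x. \<bar>f x\<bar> \<le> B"
  shows "(\<lambda>n. \<integral>x. f x \<partial>N n) \<longlonglongrightarrow> (\<integral>x. f x \<partial>\<mu>)"
proof (rule tendsto_by_approximation)
  fix \<epsilon> :: real assume "0 < \<epsilon>"
  have B0: "0 \<le> B" using B[of 0] by linarith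
  define \<eta> where "\<eta> = \<epsilon> / (2 * (B + 1))"
  have \<eta>: "\<eta> > 0" using \<open>0 < \<epsilon>\<close> B0 by (simp add: \<eta>_def)
  obtain K where K: "K > 0" "measure \<mu> {x. K < norm x} < \<eta>"
    using prob_space_norm_tail[OF \<mu> \<eta>] by blast
  define cut :: "real^'n \<Rightarrow> real" where "cut x = max 0 (min 1 (K + 1 - norm x))" for x
  have cut: "continuous_on UNIV cut" unfolding cut_def[abs_def] by (intro continuous_intros)
  have cut_bounds: "0 \<le> cut x" "cut x \<le> 1" for x by (auto simp: cut_def)
  have cut_zero: "cut x = 0" if "K + 1 < norm x" for x using that by (auto simp: cut_def)
  have cut_one: "cut x = 1" if "norm x \<le> K" for x using that by (auto simp: cut_def)
  have [measurable]: "cut \<in> borel_measurable borel" "f \<in> borel_measurable borel"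
    by (auto intro: borel_measurable_continuous_onI cut f)
  have c1: "(\<lambda>n. \<integral>x. cut x \<partial>N n) \<longlonglongrightarrow> (\<integral>x. cut x \<partial>\<mu>)"
    using cut_bounds by (intro char_tendsto_compact_support[where B=1 and R="K+1"] N \<mu> ch cut cut_zero) auto
  have B_cut: "\<bar>f x * cut x\<bar> \<le> B" for x
    using mult_mono[OF B[of x], of "\<bar>cut x\<bar>" 1] cut_bounds[of x] B0 by (simp add: abs_mult)
  have c2: "(\<lambda>n. \<integral>x. f x * cut x \<partial>N n) \<longlonglongrightarrow> (\<integral>x. f x * cut x \<partial>\<mu>)"
    using B_cut by (intro char_tendsto_compact_support[where B=B and R="K+1"] N \<mu> ch) (simp_all add: cut_zero continuous_on_mult cut f)
  have diff: "\<bar>(\<integral>x. f x \<partial>L) - (\<integral>x. f x * cut x \<partial>L)\<bar> \<le> B * (1 - (\<integral>x. cut x \<partial>L))"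
    if L: "prob_space L" "sets L = sets borel" for L
  proof -
    note [measurable_cong] = L(2)
    interpret L: prob_space L by fact
    have i: "integrable L f" "integrable L (\<lambda>x. f x * cut x)" "integrable L cut"
      using B B_cut cut_bounds
      by (intro L.integrable_const_bound[where B=B] L.integrable_const_bound[where B=1 and f=cut]; simp)+
    have pw: "\<bar>f x * (1 - cut x)\<bar> \<le> B * (1 - cut x)" for x
      using B[of x] cut_bounds[of x] by (simp add: abs_mult mult_right_mono)
    have i': "integrable L (\<lambda>x. f x * (1 - cut x))" using i by (simp add: right_diff_distrib)
    have "\<bar>(\<integral>x. f x \<partial>L) - (\<integral>x. f x * cut x \<partial>L)\<bar> = \<bar>\<integral>x. f x * (1 - cut x) \<partial>L\<bar>"
      using i by (simp add: right_diff_distrib)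
    also have "\<dots> \<le> (\<integral>x. \<bar>f x * (1 - cut x)\<bar> \<partial>L)" by (rule integral_abs_bound)
    also have "\<dots> \<le> (\<integral>x. B * (1 - cut x) \<partial>L)"
      using i i' by (intro integral_mono integrable_abs pw) auto
    also have "\<dots> = B * (1 - (\<integral>x. cut x \<partial>L))" using i by (simp add: L.prob_space)
    finally show ?thesis .
  qed
  have \<mu>_cut: "1 - (\<integral>x. cut x \<partial>\<mu>) < \<eta>"
  proof -
    note [measurable_cong] = \<mu>(2)
    interpret L: prob_space \<mu> by fact
    have sp: "space \<mu> = UNIV" using sets_eq_imp_space_eq[OF \<mu>(2)] by simp
    have i: "integrable \<mu> cut" using cut_bounds by (auto intro!: L.integrable_const_bound[where B=1])
    have T: "{x. K < norm x} \<in> sets \<mu>" by (simp add: \<mu>(2))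
    have "1 - (\<integral>x. cut x \<partial>\<mu>) = (\<integral>x. 1 - cut x \<partial>\<mu>)" using i by (simp add: L.prob_space)
    also have "\<dots> \<le> (\<integral>x. indicator {x. K < norm x} x \<partial>\<mu>)"
      using i T cut_bounds cut_one by (intro integral_mono integrable_real_indicator) (auto simp: indicator_def not_less L.emeasure_finite less_top[symmetric])
    also have "\<dots> = measure \<mu> {x. K < norm x}" using T by (simp add: sp)
    finally show ?thesis using K(2) by simp
  qed
  have B\<eta>: "B * (2 * \<eta>) \<le> \<epsilon>" using B0 \<open>0 < \<epsilon>\<close> by (simp add: \<eta>_def field_simps)
  have "\<forall>\<^sub>F n in sequentially. (\<integral>x. cut x \<partial>N n) > 1 - 2 * \<eta>"
    using \<mu>_cut \<eta> by (intro order_tendstoD(1)[OF c1]) auto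
  then have "\<forall>\<^sub>F n in sequentially. \<bar>(\<integral>x. f x \<partial>N n) - (\<integral>x. f x * cut x \<partial>N n)\<bar> \<le> \<epsilon>"
  proof eventually_elim
    case (elim n)
    have "B * (1 - (\<integral>x. cut x \<partial>N n)) \<le> B * (2 * \<eta>)" using elim B0 by (intro mult_left_mono) auto
    with diff[OF N, of n] B\<eta> show ?case by linarith
  qed
  moreover have "\<bar>(\<integral>x. f x \<partial>\<mu>) - (\<integral>x. f x * cut x \<partial>\<mu>)\<bar> \<le> \<epsilon>"
  proof -
    have "B * (1 - (\<integral>x. cut x \<partial>\<mu>)) \<le> B * (2 * \<eta>)" using \<mu>_cut \<eta> B0 by (intro mult_left_mono) auto
    with diff[OF \<mu>] B\<eta> show ?thesis by linarith
  qed
  ultimately show "\<exists>g h. (\<forall>\<^sub>F n in sequentially. \<bar>(\<integral>x. f x \<partial>N n) - g n\<bar> \<le> \<epsilon>) \<and> \<bar>(\<integral>x. f x \<partial>\<mu>) - h\<bar> \<le> \<epsilon> \<and> g \<longlonglongrightarrow> h"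
    using c2 by (intro exI[of _ "\<lambda>n. \<integral>x. f x * cut x \<partial>N n"] exI[of _ "\<integral>x. f x * cut x \<partial>\<mu>"]) simp
qed

theorem conv_normal_char:
  fixes W :: "nat \<Rightarrow> 'a \<Rightarrow> real^'n"
  assumes M: "prob_space M" and W [measurable]: "\<And>n. W n \<in> borel_measurable M" and V: "psd V"
    and ch: "\<And>s. (\<lambda>n. \<integral>\<omega>. iexp (s \<bullet> W n \<omega>) \<partial>M) \<longlonglongrightarrow> complex_of_real (exp (- (s \<bullet> (V *v s)) / 2))"
  shows "conv_normal M W V"
  unfolding conv_normal_def conv_distr_def
proof (intro conjI V allI impI)
  fix f :: "real^'n \<Rightarrow> real" assume f: "continuous_on UNIV f \<and> bounded (range f)"
  then obtain B where B: "\<And>x. \<bar>f x\<bar> \<le> B" by (auto simp: bounded_iff)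
  have [measurable]: "f \<in> borel_measurable borel" using f by (auto intro: borel_measurable_continuous_onI)
  have "(\<lambda>n. \<integral>x. f x \<partial>distr M borel (W n)) \<longlonglongrightarrow> (\<integral>x. f x \<partial>mvnormal V)"
    using f B ch
    by (intro char_tendsto_imp_integral_tendsto[where B=B] prob_space.prob_space_distr[OF M] prob_space_mvnormal)
       (auto simp: integral_distr char_mvnormal[OF V])
  then show "(\<lambda>n. \<integral>\<omega>. f (W n \<omega>) \<partial>M) \<longlonglongrightarrow> (\<integral>x. f x \<partial>mvnormal V)"
    by (simp add: integral_distr)
qed

subsection \<open>Negligible and bounded sequences in probability\<close>

lemma iexp_diff_le: "cmod (iexp x - iexp y) \<le> \<bar>x - y\<bar>"
proof -
  have "iexp x - iexp y = iexp y * (iexp (x - y) - 1)"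
    by (simp add: algebra_simps exp_add[symmetric])
  then have "cmod (iexp x - iexp y) = cmod (iexp (x - y) - 1)" by (simp add: norm_mult)
  also have "\<dots> \<le> \<bar>x - y\<bar>" using iexp_approx1[of "x - y" 0] by simp
  finally show ?thesis .
qed

lemma iexp_sum: "finite I \<Longrightarrow> iexp (\<Sum>i\<in>I. x i) = (\<Prod>i\<in>I. iexp (x i))"
  by (simp add: sum_distrib_left exp_sum)

lemma inverse_sqrt_tendsto_zero: "(\<lambda>n. 1 / sqrt (real n)) \<longlonglongrightarrow> 0"
  using tendsto_inverse_0_at_top[OF filterlim_compose[OF sqrt_at_top filterlim_real_sequentially]]
  by (simp add: inverse_eq_divide)

lemma iexp_add3: "iexp (x + y + z) = iexp z * iexp y * iexp x"
  by (simp add: exp_add distrib_left mult_ac)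

lemma sum_prod_UNIV: "(\<Sum>zt\<in>UNIV. f zt) = (\<Sum>z\<in>UNIV. \<Sum>t\<in>UNIV. f (z, t))"
  for f :: "'b::finite \<times> 'c::finite \<Rightarrow> real"
  unfolding UNIV_Times_UNIV[symmetric] sum.cartesian_product by simp

definition (in prob_space) null_in_prob :: "(nat \<Rightarrow> 'a \<Rightarrow> real) \<Rightarrow> bool" where
  "null_in_prob W \<longleftrightarrow> (\<forall>n. W n \<in> borel_measurable M) \<and>
     (\<forall>\<epsilon>>0. (\<lambda>n. prob {\<omega>\<in>space M. \<epsilon> < \<bar>W n \<omega>\<bar>}) \<longlonglongrightarrow> 0)"

definition (in prob_space) bounded_in_prob :: "(nat \<Rightarrow> 'a \<Rightarrow> real) \<Rightarrow> bool" where
  "bounded_in_prob W \<longleftrightarrow> (\<forall>n. W n \<in> borel_measurable M) \<and>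
     (\<forall>\<epsilon>>0. \<exists>K. \<forall>\<^sub>F n in sequentially. prob {\<omega>\<in>space M. K < \<bar>W n \<omega>\<bar>} < \<epsilon>)"

lemma borel_measurable_vecI:
  fixes f :: "'a \<Rightarrow> real^'n"
  assumes "\<And>i. (\<lambda>x. f x $ i) \<in> borel_measurable M"
  shows "f \<in> borel_measurable M"
  using assms by (subst borel_measurable_euclidean_space) (auto simp: Basis_vec_def inner_axis)

context prob_space
begin

lemma null_in_probD_measurable: "null_in_prob W \<Longrightarrow> W n \<in> borel_measurable M"
  by (simp add: null_in_prob_def)

lemma null_in_probD: "null_in_prob W \<Longrightarrow> 0 < \<epsilon> \<Longrightarrow> (\<lambda>n. prob {\<omega>\<in>space M. \<epsilon> < \<bar>W n \<omega>\<bar>}) \<longlonglongrightarrow> 0"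
  by (simp add: null_in_prob_def)

lemma bounded_in_probD_measurable: "bounded_in_prob W \<Longrightarrow> W n \<in> borel_measurable M"
  by (simp add: bounded_in_prob_def)

lemma prob_le_prob_add_prob:
  assumes [measurable]: "Measurable.pred M Q" "Measurable.pred M R"
    and "\<And>\<omega>. \<omega> \<in> space M \<Longrightarrow> P \<omega> \<Longrightarrow> Q \<omega> \<or> R \<omega>"
  shows "prob {\<omega>\<in>space M. P \<omega>} \<le> prob {\<omega>\<in>space M. Q \<omega>} + prob {\<omega>\<in>space M. R \<omega>}"
proof -
  have "prob {\<omega>\<in>space M. P \<omega>} \<le> prob ({\<omega>\<in>space M. Q \<omega>} \<union> {\<omega>\<in>space M. R \<omega>})"
    using assms(3) by (intro finite_measure_mono) auto
  also have "\<dots> \<le> prob {\<omega>\<in>space M. Q \<omega>} + prob {\<omega>\<in>space M. R \<omega>}"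
    by (intro measure_Un_le) auto
  finally show ?thesis .
qed

lemma null_in_prob_dominated:
  assumes V: "null_in_prob V" and W: "\<And>n. W n \<in> borel_measurable M"
    and E: "\<And>n. Measurable.pred M (E n)" "(\<lambda>n. prob {\<omega>\<in>space M. E n \<omega>}) \<longlonglongrightarrow> 0"
    and le: "\<And>n \<omega>. \<omega> \<in> space M \<Longrightarrow> \<not> E n \<omega> \<Longrightarrow> \<bar>W n \<omega>\<bar> \<le> \<bar>V n \<omega>\<bar>"
  shows "null_in_prob W"
  unfolding null_in_prob_def
proof (intro conjI allI impI W)
  fix \<epsilon> :: real assume "0 < \<epsilon>"
  note [measurable] = null_in_probD_measurable[OF V] W E(1)
  show "(\<lambda>n. prob {\<omega> \<in> space M. \<epsilon> < \<bar>W n \<omega>\<bar>}) \<longlonglongrightarrow> 0"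
  proof (rule tendsto_sandwich[OF _ _ tendsto_const])
    show "(\<lambda>n. prob {\<omega>\<in>space M. E n \<omega>} + prob {\<omega>\<in>space M. \<epsilon> < \<bar>V n \<omega>\<bar>}) \<longlonglongrightarrow> 0"
      using tendsto_add[OF E(2) null_in_probD[OF V \<open>0 < \<epsilon>\<close>]] by simp
    show "\<forall>\<^sub>F n in sequentially. prob {\<omega> \<in> space M. \<epsilon> < \<bar>W n \<omega>\<bar>} \<le> prob {\<omega>\<in>space M. E n \<omega>} + prob {\<omega>\<in>space M. \<epsilon> < \<bar>V n \<omega>\<bar>}"
    proof (intro always_eventually allI prob_le_prob_add_prob)
      fix n \<omega> assume "\<omega> \<in> space M" "\<epsilon> < \<bar>W n \<omega>\<bar>"
      then show "E n \<omega> \<or> \<epsilon> < \<bar>V n \<omega>\<bar>" using le[of \<omega> n] by fastforce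
    qed measurable
  qed simp
qed

lemma null_in_prob_add:
  assumes V: "null_in_prob V" and W: "null_in_prob W"
  shows "null_in_prob (\<lambda>n \<omega>. V n \<omega> + W n \<omega>)"
proof -
  note [measurable] = null_in_probD_measurable[OF V] null_in_probD_measurable[OF W]
  have "(\<lambda>n. prob {\<omega> \<in> space M. \<epsilon> < \<bar>V n \<omega> + W n \<omega>\<bar>}) \<longlonglongrightarrow> 0" if "0 < \<epsilon>" for \<epsilon>
  proof (rule tendsto_sandwich[OF _ _ tendsto_const])
    have "(\<lambda>n. prob {\<omega>\<in>space M. \<epsilon>/2 < \<bar>V n \<omega>\<bar>}) \<longlonglongrightarrow> 0" "(\<lambda>n. prob {\<omega>\<in>space M. \<epsilon>/2 < \<bar>W n \<omega>\<bar>}) \<longlonglongrightarrow> 0"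
      by (intro null_in_probD V W half_gt_zero that)+
    from tendsto_add[OF this]
    show "(\<lambda>n. prob {\<omega>\<in>space M. \<epsilon>/2 < \<bar>V n \<omega>\<bar>} + prob {\<omega>\<in>space M. \<epsilon>/2 < \<bar>W n \<omega>\<bar>}) \<longlonglongrightarrow> 0" by simp
    show "\<forall>\<^sub>F n in sequentially. prob {\<omega> \<in> space M. \<epsilon> < \<bar>V n \<omega> + W n \<omega>\<bar>}
        \<le> prob {\<omega>\<in>space M. \<epsilon>/2 < \<bar>V n \<omega>\<bar>} + prob {\<omega>\<in>space M. \<epsilon>/2 < \<bar>W n \<omega>\<bar>}"
      by (intro always_eventually allI prob_le_prob_add_prob) (measurable, arith)
  qed simp
  then show ?thesis by (simp add: null_in_prob_def)
qed

lemma null_in_prob_const: "a \<longlonglongrightarrow> 0 \<Longrightarrow> null_in_prob (\<lambda>n \<omega>. a n)"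
  unfolding null_in_prob_def
proof (intro conjI allI impI)
  fix \<epsilon> :: real assume a: "a \<longlonglongrightarrow> 0" and "0 < \<epsilon>"
  then have "\<forall>\<^sub>F n in sequentially. \<bar>a n\<bar> < \<epsilon>" using tendstoD[OF a \<open>0 < \<epsilon>\<close>] by simp
  then have "\<forall>\<^sub>F n in sequentially. prob {\<omega> \<in> space M. \<epsilon> < \<bar>a n\<bar>} = 0"
    by eventually_elim simp
  then show "(\<lambda>n. prob {\<omega> \<in> space M. \<epsilon> < \<bar>a n\<bar>}) \<longlonglongrightarrow> 0" by (rule tendsto_eventually)
qed simp

lemma null_in_prob_sum:
  assumes "finite I" "\<And>i. i \<in> I \<Longrightarrow> null_in_prob (\<lambda>n \<omega>. W i n \<omega>)"
  shows "null_in_prob (\<lambda>n \<omega>. \<Sum>i\<in>I. W i n \<omega>)"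
  using assms by (induction I rule: finite_induct) (auto intro: null_in_prob_add null_in_prob_const)

lemma bounded_in_prob_add:
  assumes V: "bounded_in_prob V" and W: "bounded_in_prob W"
  shows "bounded_in_prob (\<lambda>n \<omega>. V n \<omega> + W n \<omega>)"
proof -
  note [measurable] = bounded_in_probD_measurable[OF V] bounded_in_probD_measurable[OF W]
  have "\<exists>K. \<forall>\<^sub>F n in sequentially. prob {\<omega>\<in>space M. K < \<bar>V n \<omega> + W n \<omega>\<bar>} < \<epsilon>" if eps: "0 < \<epsilon>" for \<epsilon>
  proof -
    obtain K where K: "\<forall>\<^sub>F n in sequentially. prob {\<omega>\<in>space M. K < \<bar>V n \<omega>\<bar>} < \<epsilon> / 2"
      using V half_gt_zero[OF eps] unfolding bounded_in_prob_def by blast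
    obtain L where L: "\<forall>\<^sub>F n in sequentially. prob {\<omega>\<in>space M. L < \<bar>W n \<omega>\<bar>} < \<epsilon> / 2"
      using W half_gt_zero[OF eps] unfolding bounded_in_prob_def by blast
    from K L have "\<forall>\<^sub>F n in sequentially. prob {\<omega>\<in>space M. K + L < \<bar>V n \<omega> + W n \<omega>\<bar>} < \<epsilon>"
    proof eventually_elim
      case (elim n)
      have "prob {\<omega>\<in>space M. K + L < \<bar>V n \<omega> + W n \<omega>\<bar>}
          \<le> prob {\<omega>\<in>space M. K < \<bar>V n \<omega>\<bar>} + prob {\<omega>\<in>space M. L < \<bar>W n \<omega>\<bar>}"
        by (intro prob_le_prob_add_prob) (measurable, arith)
      with elim show ?case by linarith
    qed
    then show ?thesis by blast
  qed
  then show ?thesis by (simp add: bounded_in_prob_def)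
qed

lemma bounded_in_prob_mult:
  assumes V: "bounded_in_prob V" and W: "bounded_in_prob W"
  shows "bounded_in_prob (\<lambda>n \<omega>. V n \<omega> * W n \<omega>)"
proof -
  note [measurable] = bounded_in_probD_measurable[OF V] bounded_in_probD_measurable[OF W]
  have "\<exists>K. \<forall>\<^sub>F n in sequentially. prob {\<omega>\<in>space M. K < \<bar>V n \<omega> * W n \<omega>\<bar>} < \<epsilon>" if eps: "0 < \<epsilon>" for \<epsilon>
  proof -
    obtain K where K: "\<forall>\<^sub>F n in sequentially. prob {\<omega>\<in>space M. K < \<bar>V n \<omega>\<bar>} < \<epsilon> / 2"
      using V half_gt_zero[OF eps] unfolding bounded_in_prob_def by blast
    obtain L where L: "\<forall>\<^sub>F n in sequentially. prob {\<omega>\<in>space M. L < \<bar>W n \<omega>\<bar>} < \<epsilon> / 2"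
      using W half_gt_zero[OF eps] unfolding bounded_in_prob_def by blast
    from K L have "\<forall>\<^sub>F n in sequentially. prob {\<omega>\<in>space M. \<bar>K\<bar> * \<bar>L\<bar> < \<bar>V n \<omega> * W n \<omega>\<bar>} < \<epsilon>"
    proof eventually_elim
      case (elim n)
      have "prob {\<omega>\<in>space M. \<bar>K\<bar> * \<bar>L\<bar> < \<bar>V n \<omega> * W n \<omega>\<bar>}
          \<le> prob {\<omega>\<in>space M. K < \<bar>V n \<omega>\<bar>} + prob {\<omega>\<in>space M. L < \<bar>W n \<omega>\<bar>}"
      proof (intro prob_le_prob_add_prob)
        fix \<omega> assume *: "\<bar>K\<bar> * \<bar>L\<bar> < \<bar>V n \<omega> * W n \<omega>\<bar>"
        show "K < \<bar>V n \<omega>\<bar> \<or> L < \<bar>W n \<omega>\<bar>"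
        proof (rule ccontr)
          assume "\<not> ?thesis"
          then have "\<bar>V n \<omega>\<bar> * \<bar>W n \<omega>\<bar> \<le> \<bar>K\<bar> * \<bar>L\<bar>" by (intro mult_mono) auto
          with * show False by (simp add: abs_mult)
        qed
      qed measurable
      with elim show ?case by linarith
    qed
    then show ?thesis by blast
  qed
  then show ?thesis by (simp add: bounded_in_prob_def)
qed

lemma bounded_in_prob_const: "bounded_in_prob (\<lambda>n \<omega>. c)"
  unfolding bounded_in_prob_def by (auto intro!: exI[of _ "\<bar>c\<bar>"])

lemma bounded_in_prob_sum:
  assumes "finite I" "\<And>i. i \<in> I \<Longrightarrow> bounded_in_prob (\<lambda>n \<omega>. W i n \<omega>)"
  shows "bounded_in_prob (\<lambda>n \<omega>. \<Sum>i\<in>I. W i n \<omega>)"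
  using assms by (induction I rule: finite_induct) (auto intro: bounded_in_prob_add bounded_in_prob_const)

lemma null_imp_bounded_in_prob:
  assumes "null_in_prob W"
  shows "bounded_in_prob W"
  unfolding bounded_in_prob_def
proof (intro conjI allI impI null_in_probD_measurable[OF assms] exI)
  fix \<epsilon> :: real assume "0 < \<epsilon>"
  have "(\<lambda>n. prob {\<omega>\<in>space M. 1 < \<bar>W n \<omega>\<bar>}) \<longlonglongrightarrow> 0" using assms by (simp add: null_in_prob_def)
  from order_tendstoD(2)[OF this \<open>0 < \<epsilon>\<close>]
  show "\<forall>\<^sub>F n in sequentially. prob {\<omega>\<in>space M. 1 < \<bar>W n \<omega>\<bar>} < \<epsilon>" .
qed

lemma null_in_prob_mult_bounded:
  assumes V: "null_in_prob V" and W: "bounded_in_prob W"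
  shows "null_in_prob (\<lambda>n \<omega>. V n \<omega> * W n \<omega>)"
proof -
  note [measurable] = null_in_probD_measurable[OF V] bounded_in_probD_measurable[OF W]
  have "(\<lambda>n. prob {\<omega> \<in> space M. \<epsilon> < \<bar>V n \<omega> * W n \<omega>\<bar>}) \<longlonglongrightarrow> 0" if "0 < \<epsilon>" for \<epsilon>
  proof (rule tendstoI)
    fix e :: real assume "0 < e"
    obtain K where K: "\<forall>\<^sub>F n in sequentially. prob {\<omega>\<in>space M. K < \<bar>W n \<omega>\<bar>} < e / 2"
      using W half_gt_zero[OF \<open>0 < e\<close>] unfolding bounded_in_prob_def by blast
    define L where "L = \<bar>K\<bar> + 1"
    have L: "0 < L" "K < L" by (auto simp: L_def)
    have "(\<lambda>n. prob {\<omega>\<in>space M. \<epsilon> / L < \<bar>V n \<omega>\<bar>}) \<longlonglongrightarrow> 0"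
      by (intro null_in_probD V divide_pos_pos \<open>0 < \<epsilon>\<close> L(1))
    from order_tendstoD(2)[OF this half_gt_zero[OF \<open>0 < e\<close>]] K
    show "\<forall>\<^sub>F n in sequentially. dist (prob {\<omega> \<in> space M. \<epsilon> < \<bar>V n \<omega> * W n \<omega>\<bar>}) 0 < e"
    proof eventually_elim
      case (elim n)
      have "prob {\<omega>\<in>space M. \<epsilon> < \<bar>V n \<omega> * W n \<omega>\<bar>}
          \<le> prob {\<omega>\<in>space M. \<epsilon> / L < \<bar>V n \<omega>\<bar>} + prob {\<omega>\<in>space M. K < \<bar>W n \<omega>\<bar>}"
      proof (intro prob_le_prob_add_prob)
        fix \<omega> assume *: "\<epsilon> < \<bar>V n \<omega> * W n \<omega>\<bar>"
        show "\<epsilon> / L < \<bar>V n \<omega>\<bar> \<or> K < \<bar>W n \<omega>\<bar>"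
        proof (rule ccontr)
          assume "\<not> ?thesis"
          then have "\<bar>V n \<omega>\<bar> * \<bar>W n \<omega>\<bar> \<le> \<epsilon> / L * L" using L \<open>0 < \<epsilon>\<close> by (intro mult_mono) auto
          with * L show False by (simp add: abs_mult)
        qed
      qed measurable
      with elim show ?case by (simp add: dist_real_def)
    qed
  qed
  then show ?thesis by (simp add: null_in_prob_def)
qed

lemma null_in_prob_cmult: "null_in_prob W \<Longrightarrow> null_in_prob (\<lambda>n \<omega>. c * W n \<omega>)"
  using null_in_prob_mult_bounded[OF _ bounded_in_prob_const[of c], of W] by (simp add: mult.commute)

lemma null_in_prob_diff: "null_in_prob V \<Longrightarrow> null_in_prob W \<Longrightarrow> null_in_prob (\<lambda>n \<omega>. V n \<omega> - W n \<omega>)"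
  using null_in_prob_add[OF _ null_in_prob_cmult[of W "-1"], of V] by simp

lemma integral_tendsto_zero_of_null_in_prob:
  assumes W: "null_in_prob W" and B: "\<And>n \<omega>. \<omega> \<in> space M \<Longrightarrow> \<bar>W n \<omega>\<bar> \<le> B"
  shows "(\<lambda>n. \<integral>\<omega>. \<bar>W n \<omega>\<bar> \<partial>M) \<longlonglongrightarrow> 0"
proof (rule tendstoI)
  fix e :: real assume "0 < e"
  note [measurable] = null_in_probD_measurable[OF W]
  have B0: "0 \<le> B" using B[of _ 0] not_empty by fastforce
  have "(\<lambda>n. prob {\<omega>\<in>space M. e / 2 < \<bar>W n \<omega>\<bar>}) \<longlonglongrightarrow> 0"
    by (intro null_in_probD W half_gt_zero \<open>0 < e\<close>)
  moreover have "0 < e / (2 * (B + 1))" using B0 \<open>0 < e\<close> by simp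
  ultimately have "\<forall>\<^sub>F n in sequentially. prob {\<omega>\<in>space M. e / 2 < \<bar>W n \<omega>\<bar>} < e / (2 * (B + 1))"
    by (rule order_tendstoD(2))
  then show "\<forall>\<^sub>F n in sequentially. dist (\<integral>\<omega>. \<bar>W n \<omega>\<bar> \<partial>M) 0 < e"
  proof eventually_elim
    case (elim n)
    let ?T = "{\<omega>\<in>space M. e / 2 < \<bar>W n \<omega>\<bar>}"
    have iW: "integrable M (\<lambda>\<omega>. \<bar>W n \<omega>\<bar>)"
      using B by (intro integrable_const_bound[where B=B] AE_I2) auto
    have "(\<integral>\<omega>. \<bar>W n \<omega>\<bar> \<partial>M) \<le> (\<integral>\<omega>. e / 2 + B * indicator ?T \<omega> \<partial>M)"
    proof (rule integral_mono[OF iW])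
      show "integrable M (\<lambda>\<omega>. e / 2 + B * indicator ?T \<omega>)"
        by (intro Bochner_Integration.integrable_add integrable_mult_right integrable_real_indicator)
           (auto simp: less_top[symmetric])
      show "\<bar>W n \<omega>\<bar> \<le> e / 2 + B * indicator ?T \<omega>" if "\<omega> \<in> space M" for \<omega>
        using B[OF that, of n] that \<open>0 < e\<close> by (auto simp: indicator_def)
    qed
    also have "\<dots> = e / 2 + B * prob ?T"
      by (simp add: prob_space less_top[symmetric])
    also have "\<dots> \<le> e / 2 + B * (e / (2 * (B + 1)))"
      using elim B0 by (intro add_left_mono mult_left_mono) auto
    also have "\<dots> < e" using B0 \<open>0 < e\<close> by (simp add: field_simps)
    finally show ?case by (simp add: dist_real_def)
  qed
qed

lemma null_in_prob_of_integral_tendsto_zero: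
  assumes [measurable]: "\<And>n. W n \<in> borel_measurable M"
    and int: "(\<lambda>n. \<integral>\<omega>. min 1 \<bar>W n \<omega>\<bar> \<partial>M) \<longlonglongrightarrow> 0"
  shows "null_in_prob W"
  unfolding null_in_prob_def
proof (intro conjI allI impI)
  fix \<epsilon> :: real assume "0 < \<epsilon>"
  show "(\<lambda>n. prob {\<omega> \<in> space M. \<epsilon> < \<bar>W n \<omega>\<bar>}) \<longlonglongrightarrow> 0"
  proof (rule tendsto_sandwich[OF _ _ tendsto_const])
    show "(\<lambda>n. (\<integral>\<omega>. min 1 \<bar>W n \<omega>\<bar> \<partial>M) / min 1 \<epsilon>) \<longlonglongrightarrow> 0"
      using tendsto_divide[OF int tendsto_const[of "min 1 \<epsilon>"]] \<open>0 < \<epsilon>\<close> by simp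
    show "\<forall>\<^sub>F n in sequentially. prob {\<omega> \<in> space M. \<epsilon> < \<bar>W n \<omega>\<bar>} \<le> (\<integral>\<omega>. min 1 \<bar>W n \<omega>\<bar> \<partial>M) / min 1 \<epsilon>"
    proof (intro always_eventually allI)
      fix n
      have "prob {\<omega> \<in> space M. \<epsilon> < \<bar>W n \<omega>\<bar>} \<le> prob {\<omega> \<in> space M. min 1 \<epsilon> \<le> min 1 \<bar>W n \<omega>\<bar>}"
        by (intro finite_measure_mono) auto
      also have "\<dots> \<le> (\<integral>\<omega>. min 1 \<bar>W n \<omega>\<bar> \<partial>M) / min 1 \<epsilon>"
        using \<open>0 < \<epsilon>\<close> by (intro integral_Markov_inequality_measure[where A="{}"] integrable_const_bound[where B=1]) auto
      finally show "prob {\<omega> \<in> space M. \<epsilon> < \<bar>W n \<omega>\<bar>} \<le> (\<integral>\<omega>. min 1 \<bar>W n \<omega>\<bar> \<partial>M) / min 1 \<epsilon>" .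
    qed
  qed simp
qed simp

lemma null_in_prob_of_AE_tendsto:
  assumes [measurable]: "\<And>n. W n \<in> borel_measurable M" and lim: "AE \<omega> in M. (\<lambda>n. W n \<omega>) \<longlonglongrightarrow> 0"
  shows "null_in_prob W"
proof (rule null_in_prob_of_integral_tendsto_zero)
  have "(\<lambda>n. \<integral>\<omega>. min 1 \<bar>W n \<omega>\<bar> \<partial>M) \<longlonglongrightarrow> (\<integral>\<omega>. 0 \<partial>M)"
  proof (rule integral_dominated_convergence[where w="\<lambda>_. 1"])
    show "AE \<omega> in M. (\<lambda>n. min 1 \<bar>W n \<omega>\<bar>) \<longlonglongrightarrow> 0"
      using lim
    proof eventually_elim
      case (elim \<omega>)
      have "(\<lambda>n. min 1 \<bar>W n \<omega>\<bar>) \<longlonglongrightarrow> min 1 \<bar>0\<bar>" by (intro tendsto_intros elim)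
      then show ?case by simp
    qed
  qed auto
  then show "(\<lambda>n. \<integral>\<omega>. min 1 \<bar>W n \<omega>\<bar> \<partial>M) \<longlonglongrightarrow> 0" by simp
qed measurable

lemma null_in_prob_inverse:
  assumes W: "null_in_prob (\<lambda>n \<omega>. W n \<omega> - c)" and Wm: "\<And>n. W n \<in> borel_measurable M" and "0 < c"
  shows "null_in_prob (\<lambda>n \<omega>. 1 / W n \<omega> - 1 / c)"
proof (rule null_in_prob_dominated)
  note [measurable] = Wm
  show "null_in_prob (\<lambda>n \<omega>. 2 / c\<^sup>2 * (W n \<omega> - c))" by (rule null_in_prob_cmult[OF W])
  show "(\<lambda>n. prob {\<omega> \<in> space M. c / 2 < \<bar>W n \<omega> - c\<bar>}) \<longlonglongrightarrow> 0"
    by (intro null_in_probD W half_gt_zero \<open>0 < c\<close>)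
  fix n \<omega> assume "\<not> c / 2 < \<bar>W n \<omega> - c\<bar>"
  then have Wc: "c / 2 \<le> W n \<omega>" by linarith
  then have pos: "0 < W n \<omega>" using \<open>0 < c\<close> by linarith
  have "1 / W n \<omega> - 1 / c = (c - W n \<omega>) * (1 / (W n \<omega> * c))"
    using pos \<open>0 < c\<close> by (simp add: diff_frac_eq)
  then have "\<bar>1 / W n \<omega> - 1 / c\<bar> = \<bar>W n \<omega> - c\<bar> * (1 / (W n \<omega> * c))"
    using pos \<open>0 < c\<close> by (simp only: abs_mult abs_minus_commute) simp
  also have "\<dots> \<le> \<bar>W n \<omega> - c\<bar> * (2 / c\<^sup>2)"
  proof (rule mult_left_mono)
    have "c / 2 * c \<le> W n \<omega> * c" using Wc \<open>0 < c\<close> by (intro mult_right_mono) auto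
    then have "1 / (W n \<omega> * c) \<le> 1 / (c / 2 * c)" using \<open>0 < c\<close> by (intro divide_left_mono) (auto simp: pos)
    then show "1 / (W n \<omega> * c) \<le> 2 / c\<^sup>2" by (simp add: power2_eq_square)
  qed simp
  finally show "\<bar>1 / W n \<omega> - 1 / c\<bar> \<le> \<bar>2 / c\<^sup>2 * (W n \<omega> - c)\<bar>"
    by (simp only: abs_mult mult.commute) simp
qed (use Wm in measurable)

lemma char_diff_tendsto_zero:
  assumes V[measurable]: "\<And>n. V n \<in> borel_measurable M" and W[measurable]: "\<And>n. W n \<in> borel_measurable M"
    and null: "null_in_prob (\<lambda>n \<omega>. V n \<omega> - W n \<omega>)"
  shows "(\<lambda>n. (\<integral>\<omega>. iexp (V n \<omega>) \<partial>M) - (\<integral>\<omega>. iexp (W n \<omega>) \<partial>M)) \<longlonglongrightarrow> 0"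
proof (rule Lim_null_comparison)
  have n2: "null_in_prob (\<lambda>n \<omega>. cmod (iexp (V n \<omega>) - iexp (W n \<omega>)))"
    by (rule null_in_prob_dominated[OF null, where E="\<lambda>_ _. False"]) (auto simp: iexp_diff_le)
  have "\<bar>cmod (iexp (V n \<omega>) - iexp (W n \<omega>))\<bar> \<le> 2" for n \<omega>
    using norm_triangle_ineq4[of "iexp (V n \<omega>)" "iexp (W n \<omega>)"] by simp
  from integral_tendsto_zero_of_null_in_prob[OF n2 this]
  show "(\<lambda>n. \<integral>\<omega>. cmod (iexp (V n \<omega>) - iexp (W n \<omega>)) \<partial>M) \<longlonglongrightarrow> 0" by simp
  show "\<forall>\<^sub>F n in sequentially. norm ((\<integral>\<omega>. iexp (V n \<omega>) \<partial>M) - (\<integral>\<omega>. iexp (W n \<omega>) \<partial>M)) \<le> (\<integral>\<omega>. cmod (iexp (V n \<omega>) - iexp (W n \<omega>)) \<partial>M)"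
  proof (intro always_eventually allI)
    fix n
    have "integrable M (\<lambda>\<omega>. iexp (V n \<omega>))" "integrable M (\<lambda>\<omega>. iexp (W n \<omega>))"
      by (auto intro!: integrable_const_bound[where B=1])
    then have "(\<integral>\<omega>. iexp (V n \<omega>) \<partial>M) - (\<integral>\<omega>. iexp (W n \<omega>) \<partial>M) = (\<integral>\<omega>. iexp (V n \<omega>) - iexp (W n \<omega>) \<partial>M)" by simp
    then show "norm ((\<integral>\<omega>. iexp (V n \<omega>) \<partial>M) - (\<integral>\<omega>. iexp (W n \<omega>) \<partial>M)) \<le> (\<integral>\<omega>. cmod (iexp (V n \<omega>) - iexp (W n \<omega>)) \<partial>M)"
      by (simp only: integral_norm_bound)
  qed
qed

lemma null_in_prob_eventually_eq:
  assumes "null_in_prob V" "\<And>n. W n \<in> borel_measurable M" "\<And>n \<omega>. 0 < n \<Longrightarrow> W n \<omega> = V n \<omega>"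
  shows "null_in_prob W"
proof (rule null_in_prob_dominated[OF assms(1,2), where E="\<lambda>n _. n = 0"])
  show "(\<lambda>n. prob {\<omega> \<in> space M. n = 0}) \<longlonglongrightarrow> 0"
    by (rule tendsto_eventually) (use eventually_gt_at_top[of "0::nat"] in eventually_elim, auto)
qed (auto simp: assms(3))

lemma conv_distr_norm_bounded_in_prob:
  fixes W :: "nat \<Rightarrow> 'a \<Rightarrow> 'b::real_normed_vector"
  assumes W[measurable]: "\<And>n. W n \<in> borel_measurable M" and \<mu>: "prob_space \<mu>" "sets \<mu> = sets borel"
    and conv: "conv_distr M W \<mu>"
  shows "bounded_in_prob (\<lambda>n \<omega>. norm (W n \<omega>))"
  unfolding bounded_in_prob_def
proof (intro conjI allI impI)
  fix \<epsilon> :: real assume "0 < \<epsilon>"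
  interpret L: prob_space \<mu> by fact
  note [measurable_cong] = \<mu>(2)
  have sp: "space \<mu> = UNIV" using sets_eq_imp_space_eq[OF \<mu>(2)] by simp
  obtain K where K: "K > 0" "measure \<mu> {x. K < norm x} < \<epsilon>"
    using prob_space_norm_tail[OF \<mu> \<open>0 < \<epsilon>\<close>] by blast
  define f :: "'b \<Rightarrow> real" where "f x = max 0 (min 1 (norm x - K))" for x
  have f: "continuous_on UNIV f" unfolding f_def[abs_def] by (intro continuous_intros)
  have fb: "0 \<le> f x" "f x \<le> 1" for x by (auto simp: f_def)
  have [measurable]: "f \<in> borel_measurable borel" by (rule borel_measurable_continuous_onI[OF f])
  have "bounded (range f)" using fb by (intro boundedI[of _ 1]) auto
  with conv f have lim: "(\<lambda>n. \<integral>\<omega>. f (W n \<omega>) \<partial>M) \<longlonglongrightarrow> (\<integral>x. f x \<partial>\<mu>)" unfolding conv_distr_def by blast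
  have T: "{x. K < norm x} \<in> sets \<mu>" by (simp add: \<mu>(2))
  have i: "integrable \<mu> f" using fb by (auto intro!: L.integrable_const_bound[where B=1])
  have "(\<integral>x. f x \<partial>\<mu>) \<le> (\<integral>x. indicator {x. K < norm x} x \<partial>\<mu>)"
    using T by (intro integral_mono[OF i] integrable_real_indicator) (auto simp: indicator_def f_def L.emeasure_finite less_top[symmetric])
  also have "\<dots> = measure \<mu> {x. K < norm x}" using T by (simp add: sp)
  finally have "(\<integral>x. f x \<partial>\<mu>) < \<epsilon>" using K(2) by simp
  from order_tendstoD(2)[OF lim this]
  have "\<forall>\<^sub>F n in sequentially. prob {\<omega>\<in>space M. K + 1 < \<bar>norm (W n \<omega>)\<bar>} < \<epsilon>"
  proof eventually_elim
    case (elim n)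
    have i: "integrable M (\<lambda>\<omega>. f (W n \<omega>))" using fb by (auto intro!: integrable_const_bound[where B=1])
    have "prob {\<omega>\<in>space M. K + 1 < \<bar>norm (W n \<omega>)\<bar>} = (\<integral>\<omega>. indicator {\<omega>\<in>space M. K + 1 < \<bar>norm (W n \<omega>)\<bar>} \<omega> \<partial>M)" by simp
    also have "\<dots> \<le> (\<integral>\<omega>. f (W n \<omega>) \<partial>M)"
      by (intro integral_mono[OF _ i] integrable_real_indicator) (auto simp: indicator_def f_def less_top[symmetric])
    finally show ?case using elim by linarith
  qed
  then show "\<exists>K. \<forall>\<^sub>F n in sequentially. prob {\<omega>\<in>space M. K < \<bar>norm (W n \<omega>)\<bar>} < \<epsilon>" by blast
qed measurable

lemma bounded_in_prob_dominated:
  assumes V: "bounded_in_prob V" and W: "\<And>n. W n \<in> borel_measurable M"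
    and le: "\<And>n \<omega>. \<omega> \<in> space M \<Longrightarrow> \<bar>W n \<omega>\<bar> \<le> \<bar>V n \<omega>\<bar>"
  shows "bounded_in_prob W"
  unfolding bounded_in_prob_def
proof (intro conjI allI impI W)
  fix \<epsilon> :: real assume "0 < \<epsilon>"
  note [measurable] = W bounded_in_probD_measurable[OF V]
  obtain K where "\<forall>\<^sub>F n in sequentially. prob {\<omega>\<in>space M. K < \<bar>V n \<omega>\<bar>} < \<epsilon>"
    using V \<open>0 < \<epsilon>\<close> unfolding bounded_in_prob_def by blast
  then have "\<forall>\<^sub>F n in sequentially. prob {\<omega>\<in>space M. K < \<bar>W n \<omega>\<bar>} < \<epsilon>"
  proof eventually_elim
    case (elim n)
    have "prob {\<omega>\<in>space M. K < \<bar>W n \<omega>\<bar>} \<le> prob {\<omega>\<in>space M. K < \<bar>V n \<omega>\<bar>}"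
      using le[of _ n] by (intro finite_measure_mono) (auto intro: less_le_trans)
    with elim show ?case by linarith
  qed
  then show "\<exists>K. \<forall>\<^sub>F n in sequentially. prob {\<omega>\<in>space M. K < \<bar>W n \<omega>\<bar>} < \<epsilon>" by blast
qed

lemma bounded_in_prob_char:
  assumes W[measurable]: "\<And>n. W n \<in> borel_measurable M" and v: "0 \<le> v"
    and ch: "\<And>u. (\<lambda>n. \<integral>\<omega>. iexp (u * W n \<omega>) \<partial>M) \<longlonglongrightarrow> complex_of_real (exp (- (u\<^sup>2 * v) / 2))"
  shows "bounded_in_prob W"
proof -
  define W1 :: "nat \<Rightarrow> 'a \<Rightarrow> real^1" where "W1 n \<omega> = (\<chi> i. W n \<omega>)" for n \<omega>
  define V1 :: "real^1^1" where "V1 = (\<chi> i j. v)"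
  have [measurable]: "W1 n \<in> borel_measurable M" for n
    by (rule borel_measurable_vecI) (simp add: W1_def)
  have q: "s \<bullet> (V1 *v s) = (s $ 1)\<^sup>2 * v" for s
    by (simp add: inner_vec_def matrix_vector_mult_def sum_1 V1_def power2_eq_square)
  have "conv_normal M W1 V1"
  proof (rule conv_normal_char)
    show "psd V1" using v by (simp add: psd_def q transpose_def V1_def[symmetric]) (simp add: V1_def vec_eq_iff)
    show "(\<lambda>n. \<integral>\<omega>. iexp (s \<bullet> W1 n \<omega>) \<partial>M) \<longlonglongrightarrow> complex_of_real (exp (- (s \<bullet> (V1 *v s)) / 2))" for s
      using ch[of "s $ 1"] unfolding q by (simp add: inner_vec_def sum_1 W1_def)
  qed (auto intro: prob_space_axioms)
  then have "bounded_in_prob (\<lambda>n \<omega>. norm (W1 n \<omega>))"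
    by (intro conv_distr_norm_bounded_in_prob[OF _ prob_space_mvnormal[of V1]]) (auto simp: conv_normal_def)
  then show ?thesis
    by (rule bounded_in_prob_dominated) (auto simp: W1_def norm_real)
qed

lemma char_second_order:
  assumes \<xi>[measurable]: "\<xi> \<in> borel_measurable M" and sq: "integrable M (\<lambda>\<omega>. (\<xi> \<omega>)\<^sup>2)"
    and mean: "(\<integral>\<omega>. \<xi> \<omega> \<partial>M) = 0"
  shows "(\<lambda>n. of_nat n * ((\<integral>\<omega>. iexp (\<xi> \<omega> / sqrt (real n)) \<partial>M) - 1))
     \<longlonglongrightarrow> complex_of_real (- (\<integral>\<omega>. (\<xi> \<omega>)\<^sup>2 \<partial>M) / 2)"
proof -
  have int: "integrable M \<xi>" by (rule square_integrable_imp_integrable[OF \<xi> sq])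
  define g where "g n x = of_nat n * (iexp (x / sqrt (real n)) - 1 - \<i> * complex_of_real (x / sqrt (real n)))" for n x
  have gb: "cmod (g n x) \<le> x\<^sup>2 / 2" for n x
  proof (cases "n = 0")
    case False
    have "cmod (iexp (x / sqrt (real n)) - (1 + \<i> * complex_of_real (x / sqrt (real n)))) \<le> (x / sqrt (real n))\<^sup>2 / 2"
      using iexp_approx1[of "x / sqrt (real n)" 1] by (simp add: numeral_2_eq_2)
    also have "\<dots> = x\<^sup>2 / (2 * real n)" by (simp add: power_divide)
    finally have "real n * cmod (iexp (x / sqrt (real n)) - 1 - \<i> * complex_of_real (x / sqrt (real n))) \<le> real n * (x\<^sup>2 / (2 * real n))"
      by (intro mult_left_mono) (auto simp: algebra_simps)
    then show ?thesis using False by (simp add: g_def norm_mult)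
  qed (simp add: g_def)
  have gl: "(\<lambda>n. g n x) \<longlonglongrightarrow> complex_of_real (- x\<^sup>2 / 2)" for x
  proof (rule Lim_transform_eventually, rule LIM_zero_cancel, rule Lim_null_comparison)
    show "(\<lambda>n. \<bar>x\<bar>^3 / 6 * inverse (sqrt (real n))) \<longlonglongrightarrow> 0"
      by (intro tendsto_mult_right_zero tendsto_inverse_0_at_top filterlim_compose[OF sqrt_at_top] filterlim_real_sequentially)
    show "\<forall>\<^sub>F n in sequentially. norm (g n x - complex_of_real (- x\<^sup>2 / 2)) \<le> \<bar>x\<bar>^3 / 6 * inverse (sqrt (real n))"
      using eventually_gt_at_top[of 0]
    proof eventually_elim
      case (elim n)
      define y where "y = x / sqrt (real n)"
      have n: "of_nat n * y\<^sup>2 = x\<^sup>2" using elim by (simp add: y_def power_divide)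
      have "g n x - complex_of_real (- x\<^sup>2 / 2) = of_nat n * (iexp y - (\<Sum>k\<le>2. (\<i> * complex_of_real y) ^ k / fact k))"
        unfolding n[symmetric] g_def y_def[symmetric]
        by (simp add: numeral_2_eq_2 algebra_simps power_mult_distrib)
      also have "norm \<dots> \<le> real n * (\<bar>y\<bar>^3 / 6)"
        using iexp_approx1[of y 2] by (simp only: norm_mult norm_of_nat) (intro mult_left_mono, simp_all add: numeral_3_eq_3 fact_numeral)
      also have "\<dots> = \<bar>x\<bar>^3 / 6 * inverse (sqrt (real n))"
        using elim by (simp add: y_def power_divide power3_eq_cube field_simps)
      finally show ?case .
    qed
  qed simp
  have gm [measurable]: "(\<lambda>\<omega>. g n (\<xi> \<omega>)) \<in> borel_measurable M" for n unfolding g_def by measurable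
  have "(\<lambda>n. \<integral>\<omega>. g n (\<xi> \<omega>) \<partial>M) \<longlonglongrightarrow> (\<integral>\<omega>. complex_of_real (- (\<xi> \<omega>)\<^sup>2 / 2) \<partial>M)"
    using sq by (intro integral_dominated_convergence[where w="\<lambda>\<omega>. (\<xi> \<omega>)\<^sup>2 / 2"] AE_I2 gl) (simp_all only: gb, simp_all)
  moreover have "(\<integral>\<omega>. g n (\<xi> \<omega>) \<partial>M) = of_nat n * ((\<integral>\<omega>. iexp (\<xi> \<omega> / sqrt (real n)) \<partial>M) - 1)" for n
  proof -
    have "integrable M (\<lambda>\<omega>. iexp (\<xi> \<omega> / sqrt (real n)))" by (rule integrable_const_bound[where B=1]) auto
    moreover have "integrable M (\<lambda>\<omega>. \<i> * complex_of_real (\<xi> \<omega> / sqrt (real n)))" using int by (intro integrable_mult_right integrable_of_real) simp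
    moreover have "(\<integral>\<omega>. \<i> * complex_of_real (\<xi> \<omega> / sqrt (real n)) \<partial>M) = 0"
      unfolding integral_mult_right_zero integral_complex_of_real using mean by simp
    ultimately show ?thesis unfolding g_def by (simp add: prob_space)
  qed
  moreover have "(\<integral>\<omega>. complex_of_real (- (\<xi> \<omega>)\<^sup>2 / 2) \<partial>M) = complex_of_real (- (\<integral>\<omega>. (\<xi> \<omega>)\<^sup>2 \<partial>M) / 2)"
    unfolding integral_complex_of_real by simp
  ultimately show ?thesis by simp
qed

end

lemma exp_minus_approx:
  fixes x :: real assumes "0 \<le> x"
  shows "\<bar>exp (- x) - (1 - x)\<bar> \<le> x\<^sup>2"
proof -
  have "exp (- x) \<le> 1 / (1 + x)" using exp_ge_add_one_self[of x] assms by (simp add: exp_minus field_simps)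
  also have "1 / (1 + x) \<le> 1 - x + x\<^sup>2"
  proof -
    have "(1 - x + x\<^sup>2) * (1 + x) = 1 + x ^ 3" by (simp add: algebra_simps power2_eq_square power3_eq_cube)
    moreover have "0 \<le> x ^ 3" using assms by simp
    ultimately show ?thesis using assms by (simp add: divide_le_eq)
  qed
  finally show ?thesis using exp_ge_add_one_self[of "-x"] by simp
qed

lemma second_order_exp_diff:
  fixes \<phi> :: "nat \<Rightarrow> complex"
  assumes \<phi>: "(\<lambda>n. of_nat n * (\<phi> n - 1)) \<longlonglongrightarrow> complex_of_real (- v / 2)" and v: "0 \<le> v"
  shows "(\<lambda>n. real n * cmod (\<phi> n - complex_of_real (exp (- (v / 2) / real n)))) \<longlonglongrightarrow> 0"
proof -
  have "(\<lambda>n. real n * (exp (- (v / 2) / real n) - 1) + v / 2) \<longlonglongrightarrow> 0"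
  proof (rule Lim_null_comparison)
    show "(\<lambda>n. (v / 2)\<^sup>2 * inverse (real n)) \<longlonglongrightarrow> 0"
      by (intro tendsto_mult_right_zero lim_inverse_n)
    show "\<forall>\<^sub>F n in sequentially. norm (real n * (exp (- (v / 2) / real n) - 1) + v / 2) \<le> (v / 2)\<^sup>2 * inverse (real n)"
      using eventually_gt_at_top[of 0]
    proof eventually_elim
      case (elim n)
      have "real n * (exp (- (v / 2) / real n) - 1) + v / 2 = real n * (exp (- (v / 2 / real n)) - (1 - v / 2 / real n))"
        using elim by (simp add: field_simps)
      also have "\<bar>\<dots>\<bar> \<le> real n * (v / 2 / real n)\<^sup>2"
        unfolding abs_mult using exp_minus_approx[of "v / 2 / real n"] v by (intro mult_mono) auto
      also have "\<dots> = (v / 2)\<^sup>2 * inverse (real n)" using elim by (simp add: power2_eq_square field_simps)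
      finally show ?case by simp
    qed
  qed
  from tendsto_of_real[OF this, where ?'a=complex]
  have 2: "(\<lambda>n. of_nat n * (complex_of_real (exp (- (v / 2) / real n)) - 1) + complex_of_real (v / 2)) \<longlonglongrightarrow> 0" by simp
  have "(\<lambda>n. (of_nat n * (\<phi> n - 1) + complex_of_real (v / 2)) - (of_nat n * (complex_of_real (exp (- (v / 2) / real n)) - 1) + complex_of_real (v / 2)))
     \<longlonglongrightarrow> (complex_of_real (- v / 2) + complex_of_real (v / 2)) - 0"
    by (intro tendsto_diff 2 tendsto_add \<phi> tendsto_const)
  then have "(\<lambda>n. of_nat n * (\<phi> n - complex_of_real (exp (- (v / 2) / real n)))) \<longlonglongrightarrow> 0"
    by (simp add: algebra_simps)
  from tendsto_norm[OF this] show ?thesis by (simp add: norm_mult)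
qed

lemma integral_uniform_measure:
  fixes f :: "'a \<Rightarrow> 'b::{banach,second_countable_topology}"
  assumes [measurable]: "f \<in> borel_measurable M" "C \<in> sets M" and "finite_measure M" and pos: "0 < measure M C"
  shows "(\<integral>x. f x \<partial>uniform_measure M C) = (\<integral>x. indicator C x *\<^sub>R f x \<partial>M) /\<^sub>R measure M C"
proof -
  interpret finite_measure M by fact
  have "uniform_measure M C = density M (\<lambda>x. ennreal (indicator C x / measure M C))"
    unfolding uniform_measure_def
    by (intro density_cong AE_I2) (auto simp: emeasure_eq_measure indicator_def divide_ennreal[symmetric] pos)
  then have "(\<integral>x. f x \<partial>uniform_measure M C) = (\<integral>x. (indicator C x / measure M C) *\<^sub>R f x \<partial>M)"
    by (simp add: integral_density)
  also have "\<dots> = (\<integral>x. (1 / measure M C) *\<^sub>R (indicator C x *\<^sub>R f x) \<partial>M)"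
    by (simp add: mult.commute)
  also have "\<dots> = (1 / measure M C) *\<^sub>R (\<integral>x. indicator C x *\<^sub>R f x \<partial>M)"
    by (rule integral_scaleR_right)
  finally show ?thesis by (simp add: inverse_eq_divide)
qed

lemma exp_minus_lipschitz:
  fixes a b :: real assumes "0 \<le> a" "0 \<le> b"
  shows "\<bar>exp (- a) - exp (- b)\<bar> \<le> \<bar>a - b\<bar>"
proof -
  have "exp (- a) - exp (- b) \<le> b - a" if "0 \<le> a" "a \<le> b" for a b :: real
  proof -
    have "exp (- a) - exp (- b) = exp (- a) * (1 - exp (- (b - a)))" by (simp add: algebra_simps exp_add[symmetric])
    also have "\<dots> \<le> 1 * (b - a)"
    proof (rule mult_mono)
      show "1 - exp (- (b - a)) \<le> b - a" using exp_ge_add_one_self[of "- (b - a)"] by linarith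
    qed (use that in auto)
    finally show ?thesis by simp
  qed
  from this[of a b] this[of b a] show ?thesis
    using assms by (cases "a \<le> b") (auto simp: abs_if)
qed

lemma borel_measurable_vec_component [measurable (raw)]:
  fixes f :: "'a \<Rightarrow> real^'n"
  assumes "f \<in> borel_measurable M"
  shows "(\<lambda>x. f x $ i) \<in> borel_measurable M"
  using assms by (rule measurable_compose) (auto intro!: borel_measurable_continuous_onI continuous_intros)

subsection \<open>Conditioning on strata and assignments\<close>

locale covariate_adaptive_trial = prob_space M
  for M :: "'a measure" +
  fixes Y :: "nat \<Rightarrow> 'a \<Rightarrow> real^'k"
    and Z :: "nat \<Rightarrow> 'a \<Rightarrow> 'z::finite"
    and X :: "nat \<Rightarrow> 'a \<Rightarrow> real^'p"
    and A :: "nat \<Rightarrow> nat \<Rightarrow> 'a \<Rightarrow> 'k"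
    and pv :: "real^'k"
    and Om :: "'z \<Rightarrow> real^'k^'k"
  assumes meas: "\<And>i. (\<lambda>\<omega>. (Y i \<omega>, Z i \<omega>, X i \<omega>))
                 \<in> M \<rightarrow>\<^sub>M (borel \<Otimes>\<^sub>M count_space UNIV \<Otimes>\<^sub>M borel)"
    and indep: "indep_vars (\<lambda>_. borel \<Otimes>\<^sub>M count_space UNIV \<Otimes>\<^sub>M borel)
                 (\<lambda>i \<omega>. (Y i \<omega>, Z i \<omega>, X i \<omega>)) UNIV"
    and ident: "\<And>i. distr M (borel \<Otimes>\<^sub>M count_space UNIV \<Otimes>\<^sub>M borel) (\<lambda>\<omega>. (Y i \<omega>, Z i \<omega>, X i \<omega>))
                   = distr M (borel \<Otimes>\<^sub>M count_space UNIV \<Otimes>\<^sub>M borel) (\<lambda>\<omega>. (Y 0 \<omega>, Z 0 \<omega>, X 0 \<omega>))"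
    and mom_Y: "\<And>t. integrable M (\<lambda>\<omega>. (Y 0 \<omega> $ t)\<^sup>2)"
    and mom_X: "\<And>j. integrable M (\<lambda>\<omega>. (X 0 \<omega> $ j)\<^sup>2)"
    and pi_pos: "\<And>t. 0 < pv $ t \<and> pv $ t < 1"
    and pi_sum: "(\<Sum>t\<in>UNIV. pv $ t) = 1"
    and A_meas: "\<And>n i. A n i \<in> M \<rightarrow>\<^sub>M count_space UNIV"
    and C2i: "\<And>n. cond_indep M (\<lambda>\<omega>. map (\<lambda>i. Z i \<omega>) [0..<n])
                 {(\<lambda>\<omega>. map (\<lambda>i. A n i \<omega>) [0..<n]) -` S \<inter> space M | S. True}
                 (sigma_sets (space M) (\<Union>i\<in>{..<n}.
                    {(\<lambda>\<omega>. (Y i \<omega>, X i \<omega>)) -` U \<inter> space M | U.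
                       U \<in> sets (borel :: ((real^'k) \<times> (real^'p)) measure)}))"
    and C2ii: "AE \<omega> in M. \<forall>z t.
                 (\<lambda>n. real (card {i. i < n \<and> Z i \<omega> = z \<and> A n i \<omega> = t})
                        / real (card {i. i < n \<and> Z i \<omega> = z})) \<longlonglongrightarrow> pv $ t"
    and C3: "cond_conv_normal M (\<lambda>n \<omega>. map (\<lambda>i. Z i \<omega>) [0..<n])
               (\<lambda>n \<omega>. \<chi> zt. sqrt (real n) *
                   (real (card {i. i < n \<and> Z i \<omega> = fst zt \<and> A n i \<omega> = snd zt})
                      / real (card {i. i < n \<and> Z i \<omega> = fst zt}) - pv $ snd zt))
               (\<chi> zt zt'. if fst zt = fst zt'
                  then Om (fst zt) $ snd zt $ snd zt'
                        / measure M {\<omega>\<in>space M. Z 0 \<omega> = fst zt}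
                  else 0)"
begin

abbreviation "unitM \<equiv> (borel :: (real^'k) measure) \<Otimes>\<^sub>M (count_space UNIV :: 'z measure) \<Otimes>\<^sub>M (borel :: (real^'p) measure)"

definition unit :: "nat \<Rightarrow> 'a \<Rightarrow> (real^'k) \<times> 'z \<times> (real^'p)" where
  "unit i \<omega> = (Y i \<omega>, Z i \<omega>, X i \<omega>)"

definition pz :: "'z \<Rightarrow> real" where
  "pz z = prob {\<omega>\<in>space M. Z 0 \<omega> = z}"

definition Zs :: "nat \<Rightarrow> 'a \<Rightarrow> 'z list" where
  "Zs n \<omega> = map (\<lambda>i. Z i \<omega>) [0..<n]"

definition As :: "nat \<Rightarrow> 'a \<Rightarrow> 'k list" where
  "As n \<omega> = map (\<lambda>i. A n i \<omega>) [0..<n]"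

lemma measurable_unit [measurable]: "unit i \<in> M \<rightarrow>\<^sub>M unitM"
  using meas[of i] by (simp add: unit_def[abs_def])

lemma measurable_Y [measurable]: "Y i \<in> borel_measurable M"
  using measurable_compose[OF measurable_unit measurable_fst, of i] by (simp add: unit_def)

lemma measurable_Z [measurable]: "Z i \<in> M \<rightarrow>\<^sub>M count_space UNIV"
  using measurable_compose[OF measurable_compose[OF measurable_unit measurable_snd] measurable_fst, of i]
  by (simp add: unit_def)

lemma measurable_X [measurable]: "X i \<in> borel_measurable M"
  using measurable_compose[OF measurable_compose[OF measurable_unit measurable_snd] measurable_snd, of i]
  by (simp add: unit_def)

lemmas [measurable] = A_meas

lemma Zs_eq_iff: "Zs n \<omega> = zs \<longleftrightarrow> length zs = n \<and> (\<forall>i<n. Z i \<omega> = zs ! i)"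
  by (auto simp: Zs_def intro!: nth_equalityI)

lemma As_eq_iff: "As n \<omega> = as \<longleftrightarrow> length as = n \<and> (\<forall>i<n. A n i \<omega> = as ! i)"
  by (auto simp: As_def intro!: nth_equalityI)

lemma measurable_Zs [measurable]: "Zs n \<in> M \<rightarrow>\<^sub>M count_space UNIV"
proof (subst measurable_count_space_eq2_countable, safe)
  fix zs :: "'z list"
  have "Zs n -` {zs} \<inter> space M = {\<omega>\<in>space M. length zs = n \<and> (\<forall>i<n. Z i \<omega> = zs ! i)}"
    unfolding Zs_eq_iff[symmetric] by auto
  also have "\<dots> \<in> sets M" by measurable
  finally show "Zs n -` {zs} \<inter> space M \<in> sets M" .
qed auto

lemma measurable_As [measurable]: "As n \<in> M \<rightarrow>\<^sub>M count_space UNIV"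
proof (subst measurable_count_space_eq2_countable, safe)
  fix as :: "'k list"
  have "As n -` {as} \<inter> space M = {\<omega>\<in>space M. length as = n \<and> (\<forall>i<n. A n i \<omega> = as ! i)}"
    unfolding As_eq_iff[symmetric] by auto
  also have "\<dots> \<in> sets M" by measurable
  finally show "As n -` {as} \<inter> space M \<in> sets M" .
qed auto

lemma distr_unit: "distr M unitM (unit i) = distr M unitM (unit 0)"
  unfolding unit_def[abs_def] by (rule ident)

lemma integral_unit:
  fixes f :: "_ \<Rightarrow> 'b::{banach,second_countable_topology}"
  assumes [measurable]: "f \<in> borel_measurable unitM"
  shows "(\<integral>\<omega>. f (unit i \<omega>) \<partial>M) = (\<integral>\<omega>. f (unit 0 \<omega>) \<partial>M)"
proof -
  have "(\<integral>\<omega>. f (unit i \<omega>) \<partial>M) = (\<integral>x. f x \<partial>distr M unitM (unit i))"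
    by (simp add: integral_distr)
  also have "\<dots> = (\<integral>x. f x \<partial>distr M unitM (unit 0))"
    by (simp only: distr_unit[of i])
  also have "\<dots> = (\<integral>\<omega>. f (unit 0 \<omega>) \<partial>M)"
    by (simp add: integral_distr)
  finally show ?thesis .
qed

lemma AE_unit:
  assumes [measurable]: "Measurable.pred unitM P" and ae: "AE \<omega> in M. P (unit 0 \<omega>)"
  shows "AE \<omega> in M. P (unit i \<omega>)"
proof -
  have "AE x in distr M unitM (unit 0). P x"
    using ae by (subst AE_distr_iff) auto
  then have "AE x in distr M unitM (unit i). P x"
    by (simp only: distr_unit[of i])
  then show ?thesis by (subst (asm) AE_distr_iff) auto
qed

lemma integral_prod_units:
  fixes f :: "nat \<Rightarrow> _ \<Rightarrow> complex"
  assumes f[measurable]: "\<And>i. f i \<in> borel_measurable unitM" and b: "\<And>i x. cmod (f i x) \<le> 1"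
  shows "(\<integral>\<omega>. (\<Prod>i<n. f i (unit i \<omega>)) \<partial>M) = (\<Prod>i<n. \<integral>\<omega>. f i (unit 0 \<omega>) \<partial>M)"
proof -
  have "indep_vars (\<lambda>_. unitM) unit {..<n}"
    by (rule indep_vars_subset[OF indep[folded unit_def[abs_def]]]) (auto simp: unit_def[abs_def])
  then have "indep_vars (\<lambda>_. borel) (\<lambda>i \<omega>. f i (unit i \<omega>)) {..<n}"
    by (rule indep_vars_compose2) measurable
  then have "(\<integral>\<omega>. (\<Prod>i<n. f i (unit i \<omega>)) \<partial>M) = (\<Prod>i<n. \<integral>\<omega>. f i (unit i \<omega>) \<partial>M)"
    by (intro indep_vars_lebesgue_integral integrable_const_bound[where B=1] AE_I2 b) auto
  also have "\<dots> = (\<Prod>i<n. \<integral>\<omega>. f i (unit 0 \<omega>) \<partial>M)"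
    by (intro prod.cong refl integral_unit) measurable
  finally show ?thesis .
qed

text \<open>A stratum of probability zero is almost surely empty, so its ratio in (C2)(ii) is the junk value
  \<open>0 / 0 = 0\<close>, which does not tend to a positive limit.\<close>

lemma pz_pos: "0 < pz z"
proof (rule ccontr)
  assume "\<not> 0 < pz z"
  then have "pz z = 0" using measure_nonneg[of M] by (simp add: pz_def not_less antisym)
  then have 0: "AE \<omega> in M. Z 0 \<omega> \<noteq> z"
    by (intro AE_I'[of "{\<omega>\<in>space M. Z 0 \<omega> = z}"]) (auto simp: pz_def null_sets_def emeasure_eq_measure)
  have "AE \<omega> in M. Z i \<omega> \<noteq> z" for i
    using AE_unit[of "\<lambda>(y,z',x). z' \<noteq> z" i] 0 by (simp add: unit_def)
  then have "AE \<omega> in M. \<forall>i. Z i \<omega> \<noteq> z" by (subst AE_all_countable) auto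
  with C2ii have "AE \<omega> in M. \<forall>t. pv $ t = 0"
  proof eventually_elim
    case (elim \<omega>)
    have "(\<lambda>n. 0) \<longlonglongrightarrow> pv $ t" for t using elim by (auto dest: spec[of _ z])
    then show ?case by (simp add: LIMSEQ_const_iff)
  qed
  then show False using pi_pos by (simp add: less_le)
qed

lemma prob_Zs:
  assumes "length zs = n"
  shows "prob {\<omega>\<in>space M. Zs n \<omega> = zs} = (\<Prod>i<n. pz (zs ! i))"
proof -
  have "(\<integral>\<omega>. (\<Prod>i<n. (\<lambda>(y,z,x). if z = zs ! i then 1 else 0) (unit i \<omega>)) \<partial>M)
      = (\<Prod>i<n. \<integral>\<omega>. (\<lambda>(y,z,x). if z = zs ! i then 1 else 0) (unit 0 \<omega>) \<partial>M :: complex)"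
    by (rule integral_prod_units) (auto simp: case_prod_beta split: if_split)
  moreover have "(\<lambda>\<omega>. \<Prod>i<n. (\<lambda>(y,z,x). if z = zs ! i then 1 else 0) (unit i \<omega>)) = (\<lambda>\<omega>. complex_of_real (if Zs n \<omega> = zs then 1 else 0))"
    using assms by (auto simp: fun_eq_iff unit_def Zs_eq_iff)
  moreover have "(\<integral>\<omega>. (if Zs n \<omega> = zs then 1 else 0) \<partial>M) = prob {\<omega>\<in>space M. Zs n \<omega> = zs}"
  proof -
    have "(\<integral>\<omega>. (if Zs n \<omega> = zs then 1 else 0::real) \<partial>M) = (\<integral>\<omega>. indicator {\<omega>\<in>space M. Zs n \<omega> = zs} \<omega> \<partial>M)"
      by (intro Bochner_Integration.integral_cong) auto
    then show ?thesis by simp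
  qed
  moreover have "(\<integral>\<omega>. (\<lambda>(y,z,x). if z = zs ! i then 1 else 0) (unit 0 \<omega>) \<partial>M) = complex_of_real (pz (zs ! i))" for i
  proof -
    have "(\<integral>\<omega>. (\<lambda>(y,z,x). if z = zs ! i then 1 else 0) (unit 0 \<omega>) \<partial>M) = (\<integral>\<omega>. complex_of_real (indicator {\<omega>\<in>space M. Z 0 \<omega> = zs ! i} \<omega>) \<partial>M)"
      by (intro Bochner_Integration.integral_cong) (auto simp: unit_def)
    then show ?thesis unfolding integral_complex_of_real by (simp add: pz_def)
  qed
  ultimately have "complex_of_real (prob {\<omega>\<in>space M. Zs n \<omega> = zs}) = complex_of_real (\<Prod>i<n. pz (zs ! i))"
    by (simp only: integral_complex_of_real of_real_prod)
  then show ?thesis by (simp only: of_real_eq_iff)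
qed

lemma cond_indep_cell:
  assumes len: "length zs = n"
    and T: "T \<in> sigma_sets (space M) (\<Union>i\<in>{..<n}. {(\<lambda>\<omega>. (Y i \<omega>, X i \<omega>)) -` U \<inter> space M | U.
                       U \<in> sets (borel :: ((real^'k) \<times> (real^'p)) measure)})"
  shows "prob ({\<omega>\<in>space M. As n \<omega> = as \<and> Zs n \<omega> = zs} \<inter> T) * prob {\<omega>\<in>space M. Zs n \<omega> = zs}
       = prob {\<omega>\<in>space M. As n \<omega> = as \<and> Zs n \<omega> = zs} * prob ({\<omega>\<in>space M. Zs n \<omega> = zs} \<inter> T)"
proof -
  define C where "C = {\<omega>\<in>space M. Zs n \<omega> = zs}"
  define S where "S = As n -` {as} \<inter> space M"
  have C[measurable]: "C \<in> sets M" unfolding C_def by measurable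
  have pC: "0 < prob C" unfolding C_def prob_Zs[OF len] by (intro prod_pos) (auto simp: pz_pos)
  have "AE \<omega> in M. cond_prob_at M (Zs n) (S \<inter> T) \<omega> = cond_prob_at M (Zs n) S \<omega> * cond_prob_at M (Zs n) T \<omega>"
  proof -
    have eq: "(\<lambda>\<omega>. map (\<lambda>i. Z i \<omega>) [0..<n]) = Zs n" "(\<lambda>\<omega>. map (\<lambda>i. A n i \<omega>) [0..<n]) = As n"
      by (auto simp: Zs_def As_def)
    show ?thesis
      using C2i[of n] T unfolding cond_indep_def eq S_def by blast
  qed
  then have "\<exists>\<omega>\<in>C. cond_prob_at M (Zs n) (S \<inter> T) \<omega> = cond_prob_at M (Zs n) S \<omega> * cond_prob_at M (Zs n) T \<omega>"
  proof (rule contrapos_pp)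
    assume *: "\<not> (\<exists>\<omega>\<in>C. cond_prob_at M (Zs n) (S \<inter> T) \<omega> = cond_prob_at M (Zs n) S \<omega> * cond_prob_at M (Zs n) T \<omega>)"
    show "\<not> (AE \<omega> in M. cond_prob_at M (Zs n) (S \<inter> T) \<omega> = cond_prob_at M (Zs n) S \<omega> * cond_prob_at M (Zs n) T \<omega>)"
    proof
      assume "AE \<omega> in M. cond_prob_at M (Zs n) (S \<inter> T) \<omega> = cond_prob_at M (Zs n) S \<omega> * cond_prob_at M (Zs n) T \<omega>"
      then have "AE \<omega> in M. \<omega> \<notin> C" by eventually_elim (use * in auto)
      then have "prob C = 0" using prob_eq_0[OF C] by simp
      with pC show False by simp
    qed
  qed
  then obtain \<omega> where \<omega>: "\<omega> \<in> C" "cond_prob_at M (Zs n) (S \<inter> T) \<omega> = cond_prob_at M (Zs n) S \<omega> * cond_prob_at M (Zs n) T \<omega>" by blast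
  have CC: "{\<omega>'\<in>space M. Zs n \<omega>' = Zs n \<omega>} = C" using \<omega>(1) by (auto simp: C_def)
  have "prob (S \<inter> T \<inter> C) / prob C = prob (S \<inter> C) / prob C * (prob (T \<inter> C) / prob C)"
    using \<omega>(2) unfolding cond_prob_at_def CC .
  then have "prob (S \<inter> T \<inter> C) * prob C = prob (S \<inter> C) * prob (T \<inter> C)"
    using pC by (simp add: field_simps)
  moreover have "{\<omega>\<in>space M. As n \<omega> = as \<and> Zs n \<omega> = zs} = S \<inter> C" by (auto simp: S_def C_def)
  ultimately show ?thesis by (simp add: C_def[symmetric] Int_ac)
qed

text \<open>Once the strata are fixed, the product is a function of the \<open>Y\<^sub>i\<close> and \<open>X\<^sub>i\<close> alone, so (C2)(i) allows to
  drop the condition on the assignments.\<close>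

lemma integral_cell:
  fixes f :: "'k \<Rightarrow> _ \<Rightarrow> complex"
  assumes len: "length zs = n" "length as = n"
    and f[measurable]: "\<And>t. f t \<in> borel_measurable unitM" and b: "\<And>t x. cmod (f t x) \<le> 1"
  shows "(\<integral>\<omega>. indicator {\<omega>\<in>space M. As n \<omega> = as \<and> Zs n \<omega> = zs} \<omega> *\<^sub>R (\<Prod>i<n. f (as ! i) (unit i \<omega>)) \<partial>M)
    = prob {\<omega>\<in>space M. As n \<omega> = as \<and> Zs n \<omega> = zs} *\<^sub>R
       (\<Prod>i<n. (\<integral>\<omega>. indicator {\<omega>\<in>space M. Z 0 \<omega> = zs ! i} \<omega> *\<^sub>R f (as ! i) (unit 0 \<omega>) \<partial>M) / pz (zs ! i))"
proof -
  define C where "C = {\<omega>\<in>space M. Zs n \<omega> = zs}"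
  define E where "E = {\<omega>\<in>space M. As n \<omega> = as \<and> Zs n \<omega> = zs}"
  define F where "F \<omega> = (\<Prod>i<n. f (as ! i) (Y i \<omega>, zs ! i, X i \<omega>))" for \<omega>
  have C[measurable]: "C \<in> sets M" unfolding C_def by measurable
  have E[measurable]: "E \<in> sets M" unfolding E_def by measurable
  have pC: "prob C = (\<Prod>i<n. pz (zs ! i))" unfolding C_def by (rule prob_Zs[OF len(1)])
  have pC0: "0 < prob C" unfolding pC by (intro prod_pos) (auto simp: pz_pos)
  have [measurable]: "(\<lambda>\<omega>. f (as ! i) (Y i \<omega>, zs ! i, X i \<omega>)) \<in> borel_measurable M" for i by measurable
  have FM[measurable]: "F \<in> borel_measurable M" unfolding F_def by measurable
  define gens where "gens = (\<Union>i\<in>{..<n}. {(\<lambda>\<omega>. (Y i \<omega>, X i \<omega>)) -` U \<inter> space M | U.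
                       U \<in> sets (borel :: ((real^'k) \<times> (real^'p)) measure)})"
  define N where "N = sigma (space M) gens"
  have gens: "gens \<subseteq> Pow (space M)" by (auto simp: gens_def)
  have sN: "space N = space M" "sets N = sigma_sets (space M) gens"
    using gens by (auto simp: N_def space_measure_of sets_measure_of)
  have "gens \<subseteq> sets M"
    unfolding gens_def by (auto intro!: measurable_sets[of _ _ borel] borel_measurable_Pair)
  then have NM: "sets N \<subseteq> sets M" unfolding sN by (intro sets.sigma_sets_subset)
  have YX: "(\<lambda>\<omega>. (Y i \<omega>, X i \<omega>)) \<in> N \<rightarrow>\<^sub>M borel" if "i < n" for i
  proof (rule measurableI)
    fix U assume "U \<in> sets (borel :: ((real^'k) \<times> (real^'p)) measure)"
    then show "(\<lambda>\<omega>. (Y i \<omega>, X i \<omega>)) -` U \<inter> space N \<in> sets N"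
      unfolding sN using that by (intro sigma_sets.Basic) (auto simp: gens_def)
  qed auto
  have FN: "F \<in> borel_measurable N"
    unfolding F_def
  proof (intro borel_measurable_prod)
    fix i assume "i \<in> {..<n}"
    then have "i < n" by simp
    have "(\<lambda>yx. f (as ! i) (fst yx, zs ! i, snd yx)) \<in> borel_measurable (borel \<Otimes>\<^sub>M borel)" by measurable
    then have "(\<lambda>yx. f (as ! i) (fst yx, zs ! i, snd yx)) \<in> borel_measurable borel" by (simp add: borel_prod)
    from measurable_compose[OF YX[OF \<open>i < n\<close>] this]
    show "(\<lambda>\<omega>. f (as ! i) (Y i \<omega>, zs ! i, X i \<omega>)) \<in> borel_measurable N" by simp
  qed
  have FC: "(\<integral>\<omega>. indicator C \<omega> *\<^sub>R F \<omega> \<partial>M) = (\<Prod>i<n. \<integral>\<omega>. indicator {\<omega>\<in>space M. Z 0 \<omega> = zs ! i} \<omega> *\<^sub>R f (as ! i) (unit 0 \<omega>) \<partial>M)"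
  proof -
    define h where "h i x = (if fst (snd x) = zs ! i then f (as ! i) x else 0)" for i x
    have [measurable]: "h i \<in> borel_measurable unitM" for i unfolding h_def by measurable
    have "indicator C \<omega> *\<^sub>R F \<omega> = (\<Prod>i<n. h i (unit i \<omega>))" if "\<omega> \<in> space M" for \<omega>
    proof (cases "\<omega> \<in> C")
      case True
      then have z: "Z i \<omega> = zs ! i" if "i < n" for i using that by (auto simp: C_def Zs_eq_iff)
      show ?thesis using True by (auto simp: F_def h_def unit_def z intro!: prod.cong)
    next
      case False
      then obtain i where "i < n" "Z i \<omega> \<noteq> zs ! i" using \<open>\<omega> \<in> space M\<close> len by (auto simp: C_def Zs_eq_iff)
      then have "(\<Prod>i<n. h i (unit i \<omega>)) = 0" by (intro prod_zero) (auto simp: h_def unit_def)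
      then show ?thesis using False by simp
    qed
    then have "(\<integral>\<omega>. indicator C \<omega> *\<^sub>R F \<omega> \<partial>M) = (\<integral>\<omega>. (\<Prod>i<n. h i (unit i \<omega>)) \<partial>M)"
      by (intro Bochner_Integration.integral_cong) auto
    also have "\<dots> = (\<Prod>i<n. \<integral>\<omega>. h i (unit 0 \<omega>) \<partial>M)"
      by (rule integral_prod_units) (auto simp: h_def b)
    also have "\<dots> = (\<Prod>i<n. \<integral>\<omega>. indicator {\<omega>\<in>space M. Z 0 \<omega> = zs ! i} \<omega> *\<^sub>R f (as ! i) (unit 0 \<omega>) \<partial>M)"
      by (intro prod.cong refl Bochner_Integration.integral_cong) (auto simp: h_def unit_def)
    finally show ?thesis .
  qed
  have EF: "(\<integral>\<omega>. indicator E \<omega> *\<^sub>R (\<Prod>i<n. f (as ! i) (unit i \<omega>)) \<partial>M) = (\<integral>\<omega>. indicator E \<omega> *\<^sub>R F \<omega> \<partial>M)"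
  proof (intro Bochner_Integration.integral_cong refl)
    fix \<omega> assume "\<omega> \<in> space M"
    show "indicator E \<omega> *\<^sub>R (\<Prod>i<n. f (as ! i) (unit i \<omega>)) = indicator E \<omega> *\<^sub>R F \<omega>"
    proof (cases "\<omega> \<in> E")
      case True
      then have z: "Z i \<omega> = zs ! i" if "i < n" for i using that by (auto simp: E_def Zs_eq_iff)
      show ?thesis by (auto simp: F_def unit_def z intro!: prod.cong)
    qed simp
  qed
  have main: "(\<integral>\<omega>. indicator E \<omega> *\<^sub>R F \<omega> \<partial>M) = prob E *\<^sub>R ((\<integral>\<omega>. indicator C \<omega> *\<^sub>R F \<omega> \<partial>M) /\<^sub>R prob C)"
  proof (cases "prob E = 0")
    case True
    then have "AE \<omega> in M. \<omega> \<notin> E" using prob_eq_0[OF E] by simp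
    then have "(\<integral>\<omega>. indicator E \<omega> *\<^sub>R F \<omega> \<partial>M) = 0"
      by (intro integral_eq_zero_AE) (auto simp: indicator_def)
    then show ?thesis using True by simp
  next
    case False
    then have pE: "0 < prob E" by (simp add: measure_nonneg less_le)
    have id: "(\<lambda>\<omega>. \<omega>) \<in> uniform_measure M B \<rightarrow>\<^sub>M N" for B
      using NM by (intro measurableI) (auto simp: sN)
    interpret UE: prob_space "uniform_measure M E"
      using pE by (intro prob_space_uniform_measure) (auto simp: emeasure_eq_measure)
    interpret UC: prob_space "uniform_measure M C"
      using pC0 by (intro prob_space_uniform_measure) (auto simp: emeasure_eq_measure)
    have "distr (uniform_measure M E) N (\<lambda>\<omega>. \<omega>) = distr (uniform_measure M C) N (\<lambda>\<omega>. \<omega>)"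
    proof (rule measure_eqI)
      fix T assume "T \<in> sets (distr (uniform_measure M E) N (\<lambda>\<omega>. \<omega>))"
      then have T: "T \<in> sets N" by simp
      then have TM[measurable]: "T \<in> sets M" using NM by auto
      have "prob (E \<inter> T) * prob C = prob E * prob (C \<inter> T)"
        unfolding E_def C_def using T by (intro cond_indep_cell[OF len(1)]) (simp add: sN gens_def)
      then have "prob (E \<inter> T) / prob E = prob (C \<inter> T) / prob C"
        using pE pC0 by (simp add: field_simps)
      then have "measure (uniform_measure M E) T = measure (uniform_measure M C) T"
        using pE pC0 by (subst (1 2) measure_uniform_measure) (auto simp: emeasure_eq_measure)
      moreover have "(\<lambda>\<omega>. \<omega>) -` T \<inter> space (uniform_measure M B) = T" for B
        using sets.sets_into_space[OF TM] by auto
      ultimately show "emeasure (distr (uniform_measure M E) N (\<lambda>\<omega>. \<omega>)) T = emeasure (distr (uniform_measure M C) N (\<lambda>\<omega>. \<omega>)) T"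
        by (simp only: emeasure_distr[OF id T] UE.emeasure_eq_measure UC.emeasure_eq_measure)
    qed simp
    then have "(\<integral>\<omega>. F \<omega> \<partial>distr (uniform_measure M E) N (\<lambda>\<omega>. \<omega>)) = (\<integral>\<omega>. F \<omega> \<partial>distr (uniform_measure M C) N (\<lambda>\<omega>. \<omega>))"
      by simp
    then have "(\<integral>\<omega>. F \<omega> \<partial>uniform_measure M E) = (\<integral>\<omega>. F \<omega> \<partial>uniform_measure M C)"
      unfolding integral_distr[OF id FN] .
    then have "(\<integral>\<omega>. indicator E \<omega> *\<^sub>R F \<omega> \<partial>M) /\<^sub>R prob E = (\<integral>\<omega>. indicator C \<omega> *\<^sub>R F \<omega> \<partial>M) /\<^sub>R prob C"
      using integral_uniform_measure[OF FM E finite_measure_axioms pE] integral_uniform_measure[OF FM C finite_measure_axioms pC0] by simp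
    then have "prob E *\<^sub>R ((\<integral>\<omega>. indicator E \<omega> *\<^sub>R F \<omega> \<partial>M) /\<^sub>R prob E) = prob E *\<^sub>R ((\<integral>\<omega>. indicator C \<omega> *\<^sub>R F \<omega> \<partial>M) /\<^sub>R prob C)"
      by simp
    then show ?thesis using pE by simp
  qed
  have "(\<integral>\<omega>. indicator C \<omega> *\<^sub>R F \<omega> \<partial>M) /\<^sub>R prob C
     = (\<Prod>i<n. (\<integral>\<omega>. indicator {\<omega>\<in>space M. Z 0 \<omega> = zs ! i} \<omega> *\<^sub>R f (as ! i) (unit 0 \<omega>) \<partial>M) / pz (zs ! i))"
  proof -
    have "x /\<^sub>R r = x / complex_of_real r" for x :: complex and r
      by (simp add: scaleR_conv_of_real divide_inverse mult.commute)
    then show ?thesis unfolding FC pC by (simp only: of_real_prod prod_dividef)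
  qed
  with EF main show ?thesis by (simp add: E_def)
qed

theorem integral_given_assignment:
  fixes f :: "'k \<Rightarrow> _ \<Rightarrow> complex" and c :: "'k list \<Rightarrow> 'z list \<Rightarrow> complex"
  assumes f[measurable]: "\<And>t. f t \<in> borel_measurable unitM" and b: "\<And>t x. cmod (f t x) \<le> 1"
  defines "\<phi> t z \<equiv> (\<integral>\<omega>. indicator {\<omega>\<in>space M. Z 0 \<omega> = z} \<omega> *\<^sub>R f t (unit 0 \<omega>) \<partial>M) / pz z"
  shows "(\<integral>\<omega>. c (As n \<omega>) (Zs n \<omega>) * (\<Prod>i<n. f (A n i \<omega>) (unit i \<omega>)) \<partial>M)
       = (\<integral>\<omega>. c (As n \<omega>) (Zs n \<omega>) * (\<Prod>i<n. \<phi> (A n i \<omega>) (Z i \<omega>)) \<partial>M)"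
proof -
  define I where "I = {as::'k list. length as = n} \<times> {zs::'z list. length zs = n}"
  have fin: "finite I" unfolding I_def
    using finite_lists_length_eq[of "UNIV::'k set" n] finite_lists_length_eq[of "UNIV::'z set" n] by simp
  define E where "E p = {\<omega>\<in>space M. As n \<omega> = fst p \<and> Zs n \<omega> = snd p}" for p
  have E[measurable]: "E p \<in> sets M" for p unfolding E_def by measurable
  have decomp: "H \<omega> = (\<Sum>p\<in>I. indicator (E p) \<omega> *\<^sub>R G p \<omega>)"
    if "\<omega> \<in> space M" "\<And>p. \<omega> \<in> E p \<Longrightarrow> H \<omega> = G p \<omega>" for \<omega> and H :: "'a \<Rightarrow> complex" and G
  proof -
    have "(\<Sum>p\<in>I. indicator (E p) \<omega> *\<^sub>R G p \<omega>) = (\<Sum>p\<in>I. if p = (As n \<omega>, Zs n \<omega>) then G p \<omega> else 0)"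
      using that(1) by (intro sum.cong) (auto simp: E_def indicator_def)
    also have "\<dots> = G (As n \<omega>, Zs n \<omega>) \<omega>"
      using fin by (subst sum.delta) (auto simp: I_def As_def Zs_def)
    also have "\<dots> = H \<omega>" using that by (auto simp: E_def)
    finally show ?thesis by simp
  qed
  have int: "integrable M (\<lambda>\<omega>. indicator (E p) \<omega> *\<^sub>R (\<Prod>i<n. f (fst p ! i) (unit i \<omega>)))" for p
  proof (rule integrable_const_bound[where B=1])
    have "cmod (\<Prod>i<n. f (fst p ! i) (unit i \<omega>)) \<le> 1" for \<omega>
      unfolding prod_norm[symmetric] by (intro prod_le_1) (auto simp: b)
    then show "AE \<omega> in M. norm (indicator (E p) \<omega> *\<^sub>R (\<Prod>i<n. f (fst p ! i) (unit i \<omega>))) \<le> 1"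
      by (auto simp: indicator_def)
  qed measurable
  have int2: "integrable M (\<lambda>\<omega>. indicator (E p) \<omega> *\<^sub>R a)" for p and a :: complex
    by (intro integrable_scaleR_left) (auto simp: less_top[symmetric])
  have "(\<integral>\<omega>. c (As n \<omega>) (Zs n \<omega>) * (\<Prod>i<n. f (A n i \<omega>) (unit i \<omega>)) \<partial>M)
     = (\<integral>\<omega>. (\<Sum>p\<in>I. indicator (E p) \<omega> *\<^sub>R (c (fst p) (snd p) * (\<Prod>i<n. f (fst p ! i) (unit i \<omega>)))) \<partial>M)"
  proof (intro Bochner_Integration.integral_cong refl decomp)
    fix \<omega> p assume "\<omega> \<in> E p"
    then have "As n \<omega> = fst p" "Zs n \<omega> = snd p" by (auto simp: E_def)
    then have "(\<Prod>i<n. f (A n i \<omega>) (unit i \<omega>)) = (\<Prod>i<n. f (fst p ! i) (unit i \<omega>))"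
      by (intro prod.cong) (auto simp: As_eq_iff)
    with \<open>As n \<omega> = fst p\<close> \<open>Zs n \<omega> = snd p\<close>
    show "c (As n \<omega>) (Zs n \<omega>) * (\<Prod>i<n. f (A n i \<omega>) (unit i \<omega>)) = c (fst p) (snd p) * (\<Prod>i<n. f (fst p ! i) (unit i \<omega>))"
      by simp
  qed
  also have "\<dots> = (\<Sum>p\<in>I. c (fst p) (snd p) * (\<integral>\<omega>. indicator (E p) \<omega> *\<^sub>R (\<Prod>i<n. f (fst p ! i) (unit i \<omega>)) \<partial>M))"
    by (subst Bochner_Integration.integral_sum) (simp_all only: mult_scaleR_right[symmetric] integrable_mult_right int integral_mult_right_zero)
  also have "\<dots> = (\<Sum>p\<in>I. c (fst p) (snd p) * (prob (E p) *\<^sub>R (\<Prod>i<n. \<phi> (fst p ! i) (snd p ! i))))"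
    unfolding E_def \<phi>_def by (intro sum.cong refl arg_cong2[where f="(*)"] integral_cell f b) (auto simp: I_def)
  also have "\<dots> = (\<Sum>p\<in>I. \<integral>\<omega>. indicator (E p) \<omega> *\<^sub>R (c (fst p) (snd p) * (\<Prod>i<n. \<phi> (fst p ! i) (snd p ! i))) \<partial>M)"
    by (intro sum.cong refl) (simp add: less_top[symmetric])
  also have "\<dots> = (\<integral>\<omega>. (\<Sum>p\<in>I. indicator (E p) \<omega> *\<^sub>R (c (fst p) (snd p) * (\<Prod>i<n. \<phi> (fst p ! i) (snd p ! i)))) \<partial>M)"
    by (subst Bochner_Integration.integral_sum) (simp_all only: int2)
  also have "\<dots> = (\<integral>\<omega>. c (As n \<omega>) (Zs n \<omega>) * (\<Prod>i<n. \<phi> (A n i \<omega>) (Z i \<omega>)) \<partial>M)"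
  proof (intro Bochner_Integration.integral_cong refl decomp[symmetric])
    fix \<omega> p assume "\<omega> \<in> E p"
    then have "As n \<omega> = fst p" "Zs n \<omega> = snd p" by (auto simp: E_def)
    then have "(\<Prod>i<n. \<phi> (A n i \<omega>) (Z i \<omega>)) = (\<Prod>i<n. \<phi> (fst p ! i) (snd p ! i))"
      by (intro prod.cong) (auto simp: As_eq_iff Zs_eq_iff)
    with \<open>As n \<omega> = fst p\<close> \<open>Zs n \<omega> = snd p\<close>
    show "c (As n \<omega>) (Zs n \<omega>) * (\<Prod>i<n. \<phi> (A n i \<omega>) (Z i \<omega>)) = c (fst p) (snd p) * (\<Prod>i<n. \<phi> (fst p ! i) (snd p ! i))"
      by simp
  qed
  finally show ?thesis .
qed

subsection \<open>The joint limit of sums over arms, assignment imbalances and strata\<close>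

definition nz :: "nat \<Rightarrow> 'z \<Rightarrow> 'a \<Rightarrow> nat" where
  "nz n z \<omega> = card {i. i < n \<and> Z i \<omega> = z}"

definition nzt :: "nat \<Rightarrow> 'z \<Rightarrow> 'k \<Rightarrow> 'a \<Rightarrow> nat" where
  "nzt n z t \<omega> = card {i. i < n \<and> Z i \<omega> = z \<and> A n i \<omega> = t}"

definition U :: "nat \<Rightarrow> 'a \<Rightarrow> real^('z \<times> 'k)" where
  "U n \<omega> = (\<chi> zt. sqrt (real n) *
     (real (nzt n (fst zt) (snd zt) \<omega>) / real (nz n (fst zt) \<omega>) - pv $ snd zt))"

definition Dm :: "real^('z \<times> 'k)^('z \<times> 'k)" where
  "Dm = (\<chi> zt zt'. if fst zt = fst zt' then Om (fst zt) $ snd zt $ snd zt' / pz (fst zt) else 0)"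

lemma cond_conv_U: "cond_conv_normal M Zs U Dm"
proof -
  have eq: "Zs = (\<lambda>n \<omega>. map (\<lambda>i. Z i \<omega>) [0..<n])"
    "U = (\<lambda>n \<omega>. \<chi> zt. sqrt (real n) *
                   (real (card {i. i < n \<and> Z i \<omega> = fst zt \<and> A n i \<omega> = snd zt})
                      / real (card {i. i < n \<and> Z i \<omega> = fst zt}) - pv $ snd zt))"
    "Dm = (\<chi> zt zt'. if fst zt = fst zt'
                  then Om (fst zt) $ snd zt $ snd zt'
                        / measure M {\<omega>\<in>space M. Z 0 \<omega> = fst zt}
                  else 0)"
    by (auto simp: fun_eq_iff Zs_def U_def nz_def nzt_def Dm_def pz_def)
  show ?thesis unfolding eq by (rule C3)
qed

lemma psd_Dm: "psd Dm"
  using cond_conv_U by (simp add: cond_conv_normal_def)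

lemma nzt_lists: "nzt n z t \<omega> = card {i. i < n \<and> Zs n \<omega> ! i = z \<and> As n \<omega> ! i = t}"
  unfolding nzt_def by (intro arg_cong[where f=card]) (auto simp: Zs_def As_def)

lemma nz_lists: "nz n z \<omega> = card {i. i < n \<and> Zs n \<omega> ! i = z}"
  unfolding nz_def by (intro arg_cong[where f=card]) (auto simp: Zs_def)

lemma measurable_nzt [measurable]: "nzt n z t \<in> M \<rightarrow>\<^sub>M count_space UNIV"
  unfolding nzt_def[abs_def] by measurable

lemma measurable_nz [measurable]: "nz n z \<in> M \<rightarrow>\<^sub>M count_space UNIV"
  unfolding nz_def[abs_def] by measurable

lemma measurable_U [measurable]: "U n \<in> borel_measurable M"
  by (rule borel_measurable_vecI) (simp add: U_def)

lemma sum_counts: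
  fixes F :: "'k \<Rightarrow> 'z \<Rightarrow> real"
  shows "(\<Sum>i<n. F (A n i \<omega>) (Z i \<omega>)) = (\<Sum>z\<in>UNIV. \<Sum>t\<in>UNIV. real (nzt n z t \<omega>) * F t z)"
proof -
  have "(\<Sum>i<n. F (A n i \<omega>) (Z i \<omega>)) = (\<Sum>i<n. \<Sum>z\<in>UNIV. \<Sum>t\<in>UNIV. if Z i \<omega> = z \<and> A n i \<omega> = t then F t z else 0)"
  proof (intro sum.cong refl)
    fix i
    have "(\<Sum>z\<in>UNIV. \<Sum>t\<in>UNIV. if Z i \<omega> = z \<and> A n i \<omega> = t then F t z else 0)
        = (\<Sum>z\<in>UNIV. if z = Z i \<omega> then F (A n i \<omega>) z else 0)"
      by (intro sum.cong refl) (auto simp: sum.delta)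
    then show "F (A n i \<omega>) (Z i \<omega>) = (\<Sum>z\<in>UNIV. \<Sum>t\<in>UNIV. if Z i \<omega> = z \<and> A n i \<omega> = t then F t z else 0)"
      by (simp add: sum.delta)
  qed
  also have "\<dots> = (\<Sum>z\<in>UNIV. \<Sum>i<n. \<Sum>t\<in>UNIV. if Z i \<omega> = z \<and> A n i \<omega> = t then F t z else 0)"
    by (rule sum.swap)
  also have "\<dots> = (\<Sum>z\<in>UNIV. \<Sum>t\<in>UNIV. \<Sum>i<n. if Z i \<omega> = z \<and> A n i \<omega> = t then F t z else 0)"
    by (intro sum.cong refl sum.swap)
  also have "\<dots> = (\<Sum>z\<in>UNIV. \<Sum>t\<in>UNIV. real (nzt n z t \<omega>) * F t z)"
  proof (intro sum.cong refl)
    fix z t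
    have "(\<Sum>i<n. if Z i \<omega> = z \<and> A n i \<omega> = t then F t z else 0) = (\<Sum>i\<in>{i\<in>{..<n}. Z i \<omega> = z \<and> A n i \<omega> = t}. F t z)"
      by (subst sum.inter_filter) auto
    also have "\<dots> = real (nzt n z t \<omega>) * F t z" by (simp add: nzt_def lessThan_def)
    finally show "(\<Sum>i<n. if Z i \<omega> = z \<and> A n i \<omega> = t then F t z else 0) = real (nzt n z t \<omega>) * F t z" .
  qed
  finally show ?thesis .
qed

lemma clt_units:
  assumes g[measurable]: "g \<in> borel_measurable unitM" and sq: "integrable M (\<lambda>\<omega>. (g (unit 0 \<omega>))\<^sup>2)"
    and mean: "(\<integral>\<omega>. g (unit 0 \<omega>) \<partial>M) = 0"
  shows "(\<lambda>n. \<integral>\<omega>. iexp (\<Sum>i<n. g (unit i \<omega>) / sqrt (real n)) \<partial>M)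
     \<longlonglongrightarrow> complex_of_real (exp (- (\<integral>\<omega>. (g (unit 0 \<omega>))\<^sup>2 \<partial>M) / 2))"
proof -
  define v where "v = (\<integral>\<omega>. (g (unit 0 \<omega>))\<^sup>2 \<partial>M)"
  define \<psi> where "\<psi> n = (\<integral>\<omega>. iexp (g (unit 0 \<omega>) / sqrt (real n)) \<partial>M)" for n :: nat
  have v: "0 \<le> v" by (simp add: v_def)
  have eq: "(\<integral>\<omega>. iexp (\<Sum>i<n. g (unit i \<omega>) / sqrt (real n)) \<partial>M) = \<psi> n ^ n" for n
  proof -
    have "(\<integral>\<omega>. iexp (\<Sum>i<n. g (unit i \<omega>) / sqrt (real n)) \<partial>M) = (\<integral>\<omega>. (\<Prod>i<n. (\<lambda>x. iexp (g x / sqrt (real n))) (unit i \<omega>)) \<partial>M)"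
      by (simp only: iexp_sum[OF finite_lessThan])
    also have "\<dots> = (\<Prod>i<n. \<integral>\<omega>. iexp (g (unit 0 \<omega>) / sqrt (real n)) \<partial>M)"
      by (rule integral_prod_units) auto
    finally show ?thesis by (simp add: \<psi>_def)
  qed
  have "(\<lambda>n. real n * cmod (\<psi> n - complex_of_real (exp (- (v / 2) / real n)))) \<longlonglongrightarrow> 0"
    unfolding \<psi>_def
  proof (rule second_order_exp_diff[OF _ v])
    show "(\<lambda>n. of_nat n * ((\<integral>\<omega>. iexp (g (unit 0 \<omega>) / sqrt (real n)) \<partial>M) - 1)) \<longlonglongrightarrow> complex_of_real (- v / 2)"
      unfolding v_def by (rule char_second_order[OF _ sq mean]) measurable
  qed
  then have "(\<lambda>n. \<psi> n ^ n - complex_of_real (exp (- v / 2))) \<longlonglongrightarrow> 0"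
  proof (rule Lim_null_comparison[rotated])
    show "\<forall>\<^sub>F n in sequentially. norm (\<psi> n ^ n - complex_of_real (exp (- v / 2))) \<le> real n * cmod (\<psi> n - complex_of_real (exp (- (v / 2) / real n)))"
      using eventually_gt_at_top[of 0]
    proof eventually_elim
      case (elim n)
      have "complex_of_real (exp (- v / 2)) = complex_of_real (exp (- (v / 2) / real n)) ^ n"
        using elim by (simp add: exp_of_nat_mult[symmetric] of_real_power[symmetric] del: of_real_power)
      moreover have "cmod (\<psi> n) \<le> 1"
        unfolding \<psi>_def by (rule order.trans[OF integral_norm_bound]) (simp add: prob_space)
      moreover have "cmod (complex_of_real (exp (- (v / 2) / real n))) \<le> 1" using v by simp
      ultimately show ?case using norm_power_diff by metis
    qed
  qed
  then show ?thesis unfolding eq v_def by (rule LIM_zero_cancel)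
qed

lemma bounded_in_prob_units:
  assumes g[measurable]: "g \<in> borel_measurable unitM" and sq: "integrable M (\<lambda>\<omega>. (g (unit 0 \<omega>))\<^sup>2)"
    and mean: "(\<integral>\<omega>. g (unit 0 \<omega>) \<partial>M) = 0"
  shows "bounded_in_prob (\<lambda>n \<omega>. \<Sum>i<n. g (unit i \<omega>) / sqrt (real n))"
proof (rule bounded_in_prob_char[where v="\<integral>\<omega>. (g (unit 0 \<omega>))\<^sup>2 \<partial>M"])
  show "(\<lambda>n. \<integral>\<omega>. iexp (u * (\<Sum>i<n. g (unit i \<omega>) / sqrt (real n))) \<partial>M)
      \<longlonglongrightarrow> complex_of_real (exp (- (u\<^sup>2 * (\<integral>\<omega>. (g (unit 0 \<omega>))\<^sup>2 \<partial>M)) / 2))" for u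
    using clt_units[of "\<lambda>x. u * g x"] sq mean by (simp add: power_mult_distrib sum_distrib_left)
qed auto

lemma null_in_prob_nz: "null_in_prob (\<lambda>n \<omega>. real (nz n z \<omega>) / real n - pz z)"
proof (rule null_in_prob_eventually_eq)
  define g where "g x = (if fst (snd x) = z then 1 else 0) - pz z" for x :: "(real^'k) \<times> 'z \<times> (real^'p)"
  have g[measurable]: "g \<in> borel_measurable unitM" unfolding g_def by measurable
  have pz01: "0 \<le> pz z" "pz z \<le> 1" by (auto simp: pz_def)
  have gb: "\<bar>g x\<bar> \<le> 1" for x using pz01 by (auto simp: g_def)
  have "integrable M (\<lambda>\<omega>. (g (unit 0 \<omega>))\<^sup>2)"
    using gb by (intro integrable_const_bound[where B=1]) (auto simp: abs_square_le_1)
  moreover have "(\<integral>\<omega>. g (unit 0 \<omega>) \<partial>M) = 0"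
  proof -
    have "(\<integral>\<omega>. g (unit 0 \<omega>) \<partial>M) = (\<integral>\<omega>. indicator {\<omega>\<in>space M. Z 0 \<omega> = z} \<omega> - pz z \<partial>M)"
      by (intro Bochner_Integration.integral_cong) (auto simp: g_def unit_def)
    also have "\<dots> = 0" by (subst Bochner_Integration.integral_diff) (auto simp: pz_def prob_space less_top[symmetric])
    finally show ?thesis .
  qed
  ultimately have "bounded_in_prob (\<lambda>n \<omega>. \<Sum>i<n. g (unit i \<omega>) / sqrt (real n))"
    by (rule bounded_in_prob_units[OF g])
  from null_in_prob_mult_bounded[OF null_in_prob_const[OF inverse_sqrt_tendsto_zero] this]
  show "null_in_prob (\<lambda>n \<omega>. 1 / sqrt (real n) * (\<Sum>i<n. g (unit i \<omega>) / sqrt (real n)))" .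
  fix n :: nat and \<omega> assume n: "0 < n"
  have "(\<Sum>i<n. g (unit i \<omega>)) = real (nz n z \<omega>) - real n * pz z"
  proof -
    have "(\<Sum>i<n. if Z i \<omega> = z then 1 else 0::real) = (\<Sum>i\<in>{i\<in>{..<n}. Z i \<omega> = z}. 1)"
      by (subst sum.inter_filter) auto
    then have "(\<Sum>i<n. if Z i \<omega> = z then 1 else 0::real) = real (nz n z \<omega>)" by (simp add: nz_def lessThan_def)
    then show ?thesis by (simp add: g_def unit_def sum_subtractf)
  qed
  moreover have "1 / sqrt (real n) * (\<Sum>i<n. g (unit i \<omega>) / sqrt (real n)) = (\<Sum>i<n. g (unit i \<omega>)) / real n"
    using n by (simp add: sum_divide_distrib[symmetric])
  ultimately show "real (nz n z \<omega>) / real n - pz z = 1 / sqrt (real n) * (\<Sum>i<n. g (unit i \<omega>) / sqrt (real n))"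
    using n by (simp add: diff_divide_distrib)
qed measurable

lemma nz_zero_imp_nzt_zero: "nz n z \<omega> = 0 \<Longrightarrow> nzt n z t \<omega> = 0"
proof -
  assume "nz n z \<omega> = 0"
  then have "{i. i < n \<and> Z i \<omega> = z} = {}" by (simp add: nz_def)
  then have "{i. i < n \<and> Z i \<omega> = z \<and> A n i \<omega> = t} = {}" by auto
  then show ?thesis by (simp add: nzt_def)
qed

lemma bounded_in_prob_nz: "bounded_in_prob (\<lambda>n \<omega>. real (nz n z \<omega>) / real n)"
proof -
  have "bounded_in_prob (\<lambda>n \<omega>. (real (nz n z \<omega>) / real n - pz z) + pz z)"
    by (intro bounded_in_prob_add null_imp_bounded_in_prob null_in_prob_nz bounded_in_prob_const)
  then show ?thesis by simp
qed

lemma null_in_prob_nzt: "null_in_prob (\<lambda>n \<omega>. real (nzt n z t \<omega>) / real n - pv $ t * pz z)"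
proof -
  have r: "null_in_prob (\<lambda>n \<omega>. real (nzt n z t \<omega>) / real (nz n z \<omega>) - pv $ t)"
  proof (rule null_in_prob_of_AE_tendsto)
    show "AE \<omega> in M. (\<lambda>n. real (nzt n z t \<omega>) / real (nz n z \<omega>) - pv $ t) \<longlonglongrightarrow> 0"
      using C2ii by eventually_elim (auto simp: nzt_def nz_def intro: LIM_zero)
  qed measurable
  have "null_in_prob (\<lambda>n \<omega>. (real (nzt n z t \<omega>) / real (nz n z \<omega>) - pv $ t) * (real (nz n z \<omega>) / real n)
      + pv $ t * (real (nz n z \<omega>) / real n - pz z))"
    by (intro null_in_prob_add null_in_prob_cmult null_in_prob_nz null_in_prob_mult_bounded r bounded_in_prob_nz)
  moreover have "(real (nzt n z t \<omega>) / real (nz n z \<omega>) - pv $ t) * (real (nz n z \<omega>) / real n)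
      + pv $ t * (real (nz n z \<omega>) / real n - pz z) = real (nzt n z t \<omega>) / real n - pv $ t * pz z" for n \<omega>
    using nz_zero_imp_nzt_zero[of n z \<omega> t] by (cases "nz n z \<omega> = 0") (auto simp: algebra_simps)
  ultimately show ?thesis by simp
qed

lemma integral_cond_expect_at:
  fixes c :: "'z list \<Rightarrow> complex" and g :: "'a \<Rightarrow> real"
  assumes g[measurable]: "g \<in> borel_measurable M" and b: "\<And>\<omega>. \<bar>g \<omega>\<bar> \<le> B"
  shows "(\<integral>\<omega>. c (Zs n \<omega>) * complex_of_real (g \<omega>) \<partial>M)
       = (\<integral>\<omega>. c (Zs n \<omega>) * complex_of_real (cond_expect_at M (Zs n) g \<omega>) \<partial>M)"
proof -
  define I where "I = {zs::'z list. length zs = n}"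
  have fin: "finite I" unfolding I_def using finite_lists_length_eq[of "UNIV::'z set" n] by simp
  define C where "C zs = {\<omega>\<in>space M. Zs n \<omega> = zs}" for zs
  have C[measurable]: "C zs \<in> sets M" for zs unfolding C_def by measurable
  have pC: "0 < prob (C zs)" if "zs \<in> I" for zs
    using that unfolding C_def I_def by (subst prob_Zs) (auto intro!: prod_pos pz_pos)
  define m where "m zs = (\<integral>\<omega>. g \<omega> * indicator (C zs) \<omega> \<partial>M) / prob (C zs)" for zs
  have decomp: "H \<omega> = (\<Sum>zs\<in>I. indicator (C zs) \<omega> *\<^sub>R G zs \<omega>)"
    if "\<omega> \<in> space M" "\<And>zs. \<omega> \<in> C zs \<Longrightarrow> H \<omega> = G zs \<omega>" for \<omega> and H :: "'a \<Rightarrow> complex" and G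
  proof -
    have "(\<Sum>zs\<in>I. indicator (C zs) \<omega> *\<^sub>R G zs \<omega>) = (\<Sum>zs\<in>I. if zs = Zs n \<omega> then G zs \<omega> else 0)"
      using that(1) by (intro sum.cong) (auto simp: C_def indicator_def)
    also have "\<dots> = G (Zs n \<omega>) \<omega>"
      using fin by (subst sum.delta) (auto simp: I_def Zs_def)
    also have "\<dots> = H \<omega>" using that by (auto simp: C_def)
    finally show ?thesis by simp
  qed
  have int: "integrable M (\<lambda>\<omega>. g \<omega> * indicator (C zs) \<omega>)" for zs
  proof (rule integrable_const_bound[where B=B])
    have "0 \<le> B" using b[of undefined] by linarith
    then show "AE \<omega> in M. norm (g \<omega> * indicator (C zs) \<omega>) \<le> B" using b by (auto simp: indicator_def)
  qed measurable
  have "(\<integral>\<omega>. c (Zs n \<omega>) * complex_of_real (g \<omega>) \<partial>M) = (\<integral>\<omega>. (\<Sum>zs\<in>I. c zs * complex_of_real (g \<omega> * indicator (C zs) \<omega>)) \<partial>M)"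
  proof (intro Bochner_Integration.integral_cong refl)
    fix \<omega> assume "\<omega> \<in> space M"
    then have "c (Zs n \<omega>) * complex_of_real (g \<omega>) = (\<Sum>zs\<in>I. indicator (C zs) \<omega> *\<^sub>R (c zs * complex_of_real (g \<omega>)))"
      by (rule decomp) (auto simp: C_def)
    then show "c (Zs n \<omega>) * complex_of_real (g \<omega>) = (\<Sum>zs\<in>I. c zs * complex_of_real (g \<omega> * indicator (C zs) \<omega>))"
      by (simp add: scaleR_conv_of_real mult_ac)
  qed
  also have "\<dots> = (\<Sum>zs\<in>I. c zs * complex_of_real (\<integral>\<omega>. g \<omega> * indicator (C zs) \<omega> \<partial>M))"
    by (subst Bochner_Integration.integral_sum)
       (simp_all only: integrable_mult_right integrable_of_real int integral_mult_right_zero integral_complex_of_real)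
  also have "\<dots> = (\<Sum>zs\<in>I. c zs * complex_of_real (m zs * prob (C zs)))"
    using pC by (intro sum.cong refl) (auto simp: m_def less_le)
  also have "\<dots> = (\<integral>\<omega>. (\<Sum>zs\<in>I. indicator (C zs) \<omega> *\<^sub>R (c zs * complex_of_real (m zs))) \<partial>M)"
    by (subst Bochner_Integration.integral_sum)
       (auto simp: scaleR_conv_of_real mult_ac less_top[symmetric] intro!: integrable_mult_right integrable_of_real sum.cong)
  also have "\<dots> = (\<integral>\<omega>. c (Zs n \<omega>) * complex_of_real (cond_expect_at M (Zs n) g \<omega>) \<partial>M)"
  proof (intro Bochner_Integration.integral_cong refl decomp[symmetric])
    fix \<omega> zs assume "\<omega> \<in> C zs"
    then have "{\<omega>'\<in>space M. Zs n \<omega>' = Zs n \<omega>} = C zs" "Zs n \<omega> = zs" by (auto simp: C_def)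
    then show "c (Zs n \<omega>) * complex_of_real (cond_expect_at M (Zs n) g \<omega>) = c zs * complex_of_real (m zs)"
      by (simp add: cond_expect_at_def m_def)
  qed
  finally show ?thesis .
qed

lemma cond_expect_at_bound:
  assumes [measurable]: "g \<in> borel_measurable M" and b: "\<And>\<omega>. \<bar>g \<omega>\<bar> \<le> B"
  shows "\<bar>cond_expect_at M (Zs n) g \<omega>\<bar> \<le> B"
proof -
  define C where "C = {\<omega>'\<in>space M. Zs n \<omega>' = Zs n \<omega>}"
  have C[measurable]: "C \<in> sets M" unfolding C_def by measurable
  have pC: "0 < prob C" unfolding C_def by (subst prob_Zs) (auto intro!: prod_pos pz_pos simp: Zs_def)
  have "\<bar>\<integral>\<omega>'. g \<omega>' * indicator C \<omega>' \<partial>M\<bar> \<le> (\<integral>\<omega>'. \<bar>g \<omega>' * indicator C \<omega>'\<bar> \<partial>M)" by (rule integral_abs_bound)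
  also have "\<dots> \<le> (\<integral>\<omega>'. B * indicator C \<omega>' \<partial>M)"
  proof (rule integral_mono')
    show "integrable M (\<lambda>\<omega>'. B * indicator C \<omega>')" by (auto simp: less_top[symmetric])
  qed (use b order.trans[OF abs_ge_zero b] in \<open>auto simp: indicator_def\<close>)
  also have "\<dots> = B * prob C" by simp
  finally show ?thesis
    using pC by (simp add: cond_expect_at_def C_def[symmetric] divide_le_eq)
qed

lemma measurable_cond_expect_at [measurable]: "cond_expect_at M (Zs n) g \<in> borel_measurable M"
proof -
  have "cond_expect_at M (Zs n) g = (\<lambda>\<omega>. (\<lambda>zs. (\<integral>\<omega>'. g \<omega>' * indicator {\<omega>'\<in>space M. Zs n \<omega>' = zs} \<omega>' \<partial>M)
       / prob {\<omega>'\<in>space M. Zs n \<omega>' = zs}) (Zs n \<omega>))"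
    by (auto simp: cond_expect_at_def)
  then show ?thesis by (simp only:) (rule measurable_compose[OF measurable_Zs], simp)
qed

lemma conv_distr_U: "conv_distr M U (mvnormal Dm)"
  unfolding conv_distr_def
proof (intro allI impI)
  fix f :: "real^('z \<times> 'k) \<Rightarrow> real" assume f: "continuous_on UNIV f \<and> bounded (range f)"
  then obtain B where B: "\<And>x. \<bar>f x\<bar> \<le> B" by (auto simp: bounded_iff)
  have [measurable]: "f \<in> borel_measurable borel" using f by (auto intro: borel_measurable_continuous_onI)
  have "(\<lambda>n. \<integral>\<omega>. cond_expect_at M (Zs n) (\<lambda>\<omega>'. f (U n \<omega>')) \<omega> \<partial>M) \<longlonglongrightarrow> (\<integral>\<omega>. (\<integral>x. f x \<partial>mvnormal Dm) \<partial>M)"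
  proof (rule integral_dominated_convergence[where w="\<lambda>_. B"])
    show "AE \<omega> in M. (\<lambda>n. cond_expect_at M (Zs n) (\<lambda>\<omega>'. f (U n \<omega>')) \<omega>) \<longlonglongrightarrow> (\<integral>x. f x \<partial>mvnormal Dm)"
      using cond_conv_U f unfolding cond_conv_normal_def by (auto elim!: eventually_mono)
    show "AE \<omega> in M. norm (cond_expect_at M (Zs n) (\<lambda>\<omega>'. f (U n \<omega>')) \<omega>) \<le> B" for n
      using cond_expect_at_bound[of "\<lambda>\<omega>'. f (U n \<omega>')" B n] B by auto
  qed auto
  moreover have "(\<integral>\<omega>. cond_expect_at M (Zs n) (\<lambda>\<omega>'. f (U n \<omega>')) \<omega> \<partial>M) = (\<integral>\<omega>. f (U n \<omega>) \<partial>M)" for n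
    using integral_cond_expect_at[of "\<lambda>\<omega>'. f (U n \<omega>')" B "\<lambda>_. 1" n] B by (simp add: integral_complex_of_real)
  ultimately show "(\<lambda>n. \<integral>\<omega>. f (U n \<omega>) \<partial>M) \<longlonglongrightarrow> (\<integral>x. f x \<partial>mvnormal Dm)" by (simp add: prob_space)
qed

lemma bounded_in_prob_U: "bounded_in_prob (\<lambda>n \<omega>. U n \<omega> $ zt)"
proof (rule bounded_in_prob_dominated)
  show "bounded_in_prob (\<lambda>n \<omega>. norm (U n \<omega>))"
    by (rule conv_distr_norm_bounded_in_prob[OF _ prob_space_mvnormal _ conv_distr_U]) auto
  show "\<bar>U n \<omega> $ zt\<bar> \<le> \<bar>norm (U n \<omega>)\<bar>" for n \<omega>
    using component_le_norm_cart[of "U n \<omega>" zt] by simp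
qed measurable

lemma char_U_given_Z:
  fixes c :: "nat \<Rightarrow> 'z list \<Rightarrow> complex"
  assumes c: "\<And>n zs. cmod (c n zs) \<le> 1"
  shows "(\<lambda>n. (\<integral>\<omega>. c n (Zs n \<omega>) * iexp (h \<bullet> U n \<omega>) \<partial>M)
     - complex_of_real (exp (- (h \<bullet> (Dm *v h)) / 2)) * (\<integral>\<omega>. c n (Zs n \<omega>) \<partial>M)) \<longlonglongrightarrow> 0"
proof -
  define \<kappa> where "\<kappa> = complex_of_real (exp (- (h \<bullet> (Dm *v h)) / 2))"
  define Cs where "Cs n \<omega> = cond_expect_at M (Zs n) (\<lambda>\<omega>'. cos (h \<bullet> U n \<omega>')) \<omega>" for n \<omega>
  define Sn where "Sn n \<omega> = cond_expect_at M (Zs n) (\<lambda>\<omega>'. sin (h \<bullet> U n \<omega>')) \<omega>" for n \<omega>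
  have [measurable]: "Cs n \<in> borel_measurable M" "Sn n \<in> borel_measurable M" for n
    unfolding Cs_def[abs_def] Sn_def[abs_def] by measurable
  have cm[measurable]: "(\<lambda>\<omega>. c n (Zs n \<omega>)) \<in> borel_measurable M" for n
    by (rule measurable_compose[OF measurable_Zs]) simp
  have Cs1: "\<bar>Cs n \<omega>\<bar> \<le> 1" and Sn1: "\<bar>Sn n \<omega>\<bar> \<le> 1" for n \<omega>
    unfolding Cs_def Sn_def by (auto intro!: cond_expect_at_bound)
  have bd: "integrable M f" if [measurable]: "f \<in> borel_measurable M" and "\<And>\<omega>. cmod (f \<omega>) \<le> B" for f :: "'a \<Rightarrow> complex" and B
    using that by (intro integrable_const_bound[where B=B]) auto
  have eq: "(\<integral>\<omega>. c n (Zs n \<omega>) * iexp (h \<bullet> U n \<omega>) \<partial>M) = (\<integral>\<omega>. c n (Zs n \<omega>) * Complex (Cs n \<omega>) (Sn n \<omega>) \<partial>M)" for n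
  proof -
    have i1: "integrable M (\<lambda>\<omega>. c n (Zs n \<omega>) * complex_of_real (cos (h \<bullet> U n \<omega>)))"
      "integrable M (\<lambda>\<omega>. c n (Zs n \<omega>) * complex_of_real (sin (h \<bullet> U n \<omega>)))"
      "integrable M (\<lambda>\<omega>. c n (Zs n \<omega>) * complex_of_real (Cs n \<omega>))"
      "integrable M (\<lambda>\<omega>. c n (Zs n \<omega>) * complex_of_real (Sn n \<omega>))"
      using c[of n] Cs1[of n] Sn1[of n] by (auto intro!: bd[of _ 1] mult_le_one simp: norm_mult)
    have "(\<integral>\<omega>. c n (Zs n \<omega>) * iexp (h \<bullet> U n \<omega>) \<partial>M)
       = (\<integral>\<omega>. c n (Zs n \<omega>) * complex_of_real (cos (h \<bullet> U n \<omega>)) + \<i> * (c n (Zs n \<omega>) * complex_of_real (sin (h \<bullet> U n \<omega>))) \<partial>M)"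
      by (intro Bochner_Integration.integral_cong refl)
         (simp only: cis_conv_exp[symmetric], simp add: complex_eq_iff)
    also have "\<dots> = (\<integral>\<omega>. c n (Zs n \<omega>) * complex_of_real (Cs n \<omega>) \<partial>M) + \<i> * (\<integral>\<omega>. c n (Zs n \<omega>) * complex_of_real (Sn n \<omega>) \<partial>M)"
    proof -
      have "(\<integral>\<omega>. c n (Zs n \<omega>) * complex_of_real (cos (h \<bullet> U n \<omega>)) \<partial>M) = (\<integral>\<omega>. c n (Zs n \<omega>) * complex_of_real (Cs n \<omega>) \<partial>M)"
        "(\<integral>\<omega>. c n (Zs n \<omega>) * complex_of_real (sin (h \<bullet> U n \<omega>)) \<partial>M) = (\<integral>\<omega>. c n (Zs n \<omega>) * complex_of_real (Sn n \<omega>) \<partial>M)"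
        unfolding Cs_def Sn_def by (rule integral_cond_expect_at[where B=1]; simp)+
      then show ?thesis using i1(1,2) by (subst Bochner_Integration.integral_add) simp_all
    qed
    also have "\<dots> = (\<integral>\<omega>. c n (Zs n \<omega>) * complex_of_real (Cs n \<omega>) + \<i> * (c n (Zs n \<omega>) * complex_of_real (Sn n \<omega>)) \<partial>M)"
      using i1(3,4) by (subst Bochner_Integration.integral_add) simp_all
    also have "\<dots> = (\<integral>\<omega>. c n (Zs n \<omega>) * Complex (Cs n \<omega>) (Sn n \<omega>) \<partial>M)"
      by (intro Bochner_Integration.integral_cong refl) (simp add: complex_eq_iff)
    finally show ?thesis .
  qed
  have Cm[measurable]: "(\<lambda>\<omega>. Complex (Cs n \<omega>) (Sn n \<omega>)) \<in> borel_measurable M" for n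
    by (simp add: Complex_eq)
  have "(\<lambda>n. \<integral>\<omega>. c n (Zs n \<omega>) * (Complex (Cs n \<omega>) (Sn n \<omega>) - \<kappa>) \<partial>M) \<longlonglongrightarrow> (\<integral>\<omega>. 0 \<partial>M)"
  proof (rule integral_dominated_convergence[where w="\<lambda>_. 3"])
    have N: "(\<integral>x. iexp (h \<bullet> x) \<partial>mvnormal Dm) = \<kappa>" unfolding \<kappa>_def by (rule char_mvnormal[OF psd_Dm])
    interpret G: prob_space "mvnormal Dm" by (rule prob_space_mvnormal)
    have iI: "integrable (mvnormal Dm) (\<lambda>x. iexp (h \<bullet> x))" by (rule G.integrable_const_bound[where B=1]) auto
    have "(\<integral>x. cos (h \<bullet> x) \<partial>mvnormal Dm) = Re \<kappa>" "(\<integral>x. sin (h \<bullet> x) \<partial>mvnormal Dm) = Im \<kappa>"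
      unfolding N[symmetric] integral_Re[OF iI, symmetric] integral_Im[OF iI, symmetric]
      by (simp_all only: cis_conv_exp[symmetric] cis.sel)
    moreover have "continuous_on UNIV (\<lambda>x. cos (h \<bullet> x)) \<and> bounded (range (\<lambda>x. cos (h \<bullet> x)))"
      "continuous_on UNIV (\<lambda>x. sin (h \<bullet> x)) \<and> bounded (range (\<lambda>x. sin (h \<bullet> x)))"
      by (auto intro!: continuous_intros boundedI[of _ 1])
    ultimately have "AE \<omega> in M. (\<lambda>n. Cs n \<omega>) \<longlonglongrightarrow> Re \<kappa> \<and> (\<lambda>n. Sn n \<omega>) \<longlonglongrightarrow> Im \<kappa>"
      using cond_conv_U unfolding cond_conv_normal_def Cs_def Sn_def
      by (auto elim!: eventually_mono)
    then show "AE \<omega> in M. (\<lambda>n. c n (Zs n \<omega>) * (Complex (Cs n \<omega>) (Sn n \<omega>) - \<kappa>)) \<longlonglongrightarrow> 0"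
    proof eventually_elim
      case (elim \<omega>)
      then have "(\<lambda>n. Complex (Cs n \<omega>) (Sn n \<omega>)) \<longlonglongrightarrow> Complex (Re \<kappa>) (Im \<kappa>)" by (intro tendsto_Complex) auto
      then have "(\<lambda>n. Complex (Cs n \<omega>) (Sn n \<omega>) - \<kappa>) \<longlonglongrightarrow> 0" by (simp add: LIM_zero)
      from tendsto_norm_zero[OF this]
      show ?case
        by (rule Lim_null_comparison[rotated]) (auto simp: norm_mult intro!: always_eventually mult_left_le_one_le c)
    qed
    fix n
    have "cmod (c n (Zs n \<omega>) * (Complex (Cs n \<omega>) (Sn n \<omega>) - \<kappa>)) \<le> 3" for \<omega>
    proof -
      have "cmod (Complex (Cs n \<omega>) (Sn n \<omega>)) \<le> 2"
        using cmod_le[of "Complex (Cs n \<omega>) (Sn n \<omega>)"] Cs1[of n \<omega>] Sn1[of n \<omega>] by simp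
      moreover have "cmod \<kappa> \<le> 1" using psd_Dm by (simp add: \<kappa>_def psd_def)
      ultimately have "cmod (Complex (Cs n \<omega>) (Sn n \<omega>) - \<kappa>) \<le> 3"
        using norm_triangle_ineq4[of "Complex (Cs n \<omega>) (Sn n \<omega>)" \<kappa>] by linarith
      then have "cmod (c n (Zs n \<omega>)) * cmod (Complex (Cs n \<omega>) (Sn n \<omega>) - \<kappa>) \<le> 1 * 3"
        by (intro mult_mono c) auto
      then show ?thesis by (simp add: norm_mult)
    qed
    then show "AE \<omega> in M. norm (c n (Zs n \<omega>) * (Complex (Cs n \<omega>) (Sn n \<omega>) - \<kappa>)) \<le> 3" by simp
  qed auto
  moreover have "(\<integral>\<omega>. c n (Zs n \<omega>) * (Complex (Cs n \<omega>) (Sn n \<omega>) - \<kappa>) \<partial>M)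
      = (\<integral>\<omega>. c n (Zs n \<omega>) * iexp (h \<bullet> U n \<omega>) \<partial>M) - \<kappa> * (\<integral>\<omega>. c n (Zs n \<omega>) \<partial>M)" for n
  proof -
    have "integrable M (\<lambda>\<omega>. c n (Zs n \<omega>))" using c by (intro bd[of _ 1]) auto
    moreover have "cmod (c n (Zs n \<omega>) * Complex (Cs n \<omega>) (Sn n \<omega>)) \<le> 1 * 2" for \<omega>
      unfolding norm_mult using cmod_le[of "Complex (Cs n \<omega>) (Sn n \<omega>)"] Cs1[of n \<omega>] Sn1[of n \<omega>] c
      by (intro mult_mono) auto
    then have "integrable M (\<lambda>\<omega>. c n (Zs n \<omega>) * Complex (Cs n \<omega>) (Sn n \<omega>))"
      by (intro bd[of _ "1 * 2"]) auto
    ultimately show ?thesis unfolding eq by (simp add: right_diff_distrib mult.commute)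
  qed
  ultimately show ?thesis by (simp add: \<kappa>_def)
qed

definition sqint :: "((real^'k) \<times> 'z \<times> (real^'p) \<Rightarrow> real) \<Rightarrow> bool" where
  "sqint \<xi> \<longleftrightarrow> \<xi> \<in> borel_measurable unitM \<and> integrable M (\<lambda>\<omega>. (\<xi> (unit 0 \<omega>))\<^sup>2)"

lemma sqint_measurable: "sqint \<xi> \<Longrightarrow> \<xi> \<in> borel_measurable unitM"
  by (simp add: sqint_def)

lemma sqint_square: "sqint \<xi> \<Longrightarrow> integrable M (\<lambda>\<omega>. (\<xi> (unit 0 \<omega>))\<^sup>2)"
  by (simp add: sqint_def)

lemma sqint_prod:
  assumes "sqint f" "sqint g"
  shows "integrable M (\<lambda>\<omega>. f (unit 0 \<omega>) * g (unit 0 \<omega>))"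
proof (rule Bochner_Integration.integrable_bound)
  note [measurable] = assms[THEN sqint_measurable]
  show "integrable M (\<lambda>\<omega>. (f (unit 0 \<omega>))\<^sup>2 + (g (unit 0 \<omega>))\<^sup>2)"
    by (intro Bochner_Integration.integrable_add sqint_square assms)
  show "(\<lambda>\<omega>. f (unit 0 \<omega>) * g (unit 0 \<omega>)) \<in> borel_measurable M" by measurable
  have "\<bar>a * b\<bar> \<le> a\<^sup>2 + b\<^sup>2" for a b :: real
  proof -
    have "2 * (\<bar>a\<bar> * \<bar>b\<bar>) \<le> a\<^sup>2 + b\<^sup>2" using sum_squares_bound[of "\<bar>a\<bar>" "\<bar>b\<bar>"] by (simp add: mult.assoc)
    moreover have "0 \<le> \<bar>a\<bar> * \<bar>b\<bar>" by simp
    ultimately show ?thesis unfolding abs_mult by linarith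
  qed
  then show "AE \<omega> in M. norm (f (unit 0 \<omega>) * g (unit 0 \<omega>)) \<le> norm ((f (unit 0 \<omega>))\<^sup>2 + (g (unit 0 \<omega>))\<^sup>2)"
    by (auto intro: order.trans[OF _ abs_ge_self])
qed

lemma sqint_integrable: "sqint f \<Longrightarrow> integrable M (\<lambda>\<omega>. f (unit 0 \<omega>))"
  by (rule square_integrable_imp_integrable) (auto simp: sqint_def intro: measurable_compose[OF measurable_unit])

lemma sqint_add: "sqint f \<Longrightarrow> sqint g \<Longrightarrow> sqint (\<lambda>x. f x + g x)"
  using sqint_prod[of f g] unfolding sqint_def by (auto simp: power2_sum mult.assoc)

lemma sqint_cmult: "sqint f \<Longrightarrow> sqint (\<lambda>x. c * f x)"
  unfolding sqint_def by (auto simp: power_mult_distrib)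

lemma sqint_diff: "sqint f \<Longrightarrow> sqint g \<Longrightarrow> sqint (\<lambda>x. f x - g x)"
  using sqint_add[of f "\<lambda>x. -1 * g x"] sqint_cmult[of g "-1"] by simp

lemma sqint_strata: "sqint (\<lambda>x. g (fst (snd x)))"
  unfolding sqint_def
proof
  show "(\<lambda>x. g (fst (snd x))) \<in> borel_measurable unitM"
    by (rule measurable_compose[of "\<lambda>x. fst (snd x)" _ "count_space UNIV"]) auto
  have "(g z)\<^sup>2 \<le> (\<Sum>z\<in>UNIV. (g z)\<^sup>2)" for z by (rule member_le_sum) auto
  then show "integrable M (\<lambda>\<omega>. (g (fst (snd (unit 0 \<omega>))))\<^sup>2)"
    by (intro integrable_const_bound[where B="\<Sum>z\<in>UNIV. (g z)\<^sup>2"])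
       (auto simp: unit_def intro!: measurable_compose[OF measurable_Z])
qed

lemma sqint_const: "sqint (\<lambda>x. c)"
  using sqint_strata[of "\<lambda>_. c"] by simp

lemma sqint_sum: "finite I \<Longrightarrow> (\<And>i. i \<in> I \<Longrightarrow> sqint (f i)) \<Longrightarrow> sqint (\<lambda>x. \<Sum>i\<in>I. f i x)"
  by (induction I rule: finite_induct) (auto intro: sqint_const sqint_add)

lemma sqint_Y: "sqint (\<lambda>x. fst x $ t)"
  unfolding sqint_def using mom_Y by (simp add: unit_def)

lemma sqint_X: "sqint (\<lambda>x. snd (snd x) $ j)"
  unfolding sqint_def using mom_X by (simp add: unit_def)

abbreviation "EE f \<equiv> (\<integral>\<omega>. f (unit 0 \<omega>) \<partial>M)"

definition cmean :: "((real^'k) \<times> 'z \<times> (real^'p) \<Rightarrow> real) \<Rightarrow> 'z \<Rightarrow> real" where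
  "cmean \<xi> z = (\<integral>\<omega>. \<xi> (unit 0 \<omega>) * indicator {\<omega>\<in>space M. Z 0 \<omega> = z} \<omega> \<partial>M) / pz z"

definition resid :: "((real^'k) \<times> 'z \<times> (real^'p) \<Rightarrow> real) \<Rightarrow> (real^'k) \<times> 'z \<times> (real^'p) \<Rightarrow> real" where
  "resid \<xi> x = \<xi> x - cmean \<xi> (fst (snd x))"

lemma sqint_resid: "sqint \<xi> \<Longrightarrow> sqint (resid \<xi>)"
  unfolding resid_def[abs_def] by (intro sqint_diff sqint_strata)

lemma EE_strata: "EE (\<lambda>x. g (fst (snd x))) = (\<Sum>z\<in>UNIV. pz z * g z)"
proof -
  have "EE (\<lambda>x. g (fst (snd x))) = (\<integral>\<omega>. (\<Sum>z\<in>UNIV. g z * indicator {\<omega>\<in>space M. Z 0 \<omega> = z} \<omega>) \<partial>M)"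
  proof (intro Bochner_Integration.integral_cong refl)
    fix \<omega> assume "\<omega> \<in> space M"
    then have "(\<Sum>z\<in>UNIV. g z * indicator {\<omega>\<in>space M. Z 0 \<omega> = z} \<omega>) = (\<Sum>z\<in>UNIV. if z = Z 0 \<omega> then g z else 0)"
      by (intro sum.cong) (auto simp: indicator_def)
    then show "g (fst (snd (unit 0 \<omega>))) = (\<Sum>z\<in>UNIV. g z * indicator {\<omega>\<in>space M. Z 0 \<omega> = z} \<omega>)"
      by (simp add: unit_def sum.delta)
  qed
  also have "\<dots> = (\<Sum>z\<in>UNIV. g z * pz z)"
    by (subst Bochner_Integration.integral_sum) (auto simp: pz_def less_top[symmetric])
  finally show ?thesis by (simp add: mult.commute)
qed

lemma integrable_mult_stratum:
  fixes f :: "'a \<Rightarrow> real"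
  shows "integrable M f \<Longrightarrow> integrable M (\<lambda>\<omega>. f \<omega> * indicator {\<omega>\<in>space M. Z 0 \<omega> = z} \<omega>)"
  by (rule integrable_real_mult_indicator) measurable

lemma sum_pz: "(\<Sum>z\<in>UNIV. pz z) = 1"
  using EE_strata[of "\<lambda>_. 1"] by (simp add: prob_space)

lemma EE_split:
  fixes f :: "(real^'k) \<times> 'z \<times> (real^'p) \<Rightarrow> real"
  assumes "integrable M (\<lambda>\<omega>. f (unit 0 \<omega>))"
  shows "EE f = (\<Sum>z\<in>UNIV. \<integral>\<omega>. f (unit 0 \<omega>) * indicator {\<omega>\<in>space M. Z 0 \<omega> = z} \<omega> \<partial>M)"
proof -
  have "(\<Sum>z\<in>UNIV. \<integral>\<omega>. f (unit 0 \<omega>) * indicator {\<omega>\<in>space M. Z 0 \<omega> = z} \<omega> \<partial>M)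
     = (\<integral>\<omega>. (\<Sum>z\<in>UNIV. f (unit 0 \<omega>) * indicator {\<omega>\<in>space M. Z 0 \<omega> = z} \<omega>) \<partial>M)"
    using assms by (subst Bochner_Integration.integral_sum) (auto intro!: integrable_mult_stratum)
  also have "\<dots> = EE f"
  proof (intro Bochner_Integration.integral_cong refl)
    fix \<omega> assume "\<omega> \<in> space M"
    then have "(\<Sum>z\<in>UNIV. f (unit 0 \<omega>) * indicator {\<omega>\<in>space M. Z 0 \<omega> = z} \<omega>) = (\<Sum>z\<in>UNIV. if z = Z 0 \<omega> then f (unit 0 \<omega>) else 0)"
      by (intro sum.cong) (auto simp: indicator_def)
    then show "(\<Sum>z\<in>UNIV. f (unit 0 \<omega>) * indicator {\<omega>\<in>space M. Z 0 \<omega> = z} \<omega>) = f (unit 0 \<omega>)"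
      by (simp add: sum.delta)
  qed
  finally show ?thesis by simp
qed

lemma EE_mult_strata:
  assumes "sqint f"
  shows "EE (\<lambda>x. f x * g (fst (snd x))) = (\<Sum>z\<in>UNIV. pz z * (cmean f z * g z))"
proof -
  have "EE (\<lambda>x. f x * g (fst (snd x))) = (\<Sum>z\<in>UNIV. \<integral>\<omega>. f (unit 0 \<omega>) * g (fst (snd (unit 0 \<omega>))) * indicator {\<omega>\<in>space M. Z 0 \<omega> = z} \<omega> \<partial>M)"
    by (rule EE_split[OF sqint_prod[OF assms sqint_strata]])
  also have "\<dots> = (\<Sum>z\<in>UNIV. pz z * (cmean f z * g z))"
  proof (intro sum.cong refl)
    fix z
    have "(\<integral>\<omega>. f (unit 0 \<omega>) * g (fst (snd (unit 0 \<omega>))) * indicator {\<omega>\<in>space M. Z 0 \<omega> = z} \<omega> \<partial>M)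
       = (\<integral>\<omega>. g z * (f (unit 0 \<omega>) * indicator {\<omega>\<in>space M. Z 0 \<omega> = z} \<omega>) \<partial>M)"
      by (intro Bochner_Integration.integral_cong) (auto simp: indicator_def unit_def)
    also have "\<dots> = pz z * (cmean f z * g z)"
      using pz_pos[of z] by (simp add: cmean_def)
    finally show "(\<integral>\<omega>. f (unit 0 \<omega>) * g (fst (snd (unit 0 \<omega>))) * indicator {\<omega>\<in>space M. Z 0 \<omega> = z} \<omega> \<partial>M) = pz z * (cmean f z * g z)" .
  qed
  finally show ?thesis .
qed

lemma EE_cmean: "sqint f \<Longrightarrow> EE (\<lambda>x. cmean f (fst (snd x))) = EE f"
  using EE_strata[of "cmean f"] EE_mult_strata[of f "\<lambda>_. 1"] by simp

lemma integral_resid_stratum: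
  assumes "sqint \<xi>"
  shows "(\<integral>\<omega>. resid \<xi> (unit 0 \<omega>) * indicator {\<omega>\<in>space M. Z 0 \<omega> = z} \<omega> \<partial>M) = 0"
proof -
  have "(\<integral>\<omega>. resid \<xi> (unit 0 \<omega>) * indicator {\<omega>\<in>space M. Z 0 \<omega> = z} \<omega> \<partial>M)
     = (\<integral>\<omega>. \<xi> (unit 0 \<omega>) * indicator {\<omega>\<in>space M. Z 0 \<omega> = z} \<omega> - cmean \<xi> z * indicator {\<omega>\<in>space M. Z 0 \<omega> = z} \<omega> \<partial>M)"
    by (intro Bochner_Integration.integral_cong refl) (auto simp: resid_def unit_def indicator_def)
  also have "\<dots> = (\<integral>\<omega>. \<xi> (unit 0 \<omega>) * indicator {\<omega>\<in>space M. Z 0 \<omega> = z} \<omega> \<partial>M) - cmean \<xi> z * pz z"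
    using sqint_integrable[OF assms]
    by (subst Bochner_Integration.integral_diff) (auto intro!: integrable_mult_stratum simp: pz_def less_top[symmetric])
  also have "\<dots> = 0" using pz_pos[of z] by (simp add: cmean_def)
  finally show ?thesis .
qed

lemma char_stratum:
  assumes q: "sqint q" and mean: "(\<integral>\<omega>. q (unit 0 \<omega>) * indicator {\<omega>\<in>space M. Z 0 \<omega> = z} \<omega> \<partial>M) = 0"
  shows "(\<lambda>n. of_nat n * ((\<integral>\<omega>. indicator {\<omega>\<in>space M. Z 0 \<omega> = z} \<omega> *\<^sub>R iexp (q (unit 0 \<omega>) / sqrt (real n)) \<partial>M) / pz z - 1))
    \<longlonglongrightarrow> complex_of_real (- cmean (\<lambda>x. (q x)\<^sup>2) z / 2)"
proof -
  let ?C = "{\<omega>\<in>space M. Z 0 \<omega> = z}"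
  define \<xi> where "\<xi> \<omega> = q (unit 0 \<omega>) * indicator ?C \<omega>" for \<omega>
  note [measurable] = sqint_measurable[OF q]
  have \<xi>m[measurable]: "\<xi> \<in> borel_measurable M" unfolding \<xi>_def by measurable
  have \<xi>2: "(\<xi> \<omega>)\<^sup>2 = (q (unit 0 \<omega>))\<^sup>2 * indicator ?C \<omega>" for \<omega> by (auto simp: \<xi>_def indicator_def)
  have sq: "integrable M (\<lambda>\<omega>. (\<xi> \<omega>)\<^sup>2)"
    unfolding \<xi>2 by (intro integrable_mult_stratum sqint_square q)
  have pz: "complex_of_real (pz z) \<noteq> 0" using pz_pos[of z] by simp
  have "(\<lambda>n. of_nat n * ((\<integral>\<omega>. iexp (\<xi> \<omega> / sqrt (real n)) \<partial>M) - 1) / complex_of_real (pz z))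
     \<longlonglongrightarrow> complex_of_real (- (\<integral>\<omega>. (\<xi> \<omega>)\<^sup>2 \<partial>M) / 2) / complex_of_real (pz z)"
    using mean by (intro tendsto_divide tendsto_const pz char_second_order sq) (auto simp: \<xi>_def)
  moreover have "complex_of_real (- (\<integral>\<omega>. (\<xi> \<omega>)\<^sup>2 \<partial>M) / 2) / complex_of_real (pz z) = complex_of_real (- cmean (\<lambda>x. (q x)\<^sup>2) z / 2)"
    unfolding \<xi>2 cmean_def by simp
  moreover have "of_nat n * ((\<integral>\<omega>. iexp (\<xi> \<omega> / sqrt (real n)) \<partial>M) - 1) / complex_of_real (pz z)
     = of_nat n * ((\<integral>\<omega>. indicator ?C \<omega> *\<^sub>R iexp (q (unit 0 \<omega>) / sqrt (real n)) \<partial>M) / pz z - 1)" for n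
  proof -
    have i: "integrable M (\<lambda>\<omega>. indicator ?C \<omega> *\<^sub>R iexp (q (unit 0 \<omega>) / sqrt (real n)))"
      by (rule integrable_const_bound[where B=1]) (auto simp: indicator_def)
    have "(\<integral>\<omega>. iexp (\<xi> \<omega> / sqrt (real n)) \<partial>M)
       = (\<integral>\<omega>. indicator ?C \<omega> *\<^sub>R iexp (q (unit 0 \<omega>) / sqrt (real n)) + (1 - complex_of_real (indicator ?C \<omega>)) \<partial>M)"
      by (intro Bochner_Integration.integral_cong refl) (auto simp: \<xi>_def indicator_def)
    also have "\<dots> = (\<integral>\<omega>. indicator ?C \<omega> *\<^sub>R iexp (q (unit 0 \<omega>) / sqrt (real n)) \<partial>M) + (\<integral>\<omega>. 1 - complex_of_real (indicator ?C \<omega>) \<partial>M)"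
      by (rule Bochner_Integration.integral_add[OF i]) (auto simp: less_top[symmetric] intro!: Bochner_Integration.integrable_diff integrable_of_real)
    also have "(\<integral>\<omega>. 1 - complex_of_real (indicator ?C \<omega>) \<partial>M) = 1 - complex_of_real (pz z)"
      by (subst Bochner_Integration.integral_diff)
         (auto simp: pz_def integral_complex_of_real prob_space less_top[symmetric] intro!: integrable_of_real)
    finally have "(\<integral>\<omega>. iexp (\<xi> \<omega> / sqrt (real n)) \<partial>M)
       = (\<integral>\<omega>. indicator ?C \<omega> *\<^sub>R iexp (q (unit 0 \<omega>) / sqrt (real n)) \<partial>M) + (1 - complex_of_real (pz z))" .
    then have "(\<integral>\<omega>. iexp (\<xi> \<omega> / sqrt (real n)) \<partial>M) - 1
       = (\<integral>\<omega>. indicator ?C \<omega> *\<^sub>R iexp (q (unit 0 \<omega>) / sqrt (real n)) \<partial>M) - complex_of_real (pz z)"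
      by simp
    then show ?thesis using pz by (simp only: times_divide_eq_right[symmetric] diff_divide_distrib divide_self not_False_eq_True)
  qed
  ultimately show ?thesis by (simp only:)
qed

theorem char_main:
  fixes q :: "'k \<Rightarrow> (real^'k) \<times> 'z \<times> (real^'p) \<Rightarrow> real" and g :: "'z \<Rightarrow> real" and h :: "real^('z \<times> 'k)"
  assumes q: "\<And>t. sqint (q t)"
    and mean: "\<And>t z. (\<integral>\<omega>. q t (unit 0 \<omega>) * indicator {\<omega>\<in>space M. Z 0 \<omega> = z} \<omega> \<partial>M) = 0"
    and g: "EE (\<lambda>x. g (fst (snd x))) = 0"
  shows "(\<lambda>n. \<integral>\<omega>. iexp ((\<Sum>i<n. q (A n i \<omega>) (unit i \<omega>) / sqrt (real n)) + h \<bullet> U n \<omega> + (\<Sum>i<n. g (Z i \<omega>) / sqrt (real n))) \<partial>M)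
    \<longlonglongrightarrow> complex_of_real (exp (- ((\<Sum>t\<in>UNIV. pv $ t * EE (\<lambda>x. (q t x)\<^sup>2)) + h \<bullet> (Dm *v h) + EE (\<lambda>x. (g (fst (snd x)))\<^sup>2)) / 2))"
proof -
  note qm[measurable] = sqint_measurable[OF q]
  define v where "v t z = cmean (\<lambda>x. (q t x)\<^sup>2) z" for t z
  have v0: "0 \<le> v t z" for t z
    unfolding v_def cmean_def using pz_pos[of z] by (auto intro!: divide_nonneg_pos Bochner_Integration.integral_nonneg)
  define va where "va = (\<Sum>t\<in>UNIV. pv $ t * EE (\<lambda>x. (q t x)\<^sup>2))"
  have va: "(\<Sum>z\<in>UNIV. \<Sum>t\<in>UNIV. pv $ t * pz z * (v t z / 2)) = va / 2"
  proof -
    have "(\<Sum>z\<in>UNIV. pz z * v t z) = EE (\<lambda>x. (q t x)\<^sup>2)" for t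
      using EE_split[OF sqint_square[OF q[of t]]] pz_pos by (simp add: v_def cmean_def less_le)
    moreover have "(\<Sum>z\<in>UNIV. \<Sum>t\<in>UNIV. pv $ t * pz z * (v t z / 2)) = (\<Sum>t\<in>UNIV. pv $ t * (\<Sum>z\<in>UNIV. pz z * v t z) / 2)"
      by (subst sum.swap) (simp add: sum_distrib_left sum_divide_distrib mult_ac)
    ultimately show ?thesis by (simp add: va_def sum_divide_distrib)
  qed
  define \<kappa> where "\<kappa> = complex_of_real (exp (- va / 2))"
  define \<kappa>2 where "\<kappa>2 = complex_of_real (exp (- (h \<bullet> (Dm *v h)) / 2))"
  define \<kappa>3 where "\<kappa>3 = complex_of_real (exp (- EE (\<lambda>x. (g (fst (snd x)))\<^sup>2) / 2))"
  define \<phi> where "\<phi> n t z = (\<integral>\<omega>. indicator {\<omega>\<in>space M. Z 0 \<omega> = z} \<omega> *\<^sub>R iexp (q t (unit 0 \<omega>) / sqrt (real n)) \<partial>M) / pz z"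
    for n :: nat and t z
  define cc where "cc n zs = iexp (\<Sum>i<n. g (zs ! i) / sqrt (real n))" for n and zs :: "'z list"
  define ul where "ul n as zs = (\<chi> zt. sqrt (real n) *
     (real (card {i. i < n \<and> zs ! i = fst zt \<and> as ! i = snd zt}) / real (card {i. i < n \<and> zs ! i = fst zt}) - pv $ snd zt))"
    for n :: nat and as :: "'k list" and zs :: "'z list"
  have ul: "U n \<omega> = ul n (As n \<omega>) (Zs n \<omega>)" for n \<omega>
    by (simp add: U_def ul_def nzt_lists nz_lists)
  define c where "c n as zs = cc n zs * iexp (h \<bullet> ul n as zs)" for n as zs
  have ccZ: "cc n (Zs n \<omega>) = iexp (\<Sum>i<n. g (Z i \<omega>) / sqrt (real n))" for n \<omega>
    by (simp add: cc_def Zs_def)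
  define P where "P n \<omega> = (\<Prod>i<n. \<phi> n (A n i \<omega>) (Z i \<omega>))" for n \<omega>
  define R where "R n \<omega> = exp (- (\<Sum>z\<in>UNIV. \<Sum>t\<in>UNIV. real (nzt n z t \<omega>) / real n * (v t z / 2)))" for n \<omega>
  have cU: "c n (As n \<omega>) (Zs n \<omega>) = cc n (Zs n \<omega>) * iexp (h \<bullet> U n \<omega>)" for n \<omega>
    by (simp add: c_def ul)
  have c1: "cmod (c n (As n \<omega>) (Zs n \<omega>)) = 1" for n \<omega> by (simp add: c_def cc_def norm_mult)
  have [measurable]: "(\<lambda>\<omega>. c n (As n \<omega>) (Zs n \<omega>)) \<in> borel_measurable M" for n
    unfolding cU ccZ by (auto intro!: borel_measurable_times measurable_compose[OF measurable_Z])
  have [measurable]: "(\<lambda>\<omega>. \<phi> n (A n i \<omega>) (Z i \<omega>)) \<in> borel_measurable M" for n i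
    by (rule measurable_compose_countable[OF _ A_meas]) (auto intro: measurable_compose[OF measurable_Z])
  have [measurable]: "P n \<in> borel_measurable M" "R n \<in> borel_measurable M" for n
    unfolding P_def[abs_def] R_def[abs_def] by measurable
  have step1: "(\<integral>\<omega>. iexp ((\<Sum>i<n. q (A n i \<omega>) (unit i \<omega>) / sqrt (real n)) + h \<bullet> U n \<omega> + (\<Sum>i<n. g (Z i \<omega>) / sqrt (real n))) \<partial>M)
     = (\<integral>\<omega>. c n (As n \<omega>) (Zs n \<omega>) * P n \<omega> \<partial>M)" for n
  proof -
    have "(\<integral>\<omega>. iexp ((\<Sum>i<n. q (A n i \<omega>) (unit i \<omega>) / sqrt (real n)) + h \<bullet> U n \<omega> + (\<Sum>i<n. g (Z i \<omega>) / sqrt (real n))) \<partial>M)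
      = (\<integral>\<omega>. c n (As n \<omega>) (Zs n \<omega>) * (\<Prod>i<n. (\<lambda>t x. iexp (q t x / sqrt (real n))) (A n i \<omega>) (unit i \<omega>)) \<partial>M)"
    proof (intro Bochner_Integration.integral_cong refl)
      fix \<omega>
      show "iexp ((\<Sum>i<n. q (A n i \<omega>) (unit i \<omega>) / sqrt (real n)) + h \<bullet> U n \<omega> + (\<Sum>i<n. g (Z i \<omega>) / sqrt (real n)))
        = c n (As n \<omega>) (Zs n \<omega>) * (\<Prod>i<n. (\<lambda>t x. iexp (q t x / sqrt (real n))) (A n i \<omega>) (unit i \<omega>))"
        unfolding cU ccZ iexp_sum[OF finite_lessThan, symmetric] by (rule iexp_add3)
    qed
    also have "\<dots> = (\<integral>\<omega>. c n (As n \<omega>) (Zs n \<omega>) * P n \<omega> \<partial>M)"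
      unfolding P_def \<phi>_def by (rule integral_given_assignment) auto
    finally show ?thesis .
  qed
  define \<delta> where "\<delta> n = (\<Sum>z\<in>UNIV. \<Sum>t\<in>UNIV. real n * cmod (\<phi> n t z - complex_of_real (exp (- (v t z / 2) / real n))))" for n
  have \<delta>: "\<delta> \<longlonglongrightarrow> 0"
    unfolding \<delta>_def[abs_def] \<phi>_def
    by (intro tendsto_null_sum second_order_exp_diff v0) (unfold v_def, rule char_stratum[OF q mean])
  have \<phi>1: "cmod (\<phi> n t z) \<le> 1" for n t z
  proof -
    have "cmod (\<integral>\<omega>. indicator {\<omega>\<in>space M. Z 0 \<omega> = z} \<omega> *\<^sub>R iexp (q t (unit 0 \<omega>) / sqrt (real n)) \<partial>M)
       \<le> (\<integral>\<omega>. norm (indicator {\<omega>\<in>space M. Z 0 \<omega> = z} \<omega> *\<^sub>R iexp (q t (unit 0 \<omega>) / sqrt (real n))) \<partial>M)"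
      by (rule integral_norm_bound)
    also have "\<dots> = pz z" by (simp add: pz_def)
    finally show ?thesis using pz_pos[of z] by (simp add: \<phi>_def norm_divide divide_le_eq)
  qed
  have PR: "cmod (P n \<omega> - complex_of_real (R n \<omega>)) \<le> \<delta> n" for n \<omega>
  proof -
    define w where "w i = complex_of_real (exp (- (v (A n i \<omega>) (Z i \<omega>) / 2) / real n))" for i
    have "(\<Sum>i<n. (v (A n i \<omega>) (Z i \<omega>) / 2) / real n) = (\<Sum>z\<in>UNIV. \<Sum>t\<in>UNIV. real (nzt n z t \<omega>) / real n * (v t z / 2))"
      by (subst sum_counts[where F="\<lambda>t z. (v t z / 2) / real n"]) (simp add: mult.commute)
    then have "complex_of_real (R n \<omega>) = complex_of_real (exp (\<Sum>i<n. - (v (A n i \<omega>) (Z i \<omega>) / 2) / real n))"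
      by (simp add: R_def sum_negf)
    also have "\<dots> = (\<Prod>i<n. w i)" by (simp add: exp_sum w_def)
    finally have "cmod (P n \<omega> - complex_of_real (R n \<omega>)) = cmod ((\<Prod>i<n. \<phi> n (A n i \<omega>) (Z i \<omega>)) - (\<Prod>i<n. w i))"
      by (simp add: P_def)
    also have "\<dots> \<le> (\<Sum>i<n. cmod (\<phi> n (A n i \<omega>) (Z i \<omega>) - w i))"
      by (rule norm_prod_diff) (auto simp: \<phi>1 w_def v0)
    also have "\<dots> \<le> (\<Sum>i<n. \<Sum>z\<in>UNIV. \<Sum>t\<in>UNIV. cmod (\<phi> n t z - complex_of_real (exp (- (v t z / 2) / real n))))"
    proof (rule sum_mono)
      fix i
      let ?F = "\<lambda>t z. cmod (\<phi> n t z - complex_of_real (exp (- (v t z / 2) / real n)))"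
      have "?F (A n i \<omega>) (Z i \<omega>) \<le> (\<Sum>t\<in>UNIV. ?F t (Z i \<omega>))" by (rule member_le_sum) auto
      also have "\<dots> \<le> (\<Sum>z\<in>UNIV. \<Sum>t\<in>UNIV. ?F t z)" by (rule member_le_sum) (auto intro: sum_nonneg)
      finally show "cmod (\<phi> n (A n i \<omega>) (Z i \<omega>) - w i) \<le> (\<Sum>z\<in>UNIV. \<Sum>t\<in>UNIV. ?F t z)" by (simp add: w_def)
    qed
    also have "\<dots> = \<delta> n" by (simp add: \<delta>_def sum_distrib_left)
    finally show ?thesis .
  qed
  have R0: "0 \<le> R n \<omega>" "R n \<omega> \<le> 1" for n \<omega>
    by (auto simp: R_def intro!: sum_nonneg mult_nonneg_nonneg divide_nonneg_nonneg v0)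
  have va0: "0 \<le> va" unfolding va_def using pi_pos by (intro sum_nonneg mult_nonneg_nonneg Bochner_Integration.integral_nonneg) (auto simp: less_imp_le)
  have nullR: "null_in_prob (\<lambda>n \<omega>. R n \<omega> - exp (- va / 2))"
  proof (rule null_in_prob_dominated[where E="\<lambda>_ _. False"])
    show "null_in_prob (\<lambda>n \<omega>. \<Sum>z\<in>UNIV. \<Sum>t\<in>UNIV. v t z / 2 * (real (nzt n z t \<omega>) / real n - pv $ t * pz z))"
      by (intro null_in_prob_sum null_in_prob_cmult null_in_prob_nzt) auto
    fix n \<omega>
    have "(\<Sum>z\<in>UNIV. \<Sum>t\<in>UNIV. v t z / 2 * (real (nzt n z t \<omega>) / real n - pv $ t * pz z))
       = (\<Sum>z\<in>UNIV. \<Sum>t\<in>UNIV. real (nzt n z t \<omega>) / real n * (v t z / 2)) - va / 2"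
      unfolding va[symmetric] by (simp add: sum_subtractf[symmetric] algebra_simps)
    moreover have "0 \<le> (\<Sum>z\<in>UNIV. \<Sum>t\<in>UNIV. real (nzt n z t \<omega>) / real n * (v t z / 2))"
      by (intro sum_nonneg mult_nonneg_nonneg divide_nonneg_nonneg v0) auto
    ultimately show "\<bar>R n \<omega> - exp (- va / 2)\<bar> \<le> \<bar>\<Sum>z\<in>UNIV. \<Sum>t\<in>UNIV. v t z / 2 * (real (nzt n z t \<omega>) / real n - pv $ t * pz z)\<bar>"
      using exp_minus_lipschitz[of "\<Sum>z\<in>UNIV. \<Sum>t\<in>UNIV. real (nzt n z t \<omega>) / real n * (v t z / 2)" "va / 2"] va0
      by (simp add: R_def)
  qed auto
  have e1: "0 \<le> exp (- va / 2)" "exp (- va / 2) \<le> 1" using va0 by auto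
  have "(\<lambda>n. \<integral>\<omega>. \<bar>R n \<omega> - exp (- va / 2)\<bar> \<partial>M) \<longlonglongrightarrow> 0"
  proof (rule integral_tendsto_zero_of_null_in_prob[OF nullR])
    show "\<bar>R n \<omega> - exp (- va / 2)\<bar> \<le> 1" for n \<omega> using R0[of n \<omega>] e1 by linarith
  qed
  then have lim0: "(\<lambda>n. \<delta> n + (\<integral>\<omega>. \<bar>R n \<omega> - exp (- va / 2)\<bar> \<partial>M)) \<longlonglongrightarrow> 0"
    using tendsto_add[OF \<delta>] by fastforce
  have P1: "cmod (P n \<omega>) \<le> 1" for n \<omega>
    unfolding P_def prod_norm[symmetric] by (intro prod_le_1) (auto simp: \<phi>1)
  have ic: "integrable M (\<lambda>\<omega>. c n (As n \<omega>) (Zs n \<omega>))" for n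
    by (rule integrable_const_bound[where B=1]) (auto simp: c1)
  have icP: "integrable M (\<lambda>\<omega>. c n (As n \<omega>) (Zs n \<omega>) * P n \<omega>)" for n
    by (rule integrable_const_bound[where B=1]) (auto simp: norm_mult c1 P1)
  have step2: "(\<lambda>n. (\<integral>\<omega>. c n (As n \<omega>) (Zs n \<omega>) * P n \<omega> \<partial>M) - \<kappa> * (\<integral>\<omega>. c n (As n \<omega>) (Zs n \<omega>) \<partial>M)) \<longlonglongrightarrow> 0"
  proof (rule Lim_null_comparison[OF always_eventually lim0], rule allI)
    fix n
    have iR: "integrable M (\<lambda>\<omega>. \<bar>R n \<omega> - exp (- va / 2)\<bar>)"
    proof (rule integrable_const_bound[where B=1])
      have "\<bar>R n \<omega> - exp (- va / 2)\<bar> \<le> 1" for \<omega> using R0[of n \<omega>] e1 by linarith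
      then show "AE \<omega> in M. norm \<bar>R n \<omega> - exp (- va / 2)\<bar> \<le> 1" by simp
    qed measurable
    have "(\<integral>\<omega>. c n (As n \<omega>) (Zs n \<omega>) * P n \<omega> \<partial>M) - \<kappa> * (\<integral>\<omega>. c n (As n \<omega>) (Zs n \<omega>) \<partial>M)
       = (\<integral>\<omega>. c n (As n \<omega>) (Zs n \<omega>) * (P n \<omega> - \<kappa>) \<partial>M)"
    proof -
      have "(\<integral>\<omega>. c n (As n \<omega>) (Zs n \<omega>) * (P n \<omega> - \<kappa>) \<partial>M)
         = (\<integral>\<omega>. c n (As n \<omega>) (Zs n \<omega>) * P n \<omega> - \<kappa> * c n (As n \<omega>) (Zs n \<omega>) \<partial>M)"
        by (simp add: algebra_simps)
      then show ?thesis using ic[of n] icP[of n] by simp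
    qed
    also have "norm \<dots> \<le> (\<integral>\<omega>. norm (c n (As n \<omega>) (Zs n \<omega>) * (P n \<omega> - \<kappa>)) \<partial>M)"
      by (rule integral_norm_bound)
    also have "\<dots> \<le> (\<integral>\<omega>. \<delta> n + \<bar>R n \<omega> - exp (- va / 2)\<bar> \<partial>M)"
    proof (rule integral_mono')
      show "integrable M (\<lambda>\<omega>. \<delta> n + \<bar>R n \<omega> - exp (- va / 2)\<bar>)" using iR by simp
      fix \<omega>
      have "cmod (P n \<omega> - \<kappa>) \<le> cmod (P n \<omega> - complex_of_real (R n \<omega>)) + cmod (complex_of_real (R n \<omega>) - \<kappa>)"
        using norm_triangle_ineq[of "P n \<omega> - complex_of_real (R n \<omega>)" "complex_of_real (R n \<omega>) - \<kappa>"] by simp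
      also have "cmod (complex_of_real (R n \<omega>) - \<kappa>) = \<bar>R n \<omega> - exp (- va / 2)\<bar>"
        unfolding \<kappa>_def of_real_diff[symmetric] norm_of_real ..
      finally show "norm (c n (As n \<omega>) (Zs n \<omega>) * (P n \<omega> - \<kappa>)) \<le> \<delta> n + \<bar>R n \<omega> - exp (- va / 2)\<bar>"
        using PR[of n \<omega>] by (simp add: norm_mult c1)
    next
      fix \<omega>
      show "0 \<le> \<delta> n + \<bar>R n \<omega> - exp (- va / 2)\<bar>" using order.trans[OF norm_ge_zero PR[of n \<omega>]] by simp
    qed
    also have "\<dots> = \<delta> n + (\<integral>\<omega>. \<bar>R n \<omega> - exp (- va / 2)\<bar> \<partial>M)" using iR by (simp add: prob_space)
    finally show "norm ((\<integral>\<omega>. c n (As n \<omega>) (Zs n \<omega>) * P n \<omega> \<partial>M) - \<kappa> * (\<integral>\<omega>. c n (As n \<omega>) (Zs n \<omega>) \<partial>M))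
       \<le> \<delta> n + (\<integral>\<omega>. \<bar>R n \<omega> - exp (- va / 2)\<bar> \<partial>M)" .
  qed
  have step3: "(\<lambda>n. (\<integral>\<omega>. c n (As n \<omega>) (Zs n \<omega>) \<partial>M) - \<kappa>2 * (\<integral>\<omega>. cc n (Zs n \<omega>) \<partial>M)) \<longlonglongrightarrow> 0"
    unfolding cU \<kappa>2_def by (rule char_U_given_Z) (simp add: cc_def)
  have step4: "(\<lambda>n. \<integral>\<omega>. cc n (Zs n \<omega>) \<partial>M) \<longlonglongrightarrow> \<kappa>3"
    unfolding ccZ \<kappa>3_def
    using clt_units[OF sqint_measurable[OF sqint_strata[of g]] sqint_square[OF sqint_strata[of g]] g] by (simp add: unit_def)
  have "(\<lambda>n. ((\<integral>\<omega>. c n (As n \<omega>) (Zs n \<omega>) * P n \<omega> \<partial>M) - \<kappa> * (\<integral>\<omega>. c n (As n \<omega>) (Zs n \<omega>) \<partial>M))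
      + \<kappa> * ((\<integral>\<omega>. c n (As n \<omega>) (Zs n \<omega>) \<partial>M) - \<kappa>2 * (\<integral>\<omega>. cc n (Zs n \<omega>) \<partial>M)) + \<kappa> * \<kappa>2 * (\<integral>\<omega>. cc n (Zs n \<omega>) \<partial>M))
      \<longlonglongrightarrow> 0 + \<kappa> * 0 + \<kappa> * \<kappa>2 * \<kappa>3"
    by (intro tendsto_add tendsto_mult tendsto_const step2 step3 step4)
  then have "(\<lambda>n. \<integral>\<omega>. c n (As n \<omega>) (Zs n \<omega>) * P n \<omega> \<partial>M) \<longlonglongrightarrow> \<kappa> * \<kappa>2 * \<kappa>3"
    by (simp add: algebra_simps)
  moreover have "\<kappa> * \<kappa>2 * \<kappa>3 = complex_of_real (exp (- (va + h \<bullet> (Dm *v h) + EE (\<lambda>x. (g (fst (snd x)))\<^sup>2)) / 2))"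
    unfolding \<kappa>_def \<kappa>2_def \<kappa>3_def of_real_mult[symmetric] exp_add[symmetric] by (simp add: field_simps)
  ultimately show ?thesis unfolding step1 va_def by simp
qed

subsection \<open>Linearisation of the estimator\<close>

definition asum :: "nat \<Rightarrow> 'k \<Rightarrow> ((real^'k) \<times> 'z \<times> (real^'p) \<Rightarrow> real) \<Rightarrow> 'a \<Rightarrow> real" where
  "asum n t \<xi> \<omega> = (\<Sum>i<n. if A n i \<omega> = t then \<xi> (unit i \<omega>) else 0) / sqrt (real n)"

definition usum :: "nat \<Rightarrow> ((real^'k) \<times> 'z \<times> (real^'p) \<Rightarrow> real) \<Rightarrow> 'a \<Rightarrow> real" where
  "usum n \<xi> \<omega> = (\<Sum>i<n. \<xi> (unit i \<omega>)) / sqrt (real n)"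

lemma measurable_asum:
  assumes "sqint \<xi>" shows "asum n t \<xi> \<in> borel_measurable M"
proof -
  note [measurable] = sqint_measurable[OF assms]
  show ?thesis unfolding asum_def[abs_def] by measurable
qed

lemma measurable_usum:
  assumes "sqint \<xi>" shows "usum n \<xi> \<in> borel_measurable M"
proof -
  note [measurable] = sqint_measurable[OF assms]
  show ?thesis unfolding usum_def[abs_def] by measurable
qed

lemma asum_add: "asum n t (\<lambda>x. f x + g x) \<omega> = asum n t f \<omega> + asum n t g \<omega>"
  unfolding asum_def add_divide_distrib[symmetric] sum.distrib[symmetric]
  by (intro arg_cong2[where f="(/)"] sum.cong) auto

lemma asum_cmult: "asum n t (\<lambda>x. c * f x) \<omega> = c * asum n t f \<omega>"
  unfolding asum_def times_divide_eq_right sum_distrib_left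
  by (intro arg_cong2[where f="(/)"] sum.cong) auto

lemma asum_diff: "asum n t (\<lambda>x. f x - g x) \<omega> = asum n t f \<omega> - asum n t g \<omega>"
  using asum_add[of n t f "\<lambda>x. -1 * g x" \<omega>] asum_cmult[of n t "-1" g \<omega>] by simp

lemma asum_sum: "finite I \<Longrightarrow> asum n t (\<lambda>x. \<Sum>j\<in>I. f j x) \<omega> = (\<Sum>j\<in>I. asum n t (f j) \<omega>)"
proof (induction I rule: finite_induct)
  case empty
  then show ?case by (simp add: asum_def)
qed (simp add: asum_add)

lemma usum_add: "usum n (\<lambda>x. f x + g x) \<omega> = usum n f \<omega> + usum n g \<omega>"
  by (simp add: usum_def add_divide_distrib sum.distrib)

lemma usum_cmult: "usum n (\<lambda>x. c * f x) \<omega> = c * usum n f \<omega>"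
  by (simp add: usum_def sum_distrib_left)

lemma usum_sum: "finite I \<Longrightarrow> usum n (\<lambda>x. \<Sum>j\<in>I. f j x) \<omega> = (\<Sum>j\<in>I. usum n (f j) \<omega>)"
  by (induction I rule: finite_induct) (auto simp: usum_add usum_def[of _ "\<lambda>x. 0"])

lemma sum_strata_counts: "(\<Sum>i<n. m (Z i \<omega>)) = (\<Sum>z\<in>UNIV. real (nz n z \<omega>) * m z)"
proof -
  have "(\<Sum>i<n. m (Z i \<omega>)) = (\<Sum>i<n. \<Sum>z\<in>UNIV. if Z i \<omega> = z then m z else 0)"
    by (simp add: sum.delta')
  also have "\<dots> = (\<Sum>z\<in>UNIV. \<Sum>i<n. if Z i \<omega> = z then m z else 0)" by (rule sum.swap)
  also have "\<dots> = (\<Sum>z\<in>UNIV. real (nz n z \<omega>) * m z)"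
  proof (intro sum.cong refl)
    fix z
    have "(\<Sum>i<n. if Z i \<omega> = z then m z else 0) = (\<Sum>i\<in>{i\<in>{..<n}. Z i \<omega> = z}. m z)"
      by (subst sum.inter_filter) auto
    then show "(\<Sum>i<n. if Z i \<omega> = z then m z else 0) = real (nz n z \<omega>) * m z"
      by (simp add: nz_def lessThan_def)
  qed
  finally show ?thesis .
qed

lemma sum_arm_counts: "(\<Sum>i<n. if A n i \<omega> = t then m (Z i \<omega>) else 0) = (\<Sum>z\<in>UNIV. real (nzt n z t \<omega>) * m z)"
proof -
  have "(\<Sum>i<n. (\<lambda>t' z. if t' = t then m z else 0) (A n i \<omega>) (Z i \<omega>)) = (\<Sum>z\<in>UNIV. \<Sum>t'\<in>UNIV. real (nzt n z t' \<omega>) * (if t' = t then m z else 0))"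
    by (rule sum_counts)
  also have "\<dots> = (\<Sum>z\<in>UNIV. real (nzt n z t \<omega>) * m z)"
    by (intro sum.cong refl) (simp add: if_distrib sum.delta cong: if_cong)
  finally show ?thesis by simp
qed

lemma asum_strata:
  "asum n t (\<lambda>x. m (fst (snd x))) \<omega>
     = (\<Sum>z\<in>UNIV. m z * (real (nz n z \<omega>) / real n) * U n \<omega> $ (z, t)) + pv $ t * usum n (\<lambda>x. m (fst (snd x))) \<omega>"
proof (cases "n = 0")
  case True
  then show ?thesis by (simp add: asum_def usum_def)
next
  case False
  have s: "real n = sqrt (real n) * sqrt (real n)" by simp
  have "m z * (real (nz n z \<omega>) / real n) * U n \<omega> $ (z, t) = (real (nzt n z t \<omega>) * m z - pv $ t * (real (nz n z \<omega>) * m z)) / sqrt (real n)" for z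
  proof (cases "nz n z \<omega> = 0")
    case True
    then show ?thesis using nz_zero_imp_nzt_zero[OF True] by simp
  next
    case False
    have "m z * (real (nz n z \<omega>) / real n) * U n \<omega> $ (z, t)
       = m z * real (nz n z \<omega>) * (sqrt (real n) / real n) * (real (nzt n z t \<omega>) / real (nz n z \<omega>) - pv $ t)"
      by (simp add: U_def)
    also have "sqrt (real n) / real n = 1 / sqrt (real n)"
      using \<open>n \<noteq> 0\<close> by (subst s) (simp del: real_sqrt_mult_self)
    also have "m z * real (nz n z \<omega>) * (1 / sqrt (real n)) * (real (nzt n z t \<omega>) / real (nz n z \<omega>) - pv $ t)
       = m z * (real (nz n z \<omega>) * (real (nzt n z t \<omega>) / real (nz n z \<omega>) - pv $ t)) / sqrt (real n)"
      by simp
    also have "real (nz n z \<omega>) * (real (nzt n z t \<omega>) / real (nz n z \<omega>) - pv $ t) = real (nzt n z t \<omega>) - pv $ t * real (nz n z \<omega>)"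
      using False by (simp add: right_diff_distrib mult.commute)
    finally show ?thesis by (simp add: algebra_simps)
  qed
  then have "(\<Sum>z\<in>UNIV. m z * (real (nz n z \<omega>) / real n) * U n \<omega> $ (z, t))
     = ((\<Sum>z\<in>UNIV. real (nzt n z t \<omega>) * m z) - pv $ t * (\<Sum>z\<in>UNIV. real (nz n z \<omega>) * m z)) / sqrt (real n)"
    by (simp add: sum_divide_distrib[symmetric] sum_subtractf sum_distrib_left)
  then show ?thesis
    unfolding sum_strata_counts[symmetric] sum_arm_counts[symmetric]
    by (simp add: asum_def usum_def unit_def diff_divide_distrib cong: if_cong)
qed

lemma asum_decomp:
  "asum n t \<xi> \<omega> = asum n t (resid \<xi>) \<omega>
     + (\<Sum>z\<in>UNIV. cmean \<xi> z * (real (nz n z \<omega>) / real n) * U n \<omega> $ (z, t)) + pv $ t * usum n (\<lambda>x. cmean \<xi> (fst (snd x))) \<omega>"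
proof -
  have "asum n t \<xi> \<omega> = asum n t (\<lambda>x. resid \<xi> x + cmean \<xi> (fst (snd x))) \<omega>" by (simp add: resid_def)
  then show ?thesis unfolding asum_add asum_strata by simp
qed

lemma bounded_in_prob_usum:
  assumes "sqint \<xi>" "EE \<xi> = 0"
  shows "bounded_in_prob (\<lambda>n \<omega>. usum n \<xi> \<omega>)"
  using bounded_in_prob_units[OF sqint_measurable[OF assms(1)] sqint_square[OF assms(1)] assms(2)]
  by (simp add: usum_def sum_divide_distrib)

lemma bounded_in_prob_asum_resid:
  assumes \<xi>: "sqint \<xi>"
  shows "bounded_in_prob (\<lambda>n \<omega>. asum n t (resid \<xi>) \<omega>)"
proof (rule bounded_in_prob_char[where v="pv $ t * EE (\<lambda>x. (resid \<xi> x)\<^sup>2)"])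
  show "asum n t (resid \<xi>) \<in> borel_measurable M" for n by (rule measurable_asum[OF sqint_resid[OF \<xi>]])
  show "0 \<le> pv $ t * EE (\<lambda>x. (resid \<xi> x)\<^sup>2)" using pi_pos[of t] by simp
  fix u :: real
  define q where "q t' x = (if t' = t then u * resid \<xi> x else 0)" for t' x
  have "(\<lambda>n. \<integral>\<omega>. iexp ((\<Sum>i<n. q (A n i \<omega>) (unit i \<omega>) / sqrt (real n)) + 0 \<bullet> U n \<omega> + (\<Sum>i<n. (\<lambda>_. 0) (Z i \<omega>) / sqrt (real n))) \<partial>M)
    \<longlonglongrightarrow> complex_of_real (exp (- ((\<Sum>t\<in>UNIV. pv $ t * EE (\<lambda>x. (q t x)\<^sup>2)) + 0 \<bullet> (Dm *v 0) + EE (\<lambda>x. ((\<lambda>_. 0) (fst (snd x)))\<^sup>2)) / 2))"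
  proof (rule char_main)
    show "sqint (q t')" for t'
      using sqint_cmult[OF sqint_resid[OF \<xi>], of u] sqint_const[of 0] by (cases "t' = t") (simp_all add: q_def[abs_def])
    show "(\<integral>\<omega>. q t' (unit 0 \<omega>) * indicator {\<omega>\<in>space M. Z 0 \<omega> = z} \<omega> \<partial>M) = 0" for t' z
      using integral_resid_stratum[OF \<xi>, of z] by (cases "t' = t") (simp_all add: q_def mult.assoc)
  qed simp
  moreover have "(\<Sum>i<n. q (A n i \<omega>) (unit i \<omega>) / sqrt (real n)) = u * asum n t (resid \<xi>) \<omega>" for n \<omega>
    using asum_cmult[of n t u "resid \<xi>" \<omega>] unfolding asum_def[of n t "\<lambda>x. u * resid \<xi> x"] sum_divide_distrib[symmetric] q_def by (simp only:)
  moreover have "(\<Sum>t'\<in>UNIV. pv $ t' * EE (\<lambda>x. (q t' x)\<^sup>2)) = u\<^sup>2 * (pv $ t * EE (\<lambda>x. (resid \<xi> x)\<^sup>2))"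
  proof -
    have "(\<Sum>t'\<in>UNIV. pv $ t' * EE (\<lambda>x. (q t' x)\<^sup>2)) = (\<Sum>t'\<in>UNIV. if t' = t then pv $ t' * (u\<^sup>2 * EE (\<lambda>x. (resid \<xi> x)\<^sup>2)) else 0)"
      by (intro sum.cong refl) (auto simp: q_def power_mult_distrib)
    then show ?thesis by (simp add: sum.delta)
  qed
  ultimately show "(\<lambda>n. \<integral>\<omega>. iexp (u * asum n t (resid \<xi>) \<omega>) \<partial>M) \<longlonglongrightarrow> complex_of_real (exp (- (u\<^sup>2 * (pv $ t * EE (\<lambda>x. (resid \<xi> x)\<^sup>2))) / 2))"
    by simp
qed

lemma bounded_in_prob_asum:
  assumes \<xi>: "sqint \<xi>" "EE \<xi> = 0"
  shows "bounded_in_prob (\<lambda>n \<omega>. asum n t \<xi> \<omega>)"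
  unfolding asum_decomp[of _ _ \<xi>]
  by (intro bounded_in_prob_add bounded_in_prob_asum_resid \<xi> bounded_in_prob_sum bounded_in_prob_mult
      bounded_in_prob_const bounded_in_prob_nz bounded_in_prob_U bounded_in_prob_usum sqint_strata)
     (simp_all add: EE_cmean \<xi>)

lemma ncount_eq: "real (ncount A n t \<omega>) = (\<Sum>i<n. if A n i \<omega> = t then 1 else 0)"
proof -
  have "(\<Sum>i<n. if A n i \<omega> = t then 1 else 0::real) = (\<Sum>i\<in>{i\<in>{..<n}. A n i \<omega> = t}. 1)"
    by (subst sum.inter_filter) auto
  then show ?thesis by (simp add: ncount_def lessThan_def)
qed

lemma measurable_ncount [measurable]: "(\<lambda>\<omega>. real (ncount A n t \<omega>)) \<in> borel_measurable M"
  unfolding ncount_eq by measurable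

lemma null_in_prob_ncount: "null_in_prob (\<lambda>n \<omega>. real (ncount A n t \<omega>) / real n - pv $ t)"
proof -
  have "null_in_prob (\<lambda>n \<omega>. \<Sum>z\<in>UNIV. real (nzt n z t \<omega>) / real n - pv $ t * pz z)"
    by (intro null_in_prob_sum null_in_prob_nzt) auto
  moreover have "(\<Sum>z\<in>UNIV. real (nzt n z t \<omega>) / real n - pv $ t * pz z) = real (ncount A n t \<omega>) / real n - pv $ t" for n \<omega>
    using sum_arm_counts[where m="\<lambda>_. 1" and n=n and \<omega>=\<omega> and t=t] sum_pz
    by (simp add: ncount_eq sum_subtractf sum_divide_distrib[symmetric] sum_distrib_left[symmetric])
  ultimately show ?thesis by simp
qed

lemma null_in_prob_inverse_ncount: "null_in_prob (\<lambda>n \<omega>. real n / real (ncount A n t \<omega>) - 1 / pv $ t)"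
  using null_in_prob_inverse[OF null_in_prob_ncount[of t]] pi_pos[of t] by simp

lemma bounded_in_prob_inverse_ncount: "bounded_in_prob (\<lambda>n \<omega>. real n / real (ncount A n t \<omega>))"
proof -
  have "bounded_in_prob (\<lambda>n \<omega>. (real n / real (ncount A n t \<omega>) - 1 / pv $ t) + 1 / pv $ t)"
    by (intro bounded_in_prob_add null_imp_bounded_in_prob null_in_prob_inverse_ncount bounded_in_prob_const)
  then show ?thesis by simp
qed

lemma prob_ncount_zero: "(\<lambda>n. prob {\<omega>\<in>space M. real (ncount A n t \<omega>) = 0}) \<longlonglongrightarrow> 0"
proof (rule tendsto_sandwich[OF _ _ tendsto_const])
  have p: "0 < pv $ t / 2" using pi_pos[of t] by simp
  show "(\<lambda>n. prob {\<omega>\<in>space M. pv $ t / 2 < \<bar>real (ncount A n t \<omega>) / real n - pv $ t\<bar>}) \<longlonglongrightarrow> 0"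
    by (rule null_in_probD[OF null_in_prob_ncount p])
  show "\<forall>\<^sub>F n in sequentially. prob {\<omega>\<in>space M. real (ncount A n t \<omega>) = 0} \<le> prob {\<omega>\<in>space M. pv $ t / 2 < \<bar>real (ncount A n t \<omega>) / real n - pv $ t\<bar>}"
    using pi_pos[of t] by (intro always_eventually allI finite_measure_mono) auto
qed simp

abbreviation "\<theta> \<equiv> theta M (Y 0)"
abbreviation "\<mu> \<equiv> muX M (X 0)"

definition xres :: "real^'p \<Rightarrow> (real^'k) \<times> 'z \<times> (real^'p) \<Rightarrow> real" where
  "xres b x = b \<bullet> (snd (snd x) - \<mu>)"

definition yres :: "'k \<Rightarrow> (real^'k) \<times> 'z \<times> (real^'p) \<Rightarrow> real" where
  "yres t x = fst x $ t - \<theta> $ t"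

definition rres :: "real^'p \<Rightarrow> 'k \<Rightarrow> (real^'k) \<times> 'z \<times> (real^'p) \<Rightarrow> real" where
  "rres b t x = yres t x - xres b x"

lemma xres_sum: "xres b x = (\<Sum>j\<in>UNIV. b $ j * xres (axis j 1) x)"
  by (simp add: xres_def inner_vec_def[of b] inner_axis')

lemma xres_axis: "xres (axis j 1) x = snd (snd x) $ j - \<mu> $ j"
  by (simp add: xres_def inner_axis')

lemma sqint_xres: "sqint (xres b)"
proof -
  have "sqint (\<lambda>x. \<Sum>j\<in>UNIV. b $ j * (snd (snd x) $ j - \<mu> $ j))"
    by (intro sqint_sum sqint_cmult sqint_diff sqint_X sqint_const) auto
  then show ?thesis unfolding xres_axis[symmetric] xres_sum[symmetric] by simp
qed

lemma sqint_yres: "sqint (yres t)"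
  unfolding yres_def[abs_def] by (intro sqint_diff sqint_Y sqint_const)

lemma sqint_rres: "sqint (rres b t)"
  unfolding rres_def[abs_def] by (intro sqint_diff sqint_yres sqint_xres)

lemma EE_yres: "EE (yres t) = 0"
  using sqint_integrable[OF sqint_Y[of t]] by (simp add: yres_def theta_def unit_def prob_space)

lemma EE_xres: "EE (xres b) = 0"
proof -
  have "EE (xres (axis j 1)) = 0" for j
    using sqint_integrable[OF sqint_X[of j]] unfolding xres_axis by (simp add: muX_def unit_def prob_space)
  moreover have "EE (xres b) = (\<Sum>j\<in>UNIV. b $ j * EE (xres (axis j 1)))"
    unfolding xres_sum[of b]
    by (subst Bochner_Integration.integral_sum) (auto intro!: integrable_mult_right sqint_integrable sqint_xres)
  ultimately show ?thesis by simp
qed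

lemma EE_rres: "EE (rres b t) = 0"
  using sqint_integrable[OF sqint_yres[of t]] sqint_integrable[OF sqint_xres[of b]] EE_yres[of t] EE_xres[of b]
  by (simp add: rres_def)

lemma thetahat_component:
  "thetahat Y X A bh n \<omega> $ t =
      (\<Sum>i<n. if A n i \<omega> = t then Y i \<omega> $ t else 0) / real (ncount A n t \<omega>)
      - (\<Sum>j\<in>UNIV. bh n t \<omega> $ j * ((\<Sum>i<n. if A n i \<omega> = t then X i \<omega> $ j else 0) / real (ncount A n t \<omega>)
                       - (\<Sum>i<n. X i \<omega> $ j) / real n))"
proof -
  have 1: "(\<Sum>i | i < n \<and> A n i \<omega> = t. f i) = (\<Sum>i<n. if A n i \<omega> = t then f i else 0)" for f :: "nat \<Rightarrow> real"
    using sum.inter_filter[of "{..<n}" f "\<lambda>i. A n i \<omega> = t"] by (simp add: lessThan_def)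
  show ?thesis
    unfolding thetahat_def by (simp add: inner_vec_def 1)
qed

lemma measurable_thetahat:
  assumes [measurable]: "\<And>n t. bh n t \<in> borel_measurable M"
  shows "(\<lambda>\<omega>. thetahat Y X A bh n \<omega>) \<in> borel_measurable M"
  by (rule borel_measurable_vecI) (simp only: thetahat_component, measurable)

lemma thetahat_expansion:
  assumes c: "real (ncount A n t \<omega>) \<noteq> 0" and n: "0 < n"
  shows "sqrt (real n) * (thetahat Y X A bh n \<omega> $ t - \<theta> $ t)
    = real n / real (ncount A n t \<omega>) * asum n t (rres b t) \<omega> + usum n (xres b) \<omega>
      - (\<Sum>j\<in>UNIV. (bh n t \<omega> $ j - b $ j) *
          (real n / real (ncount A n t \<omega>) * asum n t (xres (axis j 1)) \<omega> - usum n (xres (axis j 1)) \<omega>))"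
proof -
  define c where "c = real (ncount A n t \<omega>)"
  define s where "s = sqrt (real n)"
  have s: "s \<noteq> 0" "real n = s * s" using n by (auto simp: s_def)
  have c0: "c \<noteq> 0" using assms by (simp add: c_def)
  have ifs: "(\<Sum>i<n. if A n i \<omega> = t then f i - a else 0) = (\<Sum>i<n. if A n i \<omega> = t then f i else 0) - c * a" for f :: "nat \<Rightarrow> real" and a
  proof -
    have "(\<Sum>i<n. if A n i \<omega> = t then f i - a else 0) = (\<Sum>i<n. (if A n i \<omega> = t then f i else 0) - (if A n i \<omega> = t then 1 else 0) * a)"
      by (intro sum.cong) auto
    then show ?thesis by (simp only: sum_subtractf sum_distrib_right[symmetric] c_def ncount_eq)
  qed
  define SY where "SY = (\<Sum>i<n. if A n i \<omega> = t then Y i \<omega> $ t else 0)"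
  define SX where "SX j = (\<Sum>i<n. if A n i \<omega> = t then X i \<omega> $ j else 0)" for j
  define TX where "TX j = (\<Sum>i<n. X i \<omega> $ j)" for j
  have ay: "asum n t (yres t) \<omega> = (SY - c * \<theta> $ t) / s"
    unfolding asum_def yres_def unit_def fst_conv ifs by (simp add: SY_def s_def)
  have ax: "asum n t (xres (axis j 1)) \<omega> = (SX j - c * \<mu> $ j) / s" for j
    unfolding asum_def xres_axis unit_def snd_conv ifs by (simp add: SX_def s_def)
  have ux: "usum n (xres (axis j 1)) \<omega> = (TX j - real n * \<mu> $ j) / s" for j
    unfolding usum_def xres_axis unit_def snd_conv by (simp add: TX_def s_def sum_subtractf)
  define w where "w j = real n / c * asum n t (xres (axis j 1)) \<omega> - usum n (xres (axis j 1)) \<omega>" for j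
  have w: "w j = s * (SX j / c - TX j / real n)" for j
    unfolding w_def ax ux s(2) using s(1) c0 by (simp add: field_simps)
  have y: "real n / c * asum n t (yres t) \<omega> = s * (SY / c - \<theta> $ t)"
    unfolding ay s(2) using s(1) c0 by (simp add: field_simps)
  have "s * (thetahat Y X A bh n \<omega> $ t - \<theta> $ t) = s * (SY / c - \<theta> $ t) - (\<Sum>j\<in>UNIV. bh n t \<omega> $ j * (s * (SX j / c - TX j / real n)))"
    unfolding thetahat_component SY_def[symmetric] SX_def[symmetric] TX_def[symmetric] c_def[symmetric]
    by (simp add: right_diff_distrib sum_distrib_left mult_ac)
  also have "\<dots> = real n / c * asum n t (yres t) \<omega> - (\<Sum>j\<in>UNIV. bh n t \<omega> $ j * w j)"
    unfolding w y ..
  also have "\<dots> = real n / c * asum n t (yres t) \<omega> - (\<Sum>j\<in>UNIV. b $ j * w j) - (\<Sum>j\<in>UNIV. (bh n t \<omega> $ j - b $ j) * w j)"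
    by (simp add: left_diff_distrib sum_subtractf)
  also have "(\<Sum>j\<in>UNIV. b $ j * w j) = real n / c * asum n t (xres b) \<omega> - usum n (xres b) \<omega>"
  proof -
    have "asum n t (xres b) \<omega> = (\<Sum>j\<in>UNIV. b $ j * asum n t (xres (axis j 1)) \<omega>)"
      by (subst (1) xres_sum[abs_def]) (simp add: asum_sum asum_cmult)
    moreover have "usum n (xres b) \<omega> = (\<Sum>j\<in>UNIV. b $ j * usum n (xres (axis j 1)) \<omega>)"
      by (subst (1) xres_sum[abs_def]) (simp add: usum_sum usum_cmult)
    ultimately show ?thesis by (simp add: w_def right_diff_distrib sum_subtractf sum_distrib_left mult_ac)
  qed
  also have "real n / c * asum n t (yres t) \<omega> - (real n / c * asum n t (xres b) \<omega> - usum n (xres b) \<omega>)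
      = real n / c * asum n t (rres b t) \<omega> + usum n (xres b) \<omega>"
    by (simp add: rres_def[abs_def] asum_diff right_diff_distrib)
  finally show ?thesis by (simp add: s_def w_def c_def)
qed

definition main_term :: "real^'p \<Rightarrow> 'k \<Rightarrow> nat \<Rightarrow> 'a \<Rightarrow> real" where
  "main_term b t n \<omega> = (asum n t (resid (rres b t)) \<omega> + (\<Sum>z\<in>UNIV. pz z * cmean (rres b t) z * U n \<omega> $ (z, t))) / pv $ t
      + usum n (\<lambda>x. cmean (rres b t) (fst (snd x))) \<omega> + usum n (xres b) \<omega>"

lemma measurable_main_term [measurable]: "main_term b t n \<in> borel_measurable M"
  unfolding main_term_def[abs_def]
  using measurable_asum[OF sqint_resid[OF sqint_rres[of b t]], of n t] measurable_usum[OF sqint_xres[of b], of n]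
    measurable_usum[OF sqint_strata[of "cmean (rres b t)"], of n]
  by measurable

lemma null_in_prob_main_term:
  assumes bm[measurable]: "\<And>n t. bh n t \<in> borel_measurable M"
    and bconv: "\<And>\<epsilon>. 0 < \<epsilon> \<Longrightarrow> (\<lambda>n. prob {\<omega>\<in>space M. \<epsilon> < dist (bh n t \<omega>) b}) \<longlonglongrightarrow> 0"
  shows "null_in_prob (\<lambda>n \<omega>. sqrt (real n) * (thetahat Y X A bh n \<omega> $ t - \<theta> $ t) - main_term b t n \<omega>)"
proof -
  let ?r = "rres b t"
  define V where "V n \<omega> = (real n / real (ncount A n t \<omega>) - 1 / pv $ t) * asum n t ?r \<omega>
     + (1 / pv $ t) * (\<Sum>z\<in>UNIV. (real (nz n z \<omega>) / real n - pz z) * (cmean ?r z * U n \<omega> $ (z, t)))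
     - (\<Sum>j\<in>UNIV. (bh n t \<omega> $ j - b $ j) *
          (real n / real (ncount A n t \<omega>) * asum n t (xres (axis j 1)) \<omega> + (-1) * usum n (xres (axis j 1)) \<omega>))" for n \<omega>
  have bnull: "null_in_prob (\<lambda>n \<omega>. bh n t \<omega> $ j - b $ j)" for j
    unfolding null_in_prob_def
  proof (intro conjI allI impI)
    fix \<epsilon> :: real assume "0 < \<epsilon>"
    show "(\<lambda>n. prob {\<omega>\<in>space M. \<epsilon> < \<bar>bh n t \<omega> $ j - b $ j\<bar>}) \<longlonglongrightarrow> 0"
    proof (rule tendsto_sandwich[OF _ _ tendsto_const bconv[OF \<open>0 < \<epsilon>\<close>]])
      show "\<forall>\<^sub>F n in sequentially. prob {\<omega>\<in>space M. \<epsilon> < \<bar>bh n t \<omega> $ j - b $ j\<bar>} \<le> prob {\<omega>\<in>space M. \<epsilon> < dist (bh n t \<omega>) b}"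
      proof (intro always_eventually allI finite_measure_mono subsetI)
        fix n \<omega> assume "\<omega> \<in> {\<omega>\<in>space M. \<epsilon> < \<bar>bh n t \<omega> $ j - b $ j\<bar>}"
        then show "\<omega> \<in> {\<omega>\<in>space M. \<epsilon> < dist (bh n t \<omega>) b}"
          using component_le_norm_cart[of "bh n t \<omega> - b" j] by (auto simp: dist_norm)
      qed measurable
    qed simp
  qed measurable
  have "null_in_prob V"
    unfolding V_def[abs_def]
    by (intro null_in_prob_diff null_in_prob_add null_in_prob_mult_bounded null_in_prob_inverse_ncount
        null_in_prob_cmult null_in_prob_sum null_in_prob_nz bnull bounded_in_prob_asum bounded_in_prob_mult bounded_in_prob_const
        bounded_in_prob_U bounded_in_prob_add bounded_in_prob_inverse_ncount bounded_in_prob_usum sqint_rres sqint_xres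
        EE_rres EE_xres) auto
  then show ?thesis
  proof (rule null_in_prob_dominated[where E="\<lambda>n \<omega>. real (ncount A n t \<omega>) = 0"])
    show "(\<lambda>n. prob {\<omega>\<in>space M. real (ncount A n t \<omega>) = 0}) \<longlonglongrightarrow> 0" by (rule prob_ncount_zero)
    show "(\<lambda>\<omega>. sqrt (real n) * (thetahat Y X A bh n \<omega> $ t - \<theta> $ t) - main_term b t n \<omega>) \<in> borel_measurable M" for n
      using measurable_thetahat[of bh n, OF bm] by measurable
    fix n \<omega> assume "real (ncount A n t \<omega>) \<noteq> 0"
    moreover from this have "0 < n" by (cases n) (auto simp: ncount_def)
    ultimately have "sqrt (real n) * (thetahat Y X A bh n \<omega> $ t - \<theta> $ t) - main_term b t n \<omega> = V n \<omega>"
    proof -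
      assume c: "real (ncount A n t \<omega>) \<noteq> 0" and n: "0 < n"
      have 1: "(\<Sum>z\<in>UNIV. (real (nz n z \<omega>) / real n - pz z) * (cmean ?r z * U n \<omega> $ (z, t)))
         = (\<Sum>z\<in>UNIV. cmean ?r z * (real (nz n z \<omega>) / real n) * U n \<omega> $ (z, t)) - (\<Sum>z\<in>UNIV. pz z * cmean ?r z * U n \<omega> $ (z, t))"
        unfolding sum_subtractf[symmetric] by (simp add: algebra_simps)
      have 2: "k * (Q + H + p * S) + u - w - ((Q + H') / p + S + u) = (k - 1 / p) * (Q + H + p * S) + 1 / p * (H - H') - w"
        if "p \<noteq> 0" for k Q H H' S u w p :: real
        using that by (simp add: field_simps)
      have p: "pv $ t \<noteq> 0" using pi_pos[of t] by simp
      show ?thesis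
        unfolding thetahat_expansion[OF c n, of bh b] main_term_def V_def 1 asum_decomp[of n t ?r \<omega>]
          mult_minus1 add_uminus_conv_diff
        by (rule 2[OF p])
    qed
    then show "\<bar>sqrt (real n) * (thetahat Y X A bh n \<omega> $ t - \<theta> $ t) - main_term b t n \<omega>\<bar> \<le> \<bar>V n \<omega>\<bar>" by simp
  qed measurable
qed

subsection \<open>The asymptotic variance\<close>

definition E2 :: "((real^'k) \<times> 'z \<times> (real^'p) \<Rightarrow> real) \<Rightarrow> ((real^'k) \<times> 'z \<times> (real^'p) \<Rightarrow> real) \<Rightarrow> real" where
  "E2 f g = EE (\<lambda>x. f x * g x)"

text \<open>With \<open>B2 f g = E[E[f | Z] E[g | Z]]\<close>, the mean conditional covariance given \<open>Z\<close> is \<open>E2 f g - B2 f g\<close>.\<close>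

definition B2 :: "((real^'k) \<times> 'z \<times> (real^'p) \<Rightarrow> real) \<Rightarrow> ((real^'k) \<times> 'z \<times> (real^'p) \<Rightarrow> real) \<Rightarrow> real" where
  "B2 f g = (\<Sum>z\<in>UNIV. pz z * (cmean f z * cmean g z))"

lemma E2_commute: "E2 f g = E2 g f"
  by (simp add: E2_def mult.commute)

lemma B2_commute: "B2 f g = B2 g f"
  by (simp add: B2_def mult.commute)

lemma E2_add_right: "sqint f \<Longrightarrow> sqint g \<Longrightarrow> sqint h \<Longrightarrow> E2 f (\<lambda>x. g x + h x) = E2 f g + E2 f h"
  using sqint_prod[of f g] sqint_prod[of f h] by (simp add: E2_def distrib_left)

lemma E2_diff_right: "sqint f \<Longrightarrow> sqint g \<Longrightarrow> sqint h \<Longrightarrow> E2 f (\<lambda>x. g x - h x) = E2 f g - E2 f h"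
  using sqint_prod[of f g] sqint_prod[of f h] by (simp add: E2_def right_diff_distrib)

lemma E2_cmult_right: "E2 f (\<lambda>x. c * g x) = c * E2 f g"
  by (simp add: E2_def mult.left_commute)

lemma E2_sum_right:
  "finite I \<Longrightarrow> sqint f \<Longrightarrow> (\<And>i. i \<in> I \<Longrightarrow> sqint (g i)) \<Longrightarrow> E2 f (\<lambda>x. \<Sum>i\<in>I. s i * g i x) = (\<Sum>i\<in>I. s i * E2 f (g i))"
proof (induction I rule: finite_induct)
  case empty
  then show ?case by (simp add: E2_def)
next
  case (insert i I)
  then show ?case by (simp add: E2_add_right E2_cmult_right sqint_cmult sqint_sum)
qed

lemma E2_add_left: "sqint f \<Longrightarrow> sqint g \<Longrightarrow> sqint h \<Longrightarrow> E2 (\<lambda>x. g x + h x) f = E2 g f + E2 h f"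
  using E2_add_right[of f g h] by (simp add: E2_commute)

lemma E2_diff_left: "sqint f \<Longrightarrow> sqint g \<Longrightarrow> sqint h \<Longrightarrow> E2 (\<lambda>x. g x - h x) f = E2 g f - E2 h f"
  using E2_diff_right[of f g h] by (simp add: E2_commute)

lemma E2_cmult_left: "E2 (\<lambda>x. c * g x) f = c * E2 g f"
  using E2_cmult_right[of f c g] by (simp add: E2_commute)

lemma E2_sum_left:
  "finite I \<Longrightarrow> sqint f \<Longrightarrow> (\<And>i. i \<in> I \<Longrightarrow> sqint (g i)) \<Longrightarrow> E2 (\<lambda>x. \<Sum>i\<in>I. s i * g i x) f = (\<Sum>i\<in>I. s i * E2 (g i) f)"
  using E2_sum_right[of I f g s] by (simp add: E2_commute)

lemma cmean_add: "sqint f \<Longrightarrow> sqint g \<Longrightarrow> cmean (\<lambda>x. f x + g x) z = cmean f z + cmean g z"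
  unfolding cmean_def
  using integrable_mult_stratum[OF sqint_integrable[of f]] integrable_mult_stratum[OF sqint_integrable[of g]]
  by (simp add: distrib_right add_divide_distrib)

lemma cmean_cmult: "cmean (\<lambda>x. c * f x) z = c * cmean f z"
  by (simp add: cmean_def mult.assoc)

lemma cmean_diff: "sqint f \<Longrightarrow> sqint g \<Longrightarrow> cmean (\<lambda>x. f x - g x) z = cmean f z - cmean g z"
  using cmean_add[of f "\<lambda>x. -1 * g x" z] cmean_cmult[of "-1" g z] sqint_cmult[of g "-1"] by simp

lemma cmean_sum:
  "finite I \<Longrightarrow> (\<And>i. i \<in> I \<Longrightarrow> sqint (f i)) \<Longrightarrow> cmean (\<lambda>x. \<Sum>i\<in>I. s i * f i x) z = (\<Sum>i\<in>I. s i * cmean (f i) z)"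
proof (induction I rule: finite_induct)
  case empty
  then show ?case by (simp add: cmean_def)
next
  case (insert i I)
  then show ?case by (simp add: cmean_add cmean_cmult sqint_cmult sqint_sum)
qed

lemma B2_diff: "sqint f \<Longrightarrow> sqint g \<Longrightarrow> B2 (\<lambda>x. f x - g x) (\<lambda>x. f x - g x) = B2 f f - 2 * B2 f g + B2 g g"
proof -
  assume "sqint f" "sqint g"
  then have "B2 (\<lambda>x. f x - g x) (\<lambda>x. f x - g x) = (\<Sum>z\<in>UNIV. pz z * (cmean f z * cmean f z) - 2 * (pz z * (cmean f z * cmean g z)) + pz z * (cmean g z * cmean g z))"
    unfolding B2_def by (intro sum.cong refl) (simp add: cmean_diff algebra_simps)
  then show ?thesis by (simp add: B2_def sum.distrib sum_subtractf sum_distrib_left)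
qed

lemma E2_resid:
  assumes f: "sqint f" and g: "sqint g"
  shows "E2 (resid f) (resid g) = E2 f g - B2 f g"
proof -
  let ?m = "\<lambda>f x. cmean f (fst (snd x))"
  have m: "sqint (?m f)" for f by (rule sqint_strata)
  have fm: "E2 f (?m g) = B2 f g" if "sqint f" for f g
    using EE_mult_strata[OF that, of "cmean g"] by (simp add: E2_def B2_def)
  have mm: "E2 (?m f) (?m g) = B2 f g"
    using EE_strata[of "\<lambda>z. cmean f z * cmean g z"] by (simp add: E2_def B2_def)
  have "E2 (resid f) (resid g) = E2 (resid f) g - E2 (resid f) (?m g)"
    using E2_diff_right[OF sqint_resid[OF f] g m[of g]] by (simp add: resid_def[abs_def])
  also have "E2 (resid f) g = E2 f g - B2 f g"
    using E2_diff_left[OF g f m[of f]] fm[OF g, of f] by (simp add: resid_def[abs_def] E2_commute B2_commute)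
  also have "E2 (resid f) (?m g) = B2 f g - B2 f g"
    using E2_diff_left[OF m[of g] f m[of f]] fm[OF f, of g] mm by (simp add: resid_def[abs_def])
  finally show ?thesis by simp
qed

lemma resid_sum:
  assumes "finite I" "\<And>i. i \<in> I \<Longrightarrow> sqint (f i)"
  shows "resid (\<lambda>x. \<Sum>i\<in>I. s i * f i x) x = (\<Sum>i\<in>I. s i * resid (f i) x)"
  using cmean_sum[OF assms, where s=s] by (simp add: resid_def right_diff_distrib sum_subtractf)

text \<open>Coefficients of \<open>\<Sum>t. s\<^sub>t * main_term (b t) t\<close> when it is split into a sum over units that is centred given
  strata and arm, a linear function of the imbalances, and a function of the strata.\<close>

definition qf :: "('k \<Rightarrow> real^'p) \<Rightarrow> real^'k \<Rightarrow> 'k \<Rightarrow> (real^'k) \<times> 'z \<times> (real^'p) \<Rightarrow> real" where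
  "qf b s t x = s $ t / pv $ t * resid (rres (b t) t) x + (\<Sum>t'\<in>UNIV. s $ t' * resid (xres (b t')) x)"

definition hf :: "('k \<Rightarrow> real^'p) \<Rightarrow> real^'k \<Rightarrow> real^('z \<times> 'k)" where
  "hf b s = (\<chi> zt. s $ snd zt * pz (fst zt) * cmean (rres (b (snd zt)) (snd zt)) (fst zt) / pv $ snd zt)"

definition gf :: "('k \<Rightarrow> real^'p) \<Rightarrow> real^'k \<Rightarrow> 'z \<Rightarrow> real" where
  "gf b s z = (\<Sum>t\<in>UNIV. s $ t * (cmean (rres (b t) t) z + cmean (xres (b t)) z))"

definition avar :: "('k \<Rightarrow> real^'p) \<Rightarrow> real^'k \<Rightarrow> real" where
  "avar b s = (\<Sum>t\<in>UNIV. pv $ t * EE (\<lambda>x. (qf b s t x)\<^sup>2)) + hf b s \<bullet> (Dm *v hf b s) + EE (\<lambda>x. (gf b s (fst (snd x)))\<^sup>2)"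

lemma sqint_qf: "sqint (qf b s t)"
  unfolding qf_def[abs_def] by (intro sqint_add sqint_cmult sqint_sum sqint_resid sqint_rres sqint_xres) auto

lemma main_term_sum:
  "(\<Sum>t\<in>UNIV. s $ t * main_term (b t) t n \<omega>)
     = (\<Sum>i<n. qf b s (A n i \<omega>) (unit i \<omega>) / sqrt (real n)) + hf b s \<bullet> U n \<omega> + (\<Sum>i<n. gf b s (Z i \<omega>) / sqrt (real n))"
proof -
  let ?r = "\<lambda>t. rres (b t) t" and ?k = "\<lambda>t. xres (b t)" and ?m = "\<lambda>f x. cmean f (fst (snd x))"
  have 1: "(\<Sum>i<n. s $ A n i \<omega> / pv $ A n i \<omega> * resid (?r (A n i \<omega>)) (unit i \<omega>)) / sqrt (real n)
     = (\<Sum>t\<in>UNIV. s $ t / pv $ t * asum n t (resid (?r t)) \<omega>)"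
  proof -
    have "(\<Sum>i<n. s $ A n i \<omega> / pv $ A n i \<omega> * resid (?r (A n i \<omega>)) (unit i \<omega>))
        = (\<Sum>i<n. \<Sum>t\<in>UNIV. if A n i \<omega> = t then s $ t / pv $ t * resid (?r t) (unit i \<omega>) else 0)"
      by (simp add: sum.delta')
    also have "\<dots> = (\<Sum>t\<in>UNIV. \<Sum>i<n. if A n i \<omega> = t then s $ t / pv $ t * resid (?r t) (unit i \<omega>) else 0)"
      by (rule sum.swap)
    finally have "(\<Sum>i<n. s $ A n i \<omega> / pv $ A n i \<omega> * resid (?r (A n i \<omega>)) (unit i \<omega>)) / sqrt (real n)
       = (\<Sum>t\<in>UNIV. asum n t (\<lambda>x. s $ t / pv $ t * resid (?r t) x) \<omega>)"
      by (simp only: asum_def sum_divide_distrib)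
    then show ?thesis by (simp only: asum_cmult)
  qed
  have 2: "(\<Sum>i<n. \<Sum>t\<in>UNIV. s $ t * resid (?k t) (unit i \<omega>)) / sqrt (real n) = (\<Sum>t\<in>UNIV. s $ t * usum n (resid (?k t)) \<omega>)"
    by (subst usum_def[symmetric, where \<xi>="\<lambda>x. \<Sum>t\<in>UNIV. s $ t * resid (?k t) x"]) (simp add: usum_sum usum_cmult)
  have 3: "(\<Sum>i<n. gf b s (Z i \<omega>) / sqrt (real n)) = (\<Sum>t\<in>UNIV. s $ t * (usum n (?m (?r t)) \<omega> + usum n (?m (?k t)) \<omega>))"
  proof -
    have "(\<Sum>i<n. gf b s (Z i \<omega>) / sqrt (real n)) = usum n (\<lambda>x. \<Sum>t\<in>UNIV. s $ t * (?m (?r t) x + ?m (?k t) x)) \<omega>"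
      by (simp add: usum_def gf_def unit_def sum_divide_distrib)
    then show ?thesis by (simp add: usum_sum usum_cmult usum_add)
  qed
  have 4: "hf b s \<bullet> U n \<omega> = (\<Sum>t\<in>UNIV. s $ t / pv $ t * (\<Sum>z\<in>UNIV. pz z * cmean (?r t) z * U n \<omega> $ (z, t)))"
    unfolding inner_vec_def sum_prod_UNIV hf_def
    by (subst sum.swap) (simp add: sum_distrib_left mult_ac)
  have 5: "usum n (?k t) \<omega> = usum n (resid (?k t)) \<omega> + usum n (?m (?k t)) \<omega>" for t
    using usum_add[of n "resid (?k t)" "?m (?k t)" \<omega>] by (simp add: resid_def)
  have "(\<Sum>i<n. qf b s (A n i \<omega>) (unit i \<omega>) / sqrt (real n))
     = (\<Sum>t\<in>UNIV. s $ t / pv $ t * asum n t (resid (?r t)) \<omega>) + (\<Sum>t\<in>UNIV. s $ t * usum n (resid (?k t)) \<omega>)"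
    unfolding 1[symmetric] 2[symmetric] qf_def by (simp add: sum_divide_distrib sum.distrib add_divide_distrib)
  then have "(\<Sum>i<n. qf b s (A n i \<omega>) (unit i \<omega>) / sqrt (real n)) + hf b s \<bullet> U n \<omega> + (\<Sum>i<n. gf b s (Z i \<omega>) / sqrt (real n))
     = (\<Sum>t\<in>UNIV. s $ t / pv $ t * asum n t (resid (?r t)) \<omega> + s $ t * usum n (resid (?k t)) \<omega>
         + s $ t / pv $ t * (\<Sum>z\<in>UNIV. pz z * cmean (?r t) z * U n \<omega> $ (z, t)) + s $ t * (usum n (?m (?r t)) \<omega> + usum n (?m (?k t)) \<omega>))"
    unfolding 3 4 by (simp only: sum.distrib)
  also have "\<dots> = (\<Sum>t\<in>UNIV. s $ t * main_term (b t) t n \<omega>)"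
    unfolding main_term_def 5 by (intro sum.cong refl) (simp add: algebra_simps add_divide_distrib)
  finally show ?thesis by simp
qed

theorem char_thetahat:
  assumes bm[measurable]: "\<And>n t. bh n t \<in> borel_measurable M"
    and bconv: "\<And>t \<epsilon>. 0 < \<epsilon> \<Longrightarrow> (\<lambda>n. prob {\<omega>\<in>space M. \<epsilon> < dist (bh n t \<omega>) (b t)}) \<longlonglongrightarrow> 0"
  shows "(\<lambda>n. \<integral>\<omega>. iexp (s \<bullet> (sqrt (real n) *\<^sub>R (thetahat Y X A bh n \<omega> - \<theta>))) \<partial>M)
     \<longlonglongrightarrow> complex_of_real (exp (- avar b s / 2))"
proof -
  define T where "T n \<omega> = s \<bullet> (sqrt (real n) *\<^sub>R (thetahat Y X A bh n \<omega> - \<theta>))" for n \<omega>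
  define W where "W n \<omega> = (\<Sum>t\<in>UNIV. s $ t * main_term (b t) t n \<omega>)" for n \<omega>
  have [measurable]: "T n \<in> borel_measurable M" for n
    unfolding T_def using measurable_thetahat[of bh n, OF bm] by measurable
  have [measurable]: "W n \<in> borel_measurable M" for n unfolding W_def by measurable
  have "null_in_prob (\<lambda>n \<omega>. \<Sum>t\<in>UNIV. s $ t * (sqrt (real n) * (thetahat Y X A bh n \<omega> $ t - \<theta> $ t) - main_term (b t) t n \<omega>))"
    by (intro null_in_prob_sum null_in_prob_cmult null_in_prob_main_term bm bconv) auto
  moreover have "(\<Sum>t\<in>UNIV. s $ t * (sqrt (real n) * (thetahat Y X A bh n \<omega> $ t - \<theta> $ t) - main_term (b t) t n \<omega>)) = T n \<omega> - W n \<omega>" for n \<omega>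
    by (simp add: T_def W_def inner_vec_def sum_subtractf[symmetric] right_diff_distrib)
  ultimately have null: "null_in_prob (\<lambda>n \<omega>. T n \<omega> - W n \<omega>)" by simp
  have g0: "EE (\<lambda>x. gf b s (fst (snd x))) = 0"
  proof -
    have "EE (\<lambda>x. gf b s (fst (snd x))) = (\<Sum>t\<in>UNIV. s $ t * (EE (\<lambda>x. cmean (rres (b t) t) (fst (snd x))) + EE (\<lambda>x. cmean (xres (b t)) (fst (snd x)))))"
      unfolding gf_def using sqint_integrable[OF sqint_strata]
      by (subst Bochner_Integration.integral_sum) (auto intro!: Bochner_Integration.integrable_add integrable_mult_right)
    then show ?thesis by (simp add: EE_cmean sqint_rres sqint_xres EE_rres EE_xres)
  qed
  have q0: "(\<integral>\<omega>. qf b s t (unit 0 \<omega>) * indicator {\<omega>\<in>space M. Z 0 \<omega> = z} \<omega> \<partial>M) = 0" for t z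
  proof -
    have r: "cmean (resid f) z = 0" if "sqint f" for f using integral_resid_stratum[OF that, of z] by (simp add: cmean_def)
    have "cmean (qf b s t) z = s $ t / pv $ t * cmean (resid (rres (b t) t)) z + (\<Sum>t'\<in>UNIV. s $ t' * cmean (resid (xres (b t'))) z)"
    proof -
      have a: "sqint (\<lambda>x. s $ t / pv $ t * resid (rres (b t) t) x)" and k: "sqint (\<lambda>x. \<Sum>t'\<in>UNIV. s $ t' * resid (xres (b t')) x)"
        by (intro sqint_cmult sqint_sum sqint_resid sqint_rres sqint_xres finite)+
      show ?thesis
        unfolding qf_def[abs_def] cmean_add[OF a k] cmean_cmult
        by (subst cmean_sum) (auto intro: sqint_resid sqint_xres)
    qed
    then have "cmean (qf b s t) z = 0" by (simp add: r sqint_rres sqint_xres)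
    then show ?thesis using pz_pos[of z] by (simp add: cmean_def)
  qed
  have "(\<lambda>n. \<integral>\<omega>. iexp (W n \<omega>) \<partial>M) \<longlonglongrightarrow> complex_of_real (exp (- avar b s / 2))"
    unfolding W_def main_term_sum avar_def by (rule char_main[OF sqint_qf q0 g0])
  moreover have "(\<lambda>n. (\<integral>\<omega>. iexp (T n \<omega>) \<partial>M) - (\<integral>\<omega>. iexp (W n \<omega>) \<partial>M)) \<longlonglongrightarrow> 0"
    by (rule char_diff_tendsto_zero[OF _ _ null]) auto
  ultimately have "(\<lambda>n. ((\<integral>\<omega>. iexp (T n \<omega>) \<partial>M) - (\<integral>\<omega>. iexp (W n \<omega>) \<partial>M)) + (\<integral>\<omega>. iexp (W n \<omega>) \<partial>M)) \<longlonglongrightarrow> 0 + complex_of_real (exp (- avar b s / 2))"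
    by (intro tendsto_add)
  then show ?thesis by (simp add: T_def)
qed

abbreviation "SX \<equiv> SigmaX M (X 0)"
abbreviation "\<beta>M \<equiv> betaM M (Y 0) (X 0)"

lemma xres_sum_fun: "xres b = (\<lambda>x. \<Sum>j\<in>UNIV. b $ j * xres (axis j 1) x)"
  using xres_sum by blast

lemma xres_diff: "xres (b - c) x = xres b x - xres c x"
  by (simp add: xres_def inner_diff_left)

lemma SigmaX_form: "u \<bullet> (SX *v w) = E2 (xres u) (xres w)"
proof -
  have S: "SX $ i $ j = E2 (xres (axis i 1)) (xres (axis j 1))" for i j
    by (simp add: SigmaX_def E2_def xres_axis unit_def)
  have "E2 (xres u) (xres w) = (\<Sum>j\<in>UNIV. w $ j * E2 (xres u) (xres (axis j 1)))"
    by (subst xres_sum_fun[of w]) (rule E2_sum_right, auto intro: sqint_xres)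
  also have "\<dots> = (\<Sum>j\<in>UNIV. w $ j * (\<Sum>i\<in>UNIV. u $ i * SX $ i $ j))"
  proof (intro sum.cong refl arg_cong2[where f="(*)"])
    fix j
    show "E2 (xres u) (xres (axis j 1)) = (\<Sum>i\<in>UNIV. u $ i * SX $ i $ j)"
      unfolding S by (subst xres_sum_fun[of u]) (rule E2_sum_left, auto intro: sqint_xres)
  qed
  also have "\<dots> = u \<bullet> (SX *v w)"
    unfolding inner_matrix_vector by (subst sum.swap) (simp add: sum_distrib_left mult_ac)
  finally show ?thesis by simp
qed

lemma covXY_form: "u \<bullet> covXY M (Y 0) (X 0) t = E2 (xres u) (yres t)"
proof -
  have "E2 (xres u) (yres t) = (\<Sum>i\<in>UNIV. u $ i * E2 (xres (axis i 1)) (yres t))"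
    by (subst xres_sum_fun[of u]) (rule E2_sum_left, auto intro: sqint_xres sqint_yres)
  then show ?thesis
    by (simp add: inner_vec_def covXY_def E2_def xres_axis yres_def unit_def)
qed

lemma SigmaX_beta:
  assumes "posdef SX"
  shows "SX *v col \<beta>M t = covXY M (Y 0) (X 0) t"
proof -
  have "col \<beta>M t = matrix_inv SX *v covXY M (Y 0) (X 0) t"
    by (simp add: col_def betaM_def vec_eq_iff)
  then show ?thesis using matrix_vector_mult_matrix_inv[OF assms] by simp
qed

lemma E2_xres_beta:
  assumes "posdef SX"
  shows "E2 (xres u) (xres (col \<beta>M t)) = E2 (xres u) (yres t)"
  unfolding SigmaX_form[symmetric] SigmaX_beta[OF assms] by (rule covXY_form)

lemma E2_beta_resid:
  assumes "posdef SX"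
  shows "E2 (xres u) (rres (col \<beta>M t) t) = 0"
  unfolding rres_def[abs_def] using E2_xres_beta[OF assms, of u t]
  by (simp add: E2_diff_right sqint_xres sqint_yres)

lemma Rm_eq: "Rm M (Y 0) (X 0) (Z 0) pv B z = diagm (\<lambda>t. cmean (rres (col B t) t) z / pv $ t)"
  by (simp add: Rm_def cmean_def rres_def yres_def xres_def unit_def pz_def)

lemma variance_rres:
  "(\<integral>\<omega>. (Y 0 \<omega> $ t - b \<bullet> X 0 \<omega> - (\<integral>\<omega>'. Y 0 \<omega>' $ t - b \<bullet> X 0 \<omega>' \<partial>M))\<^sup>2 \<partial>M) = E2 (rres b t) (rres b t)"
proof -
  have eq: "Y 0 \<omega> $ t - b \<bullet> X 0 \<omega> = rres b t (unit 0 \<omega>) + (\<theta> $ t - b \<bullet> \<mu>)" for \<omega>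
    by (simp add: rres_def yres_def xres_def unit_def inner_diff_right)
  have "(\<integral>\<omega>'. Y 0 \<omega>' $ t - b \<bullet> X 0 \<omega>' \<partial>M) = \<theta> $ t - b \<bullet> \<mu>"
    unfolding eq using sqint_integrable[OF sqint_rres[of b t]] by (simp add: EE_rres prob_space)
  then show ?thesis by (simp add: eq E2_def power2_eq_square)
qed

lemma Vm_entry:
  "Vm M (Y 0) (X 0) (Z 0) pv Om B $ i $ j
    = (if i = j then E2 (rres (col B i) i) (rres (col B i) i) / pv $ i else 0)
      + E2 (xres (col \<beta>M i)) (xres (col B j)) + E2 (xres (col B i)) (xres (col \<beta>M j)) - E2 (xres (col B i)) (xres (col B j))
      - (\<Sum>z\<in>UNIV. pz z * (cmean (rres (col B i) i) z / pv $ i * ((if i = j then pv $ i else 0) - pv $ i * pv $ j - Om z $ i $ j)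
            * (cmean (rres (col B j) j) z / pv $ j)))"
  unfolding Vm_def V_SR_def
  by (simp add: variance_rres transpose_mult_mult_entry SigmaX_form Rm_eq diagm_mult_diagm Omega_SR_def pz_def[symmetric])
     (simp add: diagm_def)

lemma Om_sym: "Om z $ i $ j = Om z $ j $ i"
proof -
  have "Dm $ (z, i) $ (z, j) = Dm $ (z, j) $ (z, i)"
    using psd_Dm by (simp add: psd_def transpose_def vec_eq_iff)
  then show ?thesis using pz_pos[of z] by (simp add: Dm_def)
qed

lemma Vm_sym: "Vm M (Y 0) (X 0) (Z 0) pv Om B $ i $ j = Vm M (Y 0) (X 0) (Z 0) pv Om B $ j $ i"
  unfolding Vm_entry[of B i j] Vm_entry[of B j i]
  by (simp add: E2_commute[of "xres (col \<beta>M j)"] E2_commute[of "xres (col B j)" "xres (col B i)"] E2_commute[of "xres (col B j)" "xres (col \<beta>M i)"] Om_sym[of _ j i] mult_ac)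

definition omq :: "('k \<Rightarrow> real^'p) \<Rightarrow> real^'k \<Rightarrow> real" where
  "omq b s = hf b s \<bullet> (Dm *v hf b s)"

lemma omq_nonneg: "0 \<le> omq b s"
  using psd_Dm by (simp add: omq_def psd_def)

lemma omq_eq:
  "omq b s = (\<Sum>z\<in>UNIV. pz z * (\<Sum>i\<in>UNIV. \<Sum>j\<in>UNIV. s $ i * s $ j *
      (cmean (rres (b i) i) z / pv $ i * Om z $ i $ j * (cmean (rres (b j) j) z / pv $ j))))"
proof -
  have "omq b s = (\<Sum>z\<in>UNIV. \<Sum>i\<in>UNIV. \<Sum>z'\<in>UNIV. \<Sum>j\<in>UNIV. hf b s $ (z, i) * hf b s $ (z', j) * Dm $ (z, i) $ (z', j))"
    unfolding omq_def inner_matrix_vector sum_prod_UNIV ..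
  also have "\<dots> = (\<Sum>z\<in>UNIV. \<Sum>i\<in>UNIV. \<Sum>j\<in>UNIV. hf b s $ (z, i) * hf b s $ (z, j) * (Om z $ i $ j / pz z))"
  proof (intro sum.cong refl)
    fix z i
    have "(\<Sum>z'\<in>UNIV. \<Sum>j\<in>UNIV. hf b s $ (z, i) * hf b s $ (z', j) * Dm $ (z, i) $ (z', j))
       = (\<Sum>z'\<in>UNIV. if z' = z then (\<Sum>j\<in>UNIV. hf b s $ (z, i) * hf b s $ (z, j) * (Om z $ i $ j / pz z)) else 0)"
      by (intro sum.cong refl) (auto simp: Dm_def)
    then show "(\<Sum>z'\<in>UNIV. \<Sum>j\<in>UNIV. hf b s $ (z, i) * hf b s $ (z', j) * Dm $ (z, i) $ (z', j))
       = (\<Sum>j\<in>UNIV. hf b s $ (z, i) * hf b s $ (z, j) * (Om z $ i $ j / pz z))"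
      by (simp add: sum.delta)
  qed
  also have "\<dots> = (\<Sum>z\<in>UNIV. pz z * (\<Sum>i\<in>UNIV. \<Sum>j\<in>UNIV. s $ i * s $ j *
      (cmean (rres (b i) i) z / pv $ i * Om z $ i $ j * (cmean (rres (b j) j) z / pv $ j))))"
  proof -
    have "hf b s $ (z, i) * hf b s $ (z, j) * (Om z $ i $ j / pz z)
       = pz z * (s $ i * s $ j * (cmean (rres (b i) i) z / pv $ i * Om z $ i $ j * (cmean (rres (b j) j) z / pv $ j)))" for z i j
      using pz_pos[of z] pi_pos[of i] pi_pos[of j] by (simp add: hf_def field_simps)
    then show ?thesis by (simp only: sum_distrib_left)
  qed
  finally show ?thesis .
qed

definition Kf :: "('k \<Rightarrow> real^'p) \<Rightarrow> real^'k \<Rightarrow> (real^'k) \<times> 'z \<times> (real^'p) \<Rightarrow> real" where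
  "Kf b s x = (\<Sum>t\<in>UNIV. s $ t * xres (b t) x)"

definition Lf :: "real^'k \<Rightarrow> (real^'k) \<times> 'z \<times> (real^'p) \<Rightarrow> real" where
  "Lf s x = (\<Sum>t\<in>UNIV. s $ t * yres t x)"

definition rf :: "('k \<Rightarrow> real^'p) \<Rightarrow> real^'k \<Rightarrow> (real^'k) \<times> 'z \<times> (real^'p) \<Rightarrow> real" where
  "rf b s x = (\<Sum>t\<in>UNIV. s $ t * rres (b t) t x)"

lemma rf_eq: "rf b s = (\<lambda>x. Lf s x - Kf b s x)"
  by (auto simp: fun_eq_iff rf_def Lf_def Kf_def rres_def right_diff_distrib sum_subtractf)

lemma sqint_Kf: "sqint (Kf b s)"
  unfolding Kf_def[abs_def] by (intro sqint_sum sqint_cmult sqint_xres) auto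

lemma sqint_Lf: "sqint (Lf s)"
  unfolding Lf_def[abs_def] by (intro sqint_sum sqint_cmult sqint_yres) auto

lemma sqint_rf: "sqint (rf b s)"
  unfolding rf_def[abs_def] by (intro sqint_sum sqint_cmult sqint_rres) auto

lemma cmean_rf: "cmean (rf b s) z = (\<Sum>t\<in>UNIV. s $ t * cmean (rres (b t) t) z)"
  unfolding rf_def[abs_def] by (intro cmean_sum sqint_rres) auto

lemma E2_Kf: "E2 (Kf b s) (Kf c s) = (\<Sum>i\<in>UNIV. \<Sum>j\<in>UNIV. s $ i * s $ j * E2 (xres (b i)) (xres (c j)))"
proof -
  have "E2 (Kf b s) (Kf c s) = (\<Sum>i\<in>UNIV. s $ i * E2 (xres (b i)) (Kf c s))"
    unfolding Kf_def[of b, abs_def] by (rule E2_sum_left) (auto intro: sqint_Kf sqint_xres)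
  also have "\<dots> = (\<Sum>i\<in>UNIV. s $ i * (\<Sum>j\<in>UNIV. s $ j * E2 (xres (b i)) (xres (c j))))"
  proof (intro sum.cong refl arg_cong2[where f="(*)"])
    fix i show "E2 (xres (b i)) (Kf c s) = (\<Sum>j\<in>UNIV. s $ j * E2 (xres (b i)) (xres (c j)))"
      unfolding Kf_def[abs_def] by (rule E2_sum_right) (auto intro: sqint_xres)
  qed
  finally show ?thesis by (simp add: sum_distrib_left mult.assoc)
qed

lemma E2_Kf_beta:
  assumes "posdef SX"
  shows "E2 (Kf b s) (Kf (col \<beta>M) s) = E2 (Kf b s) (Lf s)"
proof -
  have *: "E2 (xres u) (Kf (col \<beta>M) s) = E2 (xres u) (Lf s)" for u
  proof -
    have "E2 (xres u) (Kf (col \<beta>M) s) = (\<Sum>t\<in>UNIV. s $ t * E2 (xres u) (xres (col \<beta>M t)))"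
      unfolding Kf_def[abs_def] by (rule E2_sum_right) (auto intro: sqint_xres)
    moreover have "E2 (xres u) (Lf s) = (\<Sum>t\<in>UNIV. s $ t * E2 (xres u) (yres t))"
      unfolding Lf_def[abs_def] by (rule E2_sum_right) (auto intro: sqint_xres sqint_yres)
    ultimately show ?thesis by (simp add: E2_xres_beta[OF assms])
  qed
  have "E2 (Kf b s) f = (\<Sum>t\<in>UNIV. s $ t * E2 (xres (b t)) f)" if "sqint f" for f
    unfolding Kf_def[abs_def] by (rule E2_sum_left) (auto intro: sqint_xres that)
  then show ?thesis by (simp add: sqint_Kf sqint_Lf *)
qed

definition dq :: "('k \<Rightarrow> real^'p) \<Rightarrow> real^'k \<Rightarrow> real" where
  "dq b s = (\<Sum>t\<in>UNIV. (s $ t)\<^sup>2 / pv $ t * (E2 (rres (b t) t) (rres (b t) t) - B2 (rres (b t) t) (rres (b t) t)))"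

lemma Vm_form:
  "s \<bullet> (Vm M (Y 0) (X 0) (Z 0) pv Om B *v s)
    = dq (col B) s + 2 * E2 (Kf (col B) s) (Kf (col \<beta>M) s) - E2 (Kf (col B) s) (Kf (col B) s)
      + B2 (rf (col B) s) (rf (col B) s) + omq (col B) s"
proof -
  let ?b = "col B"
  let ?r = "\<lambda>t. rres (?b t) t"
  define m where "m t z = cmean (?r t) z" for t z
  have diag: "(\<Sum>i\<in>UNIV. \<Sum>j\<in>UNIV. s $ i * s $ j * (if i = j then a i else 0)) = (\<Sum>i\<in>UNIV. (s $ i)\<^sup>2 * a i)" for a
  proof (intro sum.cong refl)
    fix i
    have "(\<Sum>j\<in>UNIV. s $ i * s $ j * (if i = j then a i else 0)) = (\<Sum>j\<in>UNIV. if j = i then s $ i * s $ i * a i else 0)"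
      by (intro sum.cong) auto
    then show "(\<Sum>j\<in>UNIV. s $ i * s $ j * (if i = j then a i else 0)) = (s $ i)\<^sup>2 * a i"
      by (simp add: sum.delta power2_eq_square)
  qed
  have zpart: "(\<Sum>i\<in>UNIV. \<Sum>j\<in>UNIV. s $ i * s $ j * (\<Sum>z\<in>UNIV. pz z * (m i z / pv $ i * ((if i = j then pv $ i else 0) - pv $ i * pv $ j - Om z $ i $ j) * (m j z / pv $ j))))
      = (\<Sum>t\<in>UNIV. (s $ t)\<^sup>2 / pv $ t * B2 (?r t) (?r t)) - B2 (rf ?b s) (rf ?b s) - omq ?b s"
  proof -
    have "(\<Sum>i\<in>UNIV. \<Sum>j\<in>UNIV. s $ i * s $ j * (\<Sum>z\<in>UNIV. pz z * (m i z / pv $ i * ((if i = j then pv $ i else 0) - pv $ i * pv $ j - Om z $ i $ j) * (m j z / pv $ j))))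
       = (\<Sum>i\<in>UNIV. \<Sum>j\<in>UNIV. \<Sum>z\<in>UNIV. s $ i * s $ j * (if i = j then pz z * ((m i z)\<^sup>2 / pv $ i) else 0)
           - pz z * ((s $ i * m i z) * (s $ j * m j z)) - pz z * (s $ i * s $ j * (m i z / pv $ i * Om z $ i $ j * (m j z / pv $ j))))"
      unfolding sum_distrib_left
    proof (intro sum.cong refl)
      fix i j z
      show "s $ i * s $ j * (pz z * (m i z / pv $ i * ((if i = j then pv $ i else 0) - pv $ i * pv $ j - Om z $ i $ j) * (m j z / pv $ j)))
        = s $ i * s $ j * (if i = j then pz z * ((m i z)\<^sup>2 / pv $ i) else 0)
           - pz z * ((s $ i * m i z) * (s $ j * m j z)) - pz z * (s $ i * s $ j * (m i z / pv $ i * Om z $ i $ j * (m j z / pv $ j)))"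
        using pi_pos[of i] pi_pos[of j] by (cases "i = j") (simp_all add: field_simps power2_eq_square)
    qed
    also have "\<dots> = (\<Sum>z\<in>UNIV. \<Sum>i\<in>UNIV. \<Sum>j\<in>UNIV. s $ i * s $ j * (if i = j then pz z * ((m i z)\<^sup>2 / pv $ i) else 0)
           - pz z * ((s $ i * m i z) * (s $ j * m j z)) - pz z * (s $ i * s $ j * (m i z / pv $ i * Om z $ i $ j * (m j z / pv $ j))))"
      (is "(\<Sum>i\<in>UNIV. \<Sum>j\<in>UNIV. \<Sum>z\<in>UNIV. ?F i j z) = _")
    proof -
      have "(\<Sum>i\<in>UNIV. \<Sum>j\<in>UNIV. \<Sum>z\<in>UNIV. ?F i j z) = (\<Sum>i\<in>UNIV. \<Sum>z\<in>UNIV. \<Sum>j\<in>UNIV. ?F i j z)"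
        by (intro sum.cong refl sum.swap)
      also have "\<dots> = (\<Sum>z\<in>UNIV. \<Sum>i\<in>UNIV. \<Sum>j\<in>UNIV. ?F i j z)" by (rule sum.swap)
      finally show ?thesis .
    qed
    also have "\<dots> = (\<Sum>z\<in>UNIV. \<Sum>i\<in>UNIV. (s $ i)\<^sup>2 * (pz z * ((m i z)\<^sup>2 / pv $ i)))
         - (\<Sum>z\<in>UNIV. pz z * ((\<Sum>i\<in>UNIV. s $ i * m i z) * (\<Sum>j\<in>UNIV. s $ j * m j z)))
         - (\<Sum>z\<in>UNIV. pz z * (\<Sum>i\<in>UNIV. \<Sum>j\<in>UNIV. s $ i * s $ j * (m i z / pv $ i * Om z $ i $ j * (m j z / pv $ j))))"
      unfolding sum_product by (simp only: sum_subtractf diag sum_distrib_left)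
    also have "(\<Sum>z\<in>UNIV. \<Sum>i\<in>UNIV. (s $ i)\<^sup>2 * (pz z * ((m i z)\<^sup>2 / pv $ i))) = (\<Sum>t\<in>UNIV. (s $ t)\<^sup>2 / pv $ t * B2 (?r t) (?r t))"
      by (subst sum.swap) (simp add: B2_def m_def sum_distrib_left power2_eq_square mult_ac)
    also have "(\<Sum>z\<in>UNIV. pz z * ((\<Sum>i\<in>UNIV. s $ i * m i z) * (\<Sum>j\<in>UNIV. s $ j * m j z))) = B2 (rf ?b s) (rf ?b s)"
      by (simp add: B2_def cmean_rf m_def)
    finally show ?thesis by (simp only: omq_eq m_def)
  qed
  have "s \<bullet> (Vm M (Y 0) (X 0) (Z 0) pv Om B *v s)
     = (\<Sum>i\<in>UNIV. \<Sum>j\<in>UNIV. s $ i * s $ j * (if i = j then E2 (?r i) (?r i) / pv $ i else 0)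
        + s $ i * s $ j * E2 (xres (col \<beta>M i)) (xres (?b j)) + s $ i * s $ j * E2 (xres (?b i)) (xres (col \<beta>M j))
        - s $ i * s $ j * E2 (xres (?b i)) (xres (?b j))
        - s $ i * s $ j * (\<Sum>z\<in>UNIV. pz z * (m i z / pv $ i * ((if i = j then pv $ i else 0) - pv $ i * pv $ j - Om z $ i $ j) * (m j z / pv $ j))))"
    unfolding inner_matrix_vector Vm_entry m_def
    by (intro sum.cong refl) (simp only: distrib_left right_diff_distrib)
  also have "\<dots> = (\<Sum>i\<in>UNIV. (s $ i)\<^sup>2 * (E2 (?r i) (?r i) / pv $ i)) + E2 (Kf (col \<beta>M) s) (Kf ?b s) + E2 (Kf ?b s) (Kf (col \<beta>M) s)
      - E2 (Kf ?b s) (Kf ?b s) - ((\<Sum>t\<in>UNIV. (s $ t)\<^sup>2 / pv $ t * B2 (?r t) (?r t)) - B2 (rf ?b s) (rf ?b s) - omq ?b s)"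
    by (simp only: sum.distrib sum_subtractf diag zpart E2_Kf)
  also have "\<dots> = dq ?b s + 2 * E2 (Kf ?b s) (Kf (col \<beta>M) s) - E2 (Kf ?b s) (Kf ?b s) + B2 (rf ?b s) (rf ?b s) + omq ?b s"
    by (simp add: dq_def E2_commute[of "Kf (col \<beta>M) s"] right_diff_distrib sum_subtractf)
  finally show ?thesis .
qed

lemma avar_eq:
  "avar b s = dq b s + 2 * E2 (Kf b s) (Lf s) - E2 (Kf b s) (Kf b s) + B2 (rf b s) (rf b s) + omq b s"
proof -
  let ?r = "\<lambda>t. rres (b t) t"
  define w where "w = resid (Kf b s)"
  define \<rho> where "\<rho> = resid (rf b s)"
  have w: "sqint w" "sqint \<rho>" by (auto simp: w_def \<rho>_def intro: sqint_resid sqint_Kf sqint_rf)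
  have w_eq: "(\<Sum>t\<in>UNIV. s $ t * resid (xres (b t)) x) = w x" for x
    unfolding w_def Kf_def[abs_def] by (rule resid_sum[symmetric]) (auto intro: sqint_xres)
  have \<rho>_eq: "\<rho> = (\<lambda>x. \<Sum>t\<in>UNIV. s $ t * resid (?r t) x)"
    unfolding \<rho>_def rf_def[abs_def] by (rule ext, rule resid_sum) (auto intro: sqint_rres)
  have sr: "sqint (resid (?r t))" for t by (intro sqint_resid sqint_rres)
  have q: "EE (\<lambda>x. (qf b s t x)\<^sup>2) = (s $ t / pv $ t)\<^sup>2 * E2 (resid (?r t)) (resid (?r t)) + 2 * (s $ t / pv $ t) * E2 (resid (?r t)) w + E2 w w" for t
  proof -
    let ?a = "s $ t / pv $ t"
    have sa: "sqint (\<lambda>x. ?a * resid (?r t) x)" by (intro sqint_cmult sr)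
    have "EE (\<lambda>x. (qf b s t x)\<^sup>2) = E2 (\<lambda>x. ?a * resid (?r t) x + w x) (\<lambda>x. ?a * resid (?r t) x + w x)"
      unfolding E2_def qf_def w_eq by (simp add: power2_eq_square)
    also have "\<dots> = E2 (\<lambda>x. ?a * resid (?r t) x) (\<lambda>x. ?a * resid (?r t) x) + E2 w (\<lambda>x. ?a * resid (?r t) x)
        + (E2 (\<lambda>x. ?a * resid (?r t) x) w + E2 w w)"
      by (simp only: E2_add_right[OF sqint_add[OF sa w(1)] sa w(1)] E2_add_left[OF sa sa w(1)] E2_add_left[OF w(1) sa w(1)])
    also have "\<dots> = ?a\<^sup>2 * E2 (resid (?r t)) (resid (?r t)) + 2 * ?a * E2 (resid (?r t)) w + E2 w w"
      unfolding E2_cmult_left E2_cmult_right E2_commute[of w "resid (?r t)"] by (simp add: power2_eq_square)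
    finally show ?thesis .
  qed
  have "(\<Sum>t\<in>UNIV. pv $ t * EE (\<lambda>x. (qf b s t x)\<^sup>2))
     = (\<Sum>t\<in>UNIV. (s $ t)\<^sup>2 / pv $ t * E2 (resid (?r t)) (resid (?r t)) + 2 * (s $ t * E2 (resid (?r t)) w) + pv $ t * E2 w w)"
    unfolding q
  proof (intro sum.cong refl)
    fix t
    show "pv $ t * ((s $ t / pv $ t)\<^sup>2 * E2 (resid (?r t)) (resid (?r t)) + 2 * (s $ t / pv $ t) * E2 (resid (?r t)) w + E2 w w)
       = (s $ t)\<^sup>2 / pv $ t * E2 (resid (?r t)) (resid (?r t)) + 2 * (s $ t * E2 (resid (?r t)) w) + pv $ t * E2 w w"
      using pi_pos[of t] by (simp add: power2_eq_square field_simps)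
  qed
  also have "\<dots> = dq b s + 2 * E2 \<rho> w + E2 w w"
  proof -
    have "E2 \<rho> w = (\<Sum>t\<in>UNIV. s $ t * E2 (resid (?r t)) w)"
      unfolding \<rho>_eq by (rule E2_sum_left) (auto intro: w sr)
    then show ?thesis
      using pi_sum by (simp add: sum.distrib dq_def E2_resid sqint_rres sum_distrib_left[symmetric] sum_distrib_right[symmetric])
  qed
  also have "E2 \<rho> w = E2 (rf b s) (Kf b s) - B2 (rf b s) (Kf b s)"
    unfolding \<rho>_def w_def by (rule E2_resid[OF sqint_rf sqint_Kf])
  also have "E2 w w = E2 (Kf b s) (Kf b s) - B2 (Kf b s) (Kf b s)"
    unfolding w_def by (rule E2_resid[OF sqint_Kf sqint_Kf])
  also have "E2 (rf b s) (Kf b s) = E2 (Kf b s) (Lf s) - E2 (Kf b s) (Kf b s)"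
    unfolding rf_eq E2_commute[of "\<lambda>x. Lf s x - Kf b s x"] by (simp add: E2_diff_right sqint_Kf sqint_Lf)
  also have "B2 (rf b s) (Kf b s) = B2 (Lf s) (Kf b s) - B2 (Kf b s) (Kf b s)"
    unfolding rf_eq B2_def by (simp add: cmean_diff sqint_Kf sqint_Lf algebra_simps sum_subtractf)
  finally have 1: "(\<Sum>t\<in>UNIV. pv $ t * EE (\<lambda>x. (qf b s t x)\<^sup>2)) = dq b s
      + 2 * (E2 (Kf b s) (Lf s) - E2 (Kf b s) (Kf b s) - (B2 (Lf s) (Kf b s) - B2 (Kf b s) (Kf b s)))
      + (E2 (Kf b s) (Kf b s) - B2 (Kf b s) (Kf b s))" .
  have "gf b s z = cmean (Lf s) z" for z
  proof -
    have "cmean (rres (b t) t) z + cmean (xres (b t)) z = cmean (yres t) z" for t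
      by (simp add: rres_def[abs_def] cmean_diff sqint_yres sqint_xres)
    then show ?thesis unfolding gf_def Lf_def[abs_def] by (simp add: cmean_sum sqint_yres)
  qed
  then have 2: "EE (\<lambda>x. (gf b s (fst (snd x)))\<^sup>2) = B2 (Lf s) (Lf s)"
    using EE_strata[of "\<lambda>z. (cmean (Lf s) z)\<^sup>2"] by (simp add: B2_def power2_eq_square)
  have 3: "B2 (rf b s) (rf b s) = B2 (Lf s) (Lf s) - 2 * B2 (Lf s) (Kf b s) + B2 (Kf b s) (Kf b s)"
    unfolding rf_eq by (rule B2_diff[OF sqint_Lf sqint_Kf])
  show ?thesis unfolding avar_def omq_def[symmetric] 1 2 3 by simp
qed

lemma Vm_form_avar:
  assumes "posdef SX"
  shows "s \<bullet> (Vm M (Y 0) (X 0) (Z 0) pv Om B *v s) = avar (col B) s"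
  unfolding Vm_form avar_eq E2_Kf_beta[OF assms] ..

lemma avar_nonneg: "0 \<le> avar b s"
  unfolding avar_def using pi_pos psd_Dm
  by (intro add_nonneg_nonneg sum_nonneg mult_nonneg_nonneg) (auto simp: less_imp_le psd_def)

lemma psd_Vm:
  assumes "posdef SX"
  shows "psd (Vm M (Y 0) (X 0) (Z 0) pv Om B)"
  by (rule psdI[OF Vm_sym]) (simp add: Vm_form_avar[OF assms] avar_nonneg)

lemma cmean_beta_zero:
  assumes pd: "posdef SX"
    and aff: "\<exists>c d. AE \<omega> in M. (if Z 0 \<omega> = z then 1 else 0) = c + d \<bullet> X 0 \<omega>"
  shows "cmean (rres (col \<beta>M t) t) z = 0"
proof -
  let ?r = "rres (col \<beta>M t) t"
  obtain c d where cd: "AE \<omega> in M. (if Z 0 \<omega> = z then 1 else 0) = c + d \<bullet> X 0 \<omega>" using aff by blast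
  note [measurable] = sqint_measurable[OF sqint_rres[of "col \<beta>M t" t]]
  have "(\<integral>\<omega>. ?r (unit 0 \<omega>) * indicator {\<omega>\<in>space M. Z 0 \<omega> = z} \<omega> \<partial>M)
     = (\<integral>\<omega>. (c + d \<bullet> \<mu>) * ?r (unit 0 \<omega>) + xres d (unit 0 \<omega>) * ?r (unit 0 \<omega>) \<partial>M)"
  proof (rule integral_cong_AE)
    show "(\<lambda>\<omega>. (c + d \<bullet> \<mu>) * ?r (unit 0 \<omega>) + xres d (unit 0 \<omega>) * ?r (unit 0 \<omega>)) \<in> borel_measurable M"
      using sqint_measurable[OF sqint_xres[of d]] by measurable
    show "AE \<omega> in M. ?r (unit 0 \<omega>) * indicator {\<omega>\<in>space M. Z 0 \<omega> = z} \<omega>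
        = (c + d \<bullet> \<mu>) * ?r (unit 0 \<omega>) + xres d (unit 0 \<omega>) * ?r (unit 0 \<omega>)"
      using cd AE_space
    proof eventually_elim
      case (elim \<omega>)
      have "indicator {\<omega>\<in>space M. Z 0 \<omega> = z} \<omega> = c + d \<bullet> X 0 \<omega>"
        using elim by (auto simp: indicator_def split: if_splits)
      also have "\<dots> = (c + d \<bullet> \<mu>) + xres d (unit 0 \<omega>)" by (simp add: xres_def unit_def inner_diff_right)
      finally show ?case by (simp add: algebra_simps)
    qed
  qed measurable
  also have "\<dots> = (c + d \<bullet> \<mu>) * EE ?r + E2 (xres d) ?r"
    using sqint_integrable[OF sqint_rres] sqint_prod[OF sqint_xres sqint_rres] by (simp add: E2_def)
  also have "\<dots> = 0" by (simp add: EE_rres E2_beta_resid[OF pd])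
  finally show ?thesis by (simp add: cmean_def)
qed

lemma psd_Vm_diff:
  assumes pd: "posdef SX"
    and aff: "\<And>z. \<exists>c d. AE \<omega> in M. (if Z 0 \<omega> = z then 1 else 0) = c + d \<bullet> X 0 \<omega>"
  shows "psd (Vm M (Y 0) (X 0) (Z 0) pv Om B - Vm M (Y 0) (X 0) (Z 0) pv Om \<beta>M)"
proof (rule psdI)
  show "(Vm M (Y 0) (X 0) (Z 0) pv Om B - Vm M (Y 0) (X 0) (Z 0) pv Om \<beta>M) $ i $ j
      = (Vm M (Y 0) (X 0) (Z 0) pv Om B - Vm M (Y 0) (X 0) (Z 0) pv Om \<beta>M) $ j $ i" for i j
    by (simp add: Vm_sym[of _ i j])
  fix s :: "real^'k"
  let ?b = "col B" and ?\<beta> = "col \<beta>M"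
  let ?e = "\<lambda>t. rres (?\<beta> t) t"
  define c where "c t = xres (?\<beta> t - ?b t)" for t
  have sc: "sqint (c t)" for t unfolding c_def by (rule sqint_xres)
  have r_eq: "rres (?b t) t = (\<lambda>x. ?e t x + c t x)" for t
    by (auto simp: fun_eq_iff rres_def c_def xres_diff)
  have e0: "cmean (?e t) z = 0" for t z by (rule cmean_beta_zero[OF pd aff])
  have mr: "cmean (rres (?b t) t) z = cmean (c t) z" for t z
    unfolding r_eq by (simp add: cmean_add sqint_rres sc e0)
  have ec: "E2 (c t) (?e t) = 0" for t unfolding c_def by (rule E2_beta_resid[OF pd])
  have E2r: "E2 (rres (?b t) t) (rres (?b t) t) = E2 (?e t) (?e t) + E2 (c t) (c t)" for t
  proof -
    have "E2 (rres (?b t) t) (rres (?b t) t) = E2 (?e t) (?e t) + E2 (c t) (?e t) + (E2 (?e t) (c t) + E2 (c t) (c t))"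
      unfolding r_eq
      by (simp only: E2_add_right[OF sqint_add[OF sqint_rres sc] sqint_rres sc] E2_add_left[OF sqint_rres sqint_rres sc] E2_add_left[OF sc sqint_rres sc])
    then show ?thesis using ec[of t] E2_commute[of "?e t" "c t"] by simp
  qed
  have B2r: "B2 (rres (?b t) t) (rres (?b t) t) = B2 (c t) (c t)" for t by (simp add: B2_def mr)
  have B2e: "B2 (?e t) (?e t) = 0" for t by (simp add: B2_def e0)
  define cs where "cs x = (\<Sum>t\<in>UNIV. s $ t * c t x)" for x
  have scs: "sqint cs" unfolding cs_def[abs_def] by (intro sqint_sum sqint_cmult sc) auto
  have Kc: "cs = (\<lambda>x. Kf ?\<beta> s x - Kf ?b s x)"
    by (auto simp: fun_eq_iff cs_def Kf_def c_def xres_diff right_diff_distrib sum_subtractf)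
  have B2rf: "B2 (rf ?b s) (rf ?b s) = B2 cs cs"
  proof -
    have "cmean (rf ?b s) z = cmean cs z" for z
      unfolding cmean_rf mr cs_def[abs_def] by (rule cmean_sum[symmetric]) (auto intro: sc)
    then show ?thesis by (simp add: B2_def)
  qed
  have B2rb: "B2 (rf ?\<beta> s) (rf ?\<beta> s) = 0" by (simp add: B2_def cmean_rf e0)
  have E2cs: "E2 cs cs = E2 (Kf ?\<beta> s) (Kf ?\<beta> s) - 2 * E2 (Kf ?b s) (Kf ?\<beta> s) + E2 (Kf ?b s) (Kf ?b s)"
    unfolding Kc
    by (simp add: E2_diff_right E2_diff_left sqint_diff sqint_Kf E2_commute[of "Kf ?\<beta> s" "Kf ?b s"])
  have ob: "omq ?\<beta> s = 0" by (simp add: omq_eq e0)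
  have "s \<bullet> ((Vm M (Y 0) (X 0) (Z 0) pv Om B - Vm M (Y 0) (X 0) (Z 0) pv Om \<beta>M) *v s)
     = (dq ?b s - dq ?\<beta> s) - E2 cs cs + B2 cs cs + omq ?b s"
    unfolding matrix_vector_mult_diff_rdistrib inner_diff_right Vm_form B2rf B2rb E2cs ob by simp
  also have "dq ?b s - dq ?\<beta> s = (\<Sum>t\<in>UNIV. (s $ t)\<^sup>2 / pv $ t * E2 (resid (c t)) (resid (c t)))"
    unfolding dq_def sum_subtractf[symmetric]
    by (intro sum.cong refl) (simp add: E2r B2r B2e E2_resid sc algebra_simps)
  also have "(\<Sum>t\<in>UNIV. (s $ t)\<^sup>2 / pv $ t * E2 (resid (c t)) (resid (c t))) - E2 cs cs + B2 cs cs + omq ?b s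
     = (\<Sum>t\<in>UNIV. (s $ t)\<^sup>2 / pv $ t * E2 (resid (c t)) (resid (c t))) - E2 (resid cs) (resid cs) + omq ?b s"
    by (simp add: E2_resid scs)
  also have "\<dots> \<ge> 0"
  proof -
    have "E2 (resid cs) (resid cs) \<le> (\<Sum>t\<in>UNIV. (s $ t)\<^sup>2 / pv $ t * E2 (resid (c t)) (resid (c t)))"
    proof -
      have int: "integrable M (\<lambda>\<omega>. (s $ t)\<^sup>2 / pv $ t * (resid (c t) (unit 0 \<omega>) * resid (c t) (unit 0 \<omega>)))" for t
        by (intro integrable_mult_right sqint_prod sqint_resid sc)
      have "E2 (resid cs) (resid cs) \<le> (\<integral>\<omega>. (\<Sum>t\<in>UNIV. (s $ t)\<^sup>2 / pv $ t * (resid (c t) (unit 0 \<omega>) * resid (c t) (unit 0 \<omega>))) \<partial>M)"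
        unfolding E2_def
      proof (rule integral_mono)
        show "integrable M (\<lambda>\<omega>. resid cs (unit 0 \<omega>) * resid cs (unit 0 \<omega>))" by (intro sqint_prod sqint_resid scs)
        show "integrable M (\<lambda>\<omega>. \<Sum>t\<in>UNIV. (s $ t)\<^sup>2 / pv $ t * (resid (c t) (unit 0 \<omega>) * resid (c t) (unit 0 \<omega>)))"
          by (intro Bochner_Integration.integrable_sum int)
        fix \<omega>
        define d where "d t = resid (c t) (unit 0 \<omega>)" for t
        have rs: "resid cs (unit 0 \<omega>) = (\<Sum>t\<in>UNIV. sqrt (pv $ t) * (s $ t * d t / sqrt (pv $ t)))"
        proof -
          have "resid cs (unit 0 \<omega>) = (\<Sum>t\<in>UNIV. s $ t * d t)"
            unfolding cs_def[abs_def] d_def by (rule resid_sum) (auto intro: sc)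
          also have "\<dots> = (\<Sum>t\<in>UNIV. sqrt (pv $ t) * (s $ t * d t / sqrt (pv $ t)))"
          proof (intro sum.cong refl)
            fix t have "sqrt (pv $ t) \<noteq> 0" using pi_pos[of t] by simp
            then show "s $ t * d t = sqrt (pv $ t) * (s $ t * d t / sqrt (pv $ t))" by simp
          qed
          finally show ?thesis .
        qed
        have "(resid cs (unit 0 \<omega>))\<^sup>2 \<le> (\<Sum>t\<in>UNIV. (sqrt (pv $ t))\<^sup>2) * (\<Sum>t\<in>UNIV. (s $ t * d t / sqrt (pv $ t))\<^sup>2)"
          unfolding rs by (rule Cauchy_Schwarz_ineq_sum)
        also have "(\<Sum>t\<in>UNIV. (sqrt (pv $ t))\<^sup>2) = 1"
          using pi_sum pi_pos by (simp add: less_imp_le)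
        also have "1 * (\<Sum>t\<in>UNIV. (s $ t * d t / sqrt (pv $ t))\<^sup>2) = (\<Sum>t\<in>UNIV. (s $ t)\<^sup>2 / pv $ t * (d t * d t))"
          using pi_pos by (simp add: power_divide power_mult_distrib less_imp_le power2_eq_square[of "d _"])
        finally show "resid cs (unit 0 \<omega>) * resid cs (unit 0 \<omega>) \<le> (\<Sum>t\<in>UNIV. (s $ t)\<^sup>2 / pv $ t * (resid (c t) (unit 0 \<omega>) * resid (c t) (unit 0 \<omega>)))"
          by (simp add: power2_eq_square d_def)
      qed
      also have "\<dots> = (\<Sum>t\<in>UNIV. (s $ t)\<^sup>2 / pv $ t * E2 (resid (c t)) (resid (c t)))"
        unfolding E2_def by (subst Bochner_Integration.integral_sum) (simp_all only: int integral_mult_right_zero)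
      finally show ?thesis .
    qed
    then show ?thesis using omq_nonneg[of ?b s] by linarith
  qed
  finally show "0 \<le> s \<bullet> ((Vm M (Y 0) (X 0) (Z 0) pv Om B - Vm M (Y 0) (X 0) (Z 0) pv Om \<beta>M) *v s)" .
qed

lemma Rm_beta_zero:
  assumes pd: "posdef SX"
    and aff: "\<And>z. \<exists>c d. AE \<omega> in M. (if Z 0 \<omega> = z then 1 else 0) = c + d \<bullet> X 0 \<omega>"
  shows "Rm M (Y 0) (X 0) (Z 0) pv \<beta>M z = 0"
  unfolding Rm_eq cmean_beta_zero[OF pd aff] by (simp add: diagm_def vec_eq_iff)

lemma conv_normal_thetahat:
  assumes pd: "posdef SX"
    and bm[measurable]: "\<And>n t. bh n t \<in> borel_measurable M"
    and bconv: "\<And>t \<epsilon>. 0 < \<epsilon> \<Longrightarrow> (\<lambda>n. prob {\<omega>\<in>space M. \<epsilon> < dist (bh n t \<omega>) (b t)}) \<longlonglongrightarrow> 0"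
  shows "conv_normal M (\<lambda>n \<omega>. sqrt (real n) *\<^sub>R (thetahat Y X A bh n \<omega> - \<theta>))
           (Vm M (Y 0) (X 0) (Z 0) pv Om (\<chi> j t. b t $ j))"
proof (rule conv_normal_char[OF prob_space_axioms])
  have col: "col (\<chi> j t. b t $ j) = b" by (auto simp: fun_eq_iff col_def vec_eq_iff)
  show "(\<lambda>\<omega>. sqrt (real n) *\<^sub>R (thetahat Y X A bh n \<omega> - \<theta>)) \<in> borel_measurable M" for n
    using measurable_thetahat[of bh n, OF bm] by measurable
  show "psd (Vm M (Y 0) (X 0) (Z 0) pv Om (\<chi> j t. b t $ j))" by (rule psd_Vm[OF pd])
  show "(\<lambda>n. \<integral>\<omega>. iexp (s \<bullet> sqrt (real n) *\<^sub>R (thetahat Y X A bh n \<omega> - \<theta>)) \<partial>M)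
     \<longlonglongrightarrow> complex_of_real (exp (- (s \<bullet> (Vm M (Y 0) (X 0) (Z 0) pv Om (\<chi> j t. b t $ j) *v s)) / 2))" for s
    unfolding Vm_form_avar[OF pd] col by (rule char_thetahat[OF bm bconv])
qed

end

theorem theorem3:
  fixes M :: "'a measure"
    and Y :: "nat \<Rightarrow> 'a \<Rightarrow> real^'k"
    and Z :: "nat \<Rightarrow> 'a \<Rightarrow> 'z::finite"
    and X :: "nat \<Rightarrow> 'a \<Rightarrow> real^'p"
    and A :: "nat \<Rightarrow> nat \<Rightarrow> 'a \<Rightarrow> 'k"
    and pv :: "real^'k"
    and Om :: "'z \<Rightarrow> real^'k^'k"
    and bhat :: "nat \<Rightarrow> 'k \<Rightarrow> 'a \<Rightarrow> real^'p"
    and b :: "'k \<Rightarrow> real^'p"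
  assumes P: "prob_space M"
    \<comment> \<open>(C1)\<close>
    and meas: "\<And>i. (\<lambda>\<omega>. (Y i \<omega>, Z i \<omega>, X i \<omega>))
                 \<in> M \<rightarrow>\<^sub>M (borel \<Otimes>\<^sub>M count_space UNIV \<Otimes>\<^sub>M borel)"
    and indep: "prob_space.indep_vars M (\<lambda>_. borel \<Otimes>\<^sub>M count_space UNIV \<Otimes>\<^sub>M borel)
                 (\<lambda>i \<omega>. (Y i \<omega>, Z i \<omega>, X i \<omega>)) UNIV"
    and ident: "\<And>i. distr M (borel \<Otimes>\<^sub>M count_space UNIV \<Otimes>\<^sub>M borel) (\<lambda>\<omega>. (Y i \<omega>, Z i \<omega>, X i \<omega>))
                   = distr M (borel \<Otimes>\<^sub>M count_space UNIV \<Otimes>\<^sub>M borel) (\<lambda>\<omega>. (Y 0 \<omega>, Z 0 \<omega>, X 0 \<omega>))"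
    and mom_Y: "\<And>t. integrable M (\<lambda>\<omega>. (Y 0 \<omega> $ t)\<^sup>2)"
    and mom_X: "\<And>j. integrable M (\<lambda>\<omega>. (X 0 \<omega> $ j)\<^sup>2)"
    and SigmaX_pd: "posdef (SigmaX M (X 0))"
    and pi_pos: "\<And>t. 0 < pv $ t \<and> pv $ t < 1"
    and pi_sum: "(\<Sum>t\<in>UNIV. pv $ t) = 1"
    and A_meas: "\<And>n i. A n i \<in> M \<rightarrow>\<^sub>M count_space UNIV"
    \<comment> \<open>(B2)(i)\<close>
    and C2i: "\<And>n. cond_indep M (\<lambda>\<omega>. map (\<lambda>i. Z i \<omega>) [0..<n])
                 {(\<lambda>\<omega>. map (\<lambda>i. A n i \<omega>) [0..<n]) -` S \<inter> space M | S. True}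
                 (sigma_sets (space M) (\<Union>i\<in>{..<n}.
                    {(\<lambda>\<omega>. (Y i \<omega>, X i \<omega>)) -` U \<inter> space M | U.
                       U \<in> sets (borel :: ((real^'k) \<times> (real^'p)) measure)}))"
    \<comment> \<open>(B2)(ii)\<close>
    and C2ii: "AE \<omega> in M. \<forall>z t.
                 (\<lambda>n. real (card {i. i < n \<and> Z i \<omega> = z \<and> A n i \<omega> = t})
                        / real (card {i. i < n \<and> Z i \<omega> = z})) \<longlonglongrightarrow> pv $ t"
    \<comment> \<open>(C3)\<close>
    and C3: "cond_conv_normal M (\<lambda>n \<omega>. map (\<lambda>i. Z i \<omega>) [0..<n])
               (\<lambda>n \<omega>. \<chi> zt. sqrt (real n) *
                   (real (card {i. i < n \<and> Z i \<omega> = fst zt \<and> A n i \<omega> = snd zt})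
                      / real (card {i. i < n \<and> Z i \<omega> = fst zt}) - pv $ snd zt))
               (\<chi> zt zt'. if fst zt = fst zt'
                  then Om (fst zt) $ snd zt $ snd zt'
                        / measure M {\<omega>\<in>space M. Z 0 \<omega> = fst zt}
                  else 0)"
    \<comment> \<open>I(Z = z) is an affine function of X\<close>
    and affine: "\<And>z. \<exists>c d. AE \<omega> in M. (if Z 0 \<omega> = z then 1 else 0) = c + d \<bullet> X 0 \<omega>"
    \<comment> \<open>bhat_t \<rightarrow> b_t in probability\<close>
    and bhat_meas: "\<And>n t. bhat n t \<in> borel_measurable M"
    and bhat_conv: "\<And>t \<epsilon>. \<epsilon> > 0 \<Longrightarrow>
               (\<lambda>n. measure M {\<omega>\<in>space M. \<epsilon> < dist (bhat n t \<omega>) (b t)}) \<longlonglongrightarrow> 0"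
  shows "conv_normal M (\<lambda>n \<omega>. sqrt (real n) *\<^sub>R (thetahat Y X A bhat n \<omega> - theta M (Y 0)))
           (Vm M (Y 0) (X 0) (Z 0) pv Om (\<chi> j t. b t $ j))
       \<and> (\<forall>z. 0 < measure M {\<omega>\<in>space M. Z 0 \<omega> = z}
              \<longrightarrow> Rm M (Y 0) (X 0) (Z 0) pv (betaM M (Y 0) (X 0)) z = 0)
       \<and> Vm M (Y 0) (X 0) (Z 0) pv Om (betaM M (Y 0) (X 0))
           = V_SR M (Y 0) (X 0) pv (betaM M (Y 0) (X 0))
       \<and> (\<forall>B. psd (Vm M (Y 0) (X 0) (Z 0) pv Om B
                  - Vm M (Y 0) (X 0) (Z 0) pv Om (betaM M (Y 0) (X 0))))"
proof -
  interpret covariate_adaptive_trial M Y Z X A pv Om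
    by (intro covariate_adaptive_trial.intro covariate_adaptive_trial_axioms.intro
        P meas indep ident mom_Y mom_X pi_pos pi_sum A_meas C2i C2ii C3)
  have R0: "Rm M (Y 0) (X 0) (Z 0) pv (betaM M (Y 0) (X 0)) z = 0" for z
    by (rule Rm_beta_zero[OF SigmaX_pd affine])
  have "Vm M (Y 0) (X 0) (Z 0) pv Om (betaM M (Y 0) (X 0)) = V_SR M (Y 0) (X 0) pv (betaM M (Y 0) (X 0))"
    by (simp add: Vm_def R0 matrix_matrix_mult_def vec_eq_iff)
  then show ?thesis
    using conv_normal_thetahat[where bh=bhat and b=b, OF SigmaX_pd bhat_meas bhat_conv] R0 psd_Vm_diff[OF SigmaX_pd affine] by blast
qed

end
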